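(* Let $u_{\mathsf O}>0$ be fixed. Suppose that the solution $u(r)$ of the initial value problem $$-\frac1{r^2}\frac{d}{dr}\Big(r^2\frac{du}{dr}\Big)=\mathsf f(u),\qquad u=1+O(r^2)\ \text{ as } r\to+0,$$ exists and is positive on $0<r<R$, and $u(r)\to0$ as $r\to R-0$ (with $0<R<\infty$). Choose $r_\infty>R$. Then $u(r)$ can be extended onto $[0,r_\infty]$ so that the extension (regarded as a function of $(r,\zeta)\in[0,r_\infty]\times[-1,1]$ independent of $\zeta$) is an admissible solution, with parameters $\mathsf b=0$ and $u_{\mathsf O}$, of $u=\mathfrak g+\mathcal G(u)$, and satisfies condition (HL).
   Context: Notation: $a\vee b=\max(a,b)$. Equation of state (standing assumption): $P$ is a smooth function of $\rho>0$ with $P>0$, $dP/d\rho>0$ for $\rho>0$, and $P=\mathsf A\rho^\gamma(1+\Lambda(\mathsf A\rho^{\gamma-1}))$ for $\rho>0$, with constants $\mathsf A>0$, $1<\gamma<2$ and a smooth $\Lambda:\mathbb R\to\mathbb R$, $\Lambda(0)=0$. Put $\nu=1/(\gamma-1)\in(1,\infty)$. The enthalpy is $u=\int_0^\rho dP/\rho$; inverting, $\rho=\big(\frac{\gamma-1}{\gamma\mathsf A}\big)^\nu u^\nu(1+\Lambda_\rho(u))$, where $\Lambda_\rho$ is regarded as a smooth function on $\mathbb R$ with $\Lambda_\rho(0)=0$. For a parameter $u_{\mathsf O}>0$ put $\mathsf f(u)=(u\vee0)^\nu(1+\Lambda_\rho(u_{\mathsf O}u))$, with derivative $\mathsf f'(u)$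 with respect to $u$ (both depend on $u_{\mathsf O}$). Spaces, for fixed $r_\infty>0$: $\mathfrak B=\{\mathsf b\in C^1([0,r_\infty]): \mathsf b'(0)=0\}$; $\mathfrak E$ is the space of continuous functions $u(r,\zeta)$ on $[0,r_\infty]\times[-1,1]$ with $u(0,\zeta)=u(0,0)$ and $u(r,-\zeta)=u(r,\zeta)$ for all $r,\zeta$, with the sup norm. Operators: for $f\in\mathfrak E$, $$\mathcal Kf(r,\zeta)=\frac1{4\pi}\int_{-1}^1\int_0^{r_\infty}K(r,\zeta,r',\zeta')f(r',\zeta')r'^2dr'd\zeta',$$ $$K(r,\zeta,r',\zeta')=\int_0^{2\pi}\frac{d\beta}{\sqrt{r^2+r'^2-2rr'(\sqrt{1-\zeta^2}\sqrt{1-\zeta'^2}\cos\beta+\zeta\zeta')}}.$$ (Equivalently, the Newtonian potential $\frac1{4\pi}\int_{|x'|\le r_\infty}\frac{f^\flat(x')}{|x-x'|}dx'$, where $f^\flat(x)=f(|x|,x_3/|x|)$, $x\in\mathbb R^3$.) Then $\mathcal G(u)=1+\mathcal K(\mathsf f\circ u)-\mathcal K(\mathsf f\circ u)(0,0)$, with Fréchet derivative $D\mathcal G(u)h=\mathcal K(\mathsf f'\circ u\cdot h)-\mathcal K(\mathsf f'\circ u\cdot h)(0,0)$ on $\mathfrak E$. For $\mathsf b\in\mathfrak B$, $\mathfrak g(r,\zeta)=\mathsf b(r\sqrt{1-\zeta^2})$. Admissible solution with parameters $\mathsf b,u_{\mathsf O}$: a $u\in\mathfrak E$ with $u=\mathfrak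 g+\mathcal G(u)$ for which there are $r_0\in(0,r_\infty)$ and a continuous $R:[-1,1]\to(r_0,r_\infty)$ such that (a1) $\partial u/\partial r<0$ for $r_0\le r\le r_\infty$, $|\zeta|\le1$; (a2) for every $\zeta\in[-1,1]$, $u(r,\zeta)>0$ for $0\le r<R(\zeta)$, $u(R(\zeta),\zeta)=0$, and $u(r,\zeta)<0$ for $R(\zeta)<r\le r_\infty$. Condition (HL) for $u\in\mathfrak E$: if $h\in\mathfrak E$ and $h=D\mathcal G(u)h$, then $h=0$. *)

theory Defs
  imports "HOL-Analysis.Analysis" "HOL-Library.Landau_Symbols"
begin

text \<open>
  Infinite differentiability on an \<^emph>\<open>open\<close> set of reals; since \<^const>\<open>deriv\<close> is local, values
  outside \<open>S\<close> play no role.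
\<close>

definition smooth_on :: "real set \<Rightarrow> (real \<Rightarrow> real) \<Rightarrow> bool" where
  "smooth_on S f \<longleftrightarrow> (\<forall>n. \<forall>x\<in>S. ((deriv ^^ n) f) differentiable (at x))"

definition equation_of_state :: "real \<Rightarrow> real \<Rightarrow> (real \<Rightarrow> real) \<Rightarrow> (real \<Rightarrow> real) \<Rightarrow> bool" where
  "equation_of_state A \<gamma> \<Lambda> P \<longleftrightarrow>
     0 < A \<and> 1 < \<gamma> \<and> \<gamma> < 2 \<and> smooth_on UNIV \<Lambda> \<and> \<Lambda> 0 = 0 \<and> smooth_on {0<..} P \<and>
     (\<forall>\<rho>>0. P \<rho> > 0 \<and> deriv P \<rho> > 0 \<and> P \<rho> = A * \<rho> powr \<gamma> * (1 + \<Lambda> (A * \<rho> powr (\<gamma> - 1))))"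

definition enthalpy :: "(real \<Rightarrow> real) \<Rightarrow> real \<Rightarrow> real" where
  "enthalpy P \<rho> = (LBINT s:{0<..\<rho>}. deriv P s / s)"

text \<open>
  \<open>\<Lambda>\<^sub>\<rho>\<close> describes the inverse function of the enthalpy. It is only determined on positive
  arguments; its values at negative arguments are those of any smooth extension.
\<close>

definition enthalpy_inversion ::
    "real \<Rightarrow> real \<Rightarrow> (real \<Rightarrow> real) \<Rightarrow> (real \<Rightarrow> real) \<Rightarrow> bool" where
  "enthalpy_inversion A \<gamma> P \<Lambda>\<^sub>\<rho> \<longleftrightarrow>
     smooth_on UNIV \<Lambda>\<^sub>\<rho> \<and> \<Lambda>\<^sub>\<rho> 0 = 0 \<and>
     (\<forall>\<rho>>0. \<rho> = ((\<gamma> - 1) / (\<gamma> * A)) powr (1 / (\<gamma> - 1)) * enthalpy P \<rho> powr (1 / (\<gamma> - 1))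
                  * (1 + \<Lambda>\<^sub>\<rho> (enthalpy P \<rho>)))"

definition f_source :: "real \<Rightarrow> (real \<Rightarrow> real) \<Rightarrow> real \<Rightarrow> real \<Rightarrow> real" where
  "f_source \<nu> \<Lambda>\<^sub>\<rho> u\<^sub>O u = max u 0 powr \<nu> * (1 + \<Lambda>\<^sub>\<rho> (u\<^sub>O * u))"

text \<open>
  Elements of the function spaces below are total functions constrained only on \<open>[0, r_inf]\<close> resp.
  \<open>[0, r_inf] \<times> [-1, 1]\<close>; accordingly, equations between them are stated pointwise on these domains.
\<close>

definition B_space :: "real \<Rightarrow> (real \<Rightarrow> real) set" where
  "B_space r_inf = {b. \<exists>b'. continuous_on {0..r_inf} b' \<and> b' 0 = 0 \<and>
     (\<forall>x\<in>{0..r_inf}. (b has_real_derivative b' x) (at x within {0..r_inf}))}"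

definition E_space :: "real \<Rightarrow> (real \<Rightarrow> real \<Rightarrow> real) set" where
  "E_space r_inf = {u. continuous_on ({0..r_inf} \<times> {-1..1}) (\<lambda>(r, \<zeta>). u r \<zeta>) \<and>
     (\<forall>\<zeta>\<in>{-1..1}. u 0 \<zeta> = u 0 0) \<and>
     (\<forall>r\<in>{0..r_inf}. \<forall>\<zeta>\<in>{-1..1}. u r (- \<zeta>) = u r \<zeta>)}"

text \<open>
  When the circles \<open>(r, \<zeta>)\<close> and \<open>(r', \<zeta>')\<close> coincide, the mathematical kernel is infinite, whereas
  here it is \<open>0\<close> by convention. For fixed \<open>(r, \<zeta>)\<close> this concerns a null set of \<open>(r', \<zeta>')\<close> only,
  so it does not affect \<open>K_op\<close>.
\<close>

definition K_kernel :: "real \<Rightarrow> real \<Rightarrow> real \<Rightarrow> real \<Rightarrow> real" where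
  "K_kernel r \<zeta> r' \<zeta>' = (LBINT \<beta>:{0..2 * pi}.
     1 / sqrt (r\<^sup>2 + r'\<^sup>2 - 2 * r * r' * (sqrt (1 - \<zeta>\<^sup>2) * sqrt (1 - \<zeta>'\<^sup>2) * cos \<beta> + \<zeta> * \<zeta>')))"

definition K_op :: "real \<Rightarrow> (real \<Rightarrow> real \<Rightarrow> real) \<Rightarrow> real \<Rightarrow> real \<Rightarrow> real" where
  "K_op r_inf f r \<zeta> = 1 / (4 * pi) *
     (LBINT \<zeta>':{-1..1}. (LBINT r':{0..r_inf}. K_kernel r \<zeta> r' \<zeta>' * f r' \<zeta>' * r'\<^sup>2))"

definition G_op ::
    "(real \<Rightarrow> real) \<Rightarrow> real \<Rightarrow> (real \<Rightarrow> real \<Rightarrow> real) \<Rightarrow> real \<Rightarrow> real \<Rightarrow> real" where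
  "G_op f r_inf u r \<zeta> =
     1 + K_op r_inf (\<lambda>s \<eta>. f (u s \<eta>)) r \<zeta> - K_op r_inf (\<lambda>s \<eta>. f (u s \<eta>)) 0 0"

definition DG_op ::
    "(real \<Rightarrow> real) \<Rightarrow> real \<Rightarrow> (real \<Rightarrow> real \<Rightarrow> real) \<Rightarrow> (real \<Rightarrow> real \<Rightarrow> real) \<Rightarrow> real \<Rightarrow> real \<Rightarrow> real"
where
  "DG_op f r_inf u h r \<zeta> =
     K_op r_inf (\<lambda>s \<eta>. deriv f (u s \<eta>) * h s \<eta>) r \<zeta> - K_op r_inf (\<lambda>s \<eta>. deriv f (u s \<eta>) * h s \<eta>) 0 0"

definition g_fun :: "(real \<Rightarrow> real) \<Rightarrow> real \<Rightarrow> real \<Rightarrow> real" where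
  "g_fun b r \<zeta> = b (r * sqrt (1 - \<zeta>\<^sup>2))"

text \<open>
  Here \<open>f\<close> stands for the function \<open>f_source \<nu> \<Lambda>\<^sub>\<rho> u\<^sub>O\<close>. The radial derivative at \<open>r = r_inf\<close> is the
  one-sided one.
\<close>

definition admissible_solution ::
    "(real \<Rightarrow> real) \<Rightarrow> real \<Rightarrow> (real \<Rightarrow> real) \<Rightarrow> (real \<Rightarrow> real \<Rightarrow> real) \<Rightarrow> bool" where
  "admissible_solution f r_inf b u \<longleftrightarrow>
     b \<in> B_space r_inf \<and> u \<in> E_space r_inf \<and>
     (\<forall>r\<in>{0..r_inf}. \<forall>\<zeta>\<in>{-1..1}. u r \<zeta> = g_fun b r \<zeta> + G_op f r_inf u r \<zeta>) \<and>
     (\<exists>r\<^sub>0 R. 0 < r\<^sub>0 \<and> r\<^sub>0 < r_inf \<and> continuous_on {-1..1} R \<and> (\<forall>\<zeta>\<in>{-1..1}. R \<zeta> \<in> {r\<^sub>0<..<r_inf}) \<and>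
        (\<forall>r\<in>{r\<^sub>0..r_inf}. \<forall>\<zeta>\<in>{-1..1}.
           \<exists>D<0. ((\<lambda>s. u s \<zeta>) has_real_derivative D) (at r within {0..r_inf})) \<and>
        (\<forall>\<zeta>\<in>{-1..1}. (\<forall>r\<in>{0..<R \<zeta>}. u r \<zeta> > 0) \<and> u (R \<zeta>) \<zeta> = 0 \<and>
           (\<forall>r\<in>{R \<zeta><..r_inf}. u r \<zeta> < 0)))"

definition cond_HL :: "(real \<Rightarrow> real) \<Rightarrow> real \<Rightarrow> (real \<Rightarrow> real \<Rightarrow> real) \<Rightarrow> bool" where
  "cond_HL f r_inf u \<longleftrightarrow>
     (\<forall>h\<in>E_space r_inf. (\<forall>r\<in>{0..r_inf}. \<forall>\<zeta>\<in>{-1..1}. h r \<zeta> = DG_op f r_inf u h r \<zeta>) \<longrightarrow>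
        (\<forall>r\<in>{0..r_inf}. \<forall>\<zeta>\<in>{-1..1}. h r \<zeta> = 0))"

definition radial_ivp_solution :: "(real \<Rightarrow> real) \<Rightarrow> real \<Rightarrow> (real \<Rightarrow> real) \<Rightarrow> bool" where
  "radial_ivp_solution f R u \<longleftrightarrow>
     (\<forall>r\<in>{0<..<R}. u differentiable (at r) \<and> (\<lambda>s. s\<^sup>2 * deriv u s) differentiable (at r) \<and>
        - (1 / r\<^sup>2) * deriv (\<lambda>s. s\<^sup>2 * deriv u s) r = f (u r)) \<and>
     (\<lambda>r. u r - 1) \<in> O[at_right 0](\<lambda>r. r\<^sup>2)"

end

theory Submission
  imports Defs
begin

text \<open>
  The solution \<open>u\<close> is extended by Newton's shell theorem. Applying the kernel to a radial density
  \<open>k\<close> gives \<open>\<K>k(r) - \<K>k(0) = m(r)/r - \<integral>\<^sub>0\<^sup>r k(s) s ds\<close> with \<open>m(r) = \<integral>\<^sub>0\<^sup>r k(s) s\<^sup>2 ds\<close>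
  (\<open>newton_radial_increment\<close>), so that the fixed point equation for a radial function \<open>U\<close> is the
  twice integrated form of the initial value problem (\<open>radial_extension\<close>). Beyond \<open>R\<close> the source
  vanishes and \<open>U\<close> is the potential of a point mass; since \<open>U' = -m/r\<^sup>2 < 0\<close> for \<open>r > 0\<close>, \<open>U\<close> is
  negative there. This yields admissibility.

  Condition (HL) says that the linearised equation \<open>h = \<K>(p h) - const\<close>, with weight
  \<open>p = f'(U) \<ge> 0\<close> positive exactly on \<open>|x| < R\<close>, has only the zero solution. The usual proof
  expands \<open>h\<close> in spherical harmonics and compares each mode of degree at least 2 with the degree 1
  mode. Here the expansion is replaced by reflections. Regard \<open>h\<close> as a function \<open>H\<close> on the ball
  and fix a vector \<open>e\<close>; let \<open>\<sigma>\<close> be the reflection in the plane orthogonal to \<open>e\<close>.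
  The difference \<open>w = H \<circ> \<sigma> - H\<close> loses the constant, so \<open>w = \<K>(p w)\<close>, and it is odd under \<open>\<sigma>\<close>.
  The derivative of \<open>U\<close> in direction \<open>-e\<close>, called \<open>z\<close>, also satisfies \<open>z = \<K>(p z)\<close>, because the
  problem is invariant under translations (\<open>newton_translation_mode\<close>); it is odd under \<open>\<sigma>\<close> and
  positive on the half space \<open>y \<bullet> e > 0\<close>. On functions odd under \<open>\<sigma>\<close> the operator
  preserves positivity on that half space (\<open>newton_odd_nonneg\<close>: the difference of the Newton
  kernel and its mirror image is positive), so \<open>z\<close> is a Perron eigenfunction, and
  pairing with \<open>z\<close> shows that \<open>w\<close> cannot change sign in the half space. But \<open>H(-x) = H(x)\<close>, hence
  \<open>w\<close> is odd under \<open>-\<sigma>\<close>, which maps the half space to itself; therefore \<open>w = 0\<close>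
  (\<open>rotation_invariant_of_newton_fixed_point\<close>). As \<open>e\<close> is arbitrary, \<open>H\<close> is radial, and a radial
  solution satisfies a Volterra equation with value 0 at the centre, so it vanishes
  by Gronwall's inequality.

  Two further ingredients are the passage from the iterated integrals of \<open>K_op\<close> to integrals
  over the ball (spherical coordinates, \<open>K_op_eq_newton\<close>), which makes all orthogonal
  maps available, and the regularity and strict monotonicity of the source term
  (\<open>source_regular\<close>). The latter uses that the enthalpy takes every positive value: otherwise
  \<open>\<Lambda>\<^sub>\<rho>\<close>, being smooth on the whole line, would bound the density.
\<close>

section \<open>Orthogonal maps and Lebesgue measure on three-space\<close>

lemma lborel_distr_orthogonal:
  fixes A :: "real^3 \<Rightarrow> real^3"
  assumes A: "orthogonal_transformation A"
  shows "distr lborel borel A = lborel"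
proof (rule sym, rule lborel_eqI)
  have lin: "linear A" by (rule orthogonal_transformation_linear[OF A])
  have meas: "A \<in> borel_measurable borel"
    by (intro borel_measurable_continuous_onI linear_continuous_on linear_conv_bounded_linear[THEN iffD1] lin)
  have bij: "bij A" by (rule orthogonal_transformation_bij[OF A])
  have orth: "orthogonal_transformation (inv A)" by (rule orthogonal_transformation_inv[OF A])
  show "sets (distr lborel borel A) = sets borel" by simp
  fix l u :: "real^3" assume le: "\<And>b. b \<in> Basis \<Longrightarrow> l \<bullet> b \<le> u \<bullet> b"
  have vim: "A -` box l u = inv A ` box l u" using bij by (rule bij_vimage_eq_inv_image)
  have bor: "A -` box l u \<in> sets borel" using measurable_sets[OF meas, of "box l u"] by simp
  have lm: "inv A ` box l u \<in> lmeasurable"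
    by (rule measurable_orthogonal_image[OF orth]) simp
  have "emeasure (distr lborel borel A) (box l u) = emeasure lborel (A -` box l u)"
    using meas by (simp add: emeasure_distr)
  also have "\<dots> = emeasure lebesgue (A -` box l u)" using bor by simp
  also have "\<dots> = ennreal (measure lebesgue (inv A ` box l u))"
    unfolding vim by (rule emeasure_eq_measure2[OF lm])
  also have "measure lebesgue (inv A ` box l u) = measure lebesgue (box l u)"
    by (rule measure_orthogonal_image[OF orth]) simp
  also have "ennreal (measure lebesgue (box l u)) = ennreal (\<Prod>b\<in>Basis. (u - l) \<bullet> b)"
    using le by (simp add: measure_lborel_box_eq inner_diff_left)
  finally show "emeasure (distr lborel borel A) (box l u) = (\<Prod>b\<in>Basis. (u - l) \<bullet> b)"  .
qed

text \<open>
  The triple is nested as \<open>((\<zeta>, s), \<beta>)\<close> so that integrating out the longitude \<open>\<beta>\<close> first leaves a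
  function of the pair \<open>(\<zeta>, s)\<close>, whose two iterated integrals are both needed: \<open>K_op\<close> integrates
  the radius first, the shell theorem the latitude first.
\<close>

definition cart :: "(real \<times> real) \<times> real \<Rightarrow> real^3" where
  "cart p = vector [fst (fst p), snd (fst p), snd p]"

lemma cart_nth [simp]: "cart p $ 1 = fst (fst p)" "cart p $ 2 = snd (fst p)" "cart p $ 3 = snd p"
  by (simp_all add: cart_def)

lemma continuous_on_vector_3 [continuous_intros]:
  fixes a b c :: "'a::topological_space \<Rightarrow> real"
  assumes "continuous_on S a" "continuous_on S b" "continuous_on S c"
  shows "continuous_on S (\<lambda>x. vector [a x, b x, c x] :: real^3)"
proof -
  have eq: "(vector [p, q, r] :: real^3) = (\<chi> i. if i = 1 then p else if i = 2 then q else r)" for p q r :: real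
    by (simp add: vec_eq_iff forall_3)
  show ?thesis unfolding eq 
  proof (intro continuous_on_vec_lambda)
    fix i :: 3
    show "continuous_on S (\<lambda>x. if i = 1 then a x else if i = 2 then b x else c x)"
      using assms by (cases "i = 1"; cases "i = 2") simp_all
  qed
qed

lemma cart_measurable [measurable]: "cart \<in> borel_measurable borel"
  unfolding cart_def by (intro borel_measurable_continuous_onI continuous_intros)

lemma Basis_vec3: "(Basis :: (real^3) set) = {axis 1 1, axis 2 1, axis 3 1}"
  by (auto simp: Basis_vec_def UNIV_3)

lemma Basis_triple: "(Basis :: ((real\<times>real)\<times>real) set) = {((1,0),0), ((0,1),0), ((0,0),1)}"
  by (auto simp: Basis_prod_def zero_prod_def)

lemma lborel_distr_cart: "distr lborel borel cart = lborel"
proof (rule sym, rule lborel_eqI)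
  show "sets (distr lborel borel cart) = sets borel" by simp
  fix l u :: "real^3" assume le: "\<And>b. b \<in> Basis \<Longrightarrow> l \<bullet> b \<le> u \<bullet> b"
  have le': "l$1 \<le> u$1" "l$2 \<le> u$2" "l$3 \<le> u$3"
    using le[of "axis 1 1"] le[of "axis 2 1"] le[of "axis 3 1"] by (auto simp: Basis_vec3 inner_axis)
  have ne: "axis 1 1 \<noteq> (axis 2 1 :: real^3)" "axis 1 1 \<noteq> (axis 3 1 :: real^3)" "axis 2 1 \<noteq> (axis 3 1 :: real^3)"
    by (auto simp: axis_eq_axis)
  have vim: "cart -` box l u = box ((l$1, l$2), l$3) ((u$1, u$2), u$3)"
    by (auto simp: box_def Basis_triple Basis_vec3 inner_axis)
  have "emeasure (distr lborel borel cart) (box l u) = emeasure lborel (cart -` box l u)"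
    by (subst emeasure_distr) auto
  also have "\<dots> = ennreal ((u$1 - l$1) * ((u$2 - l$2) * (u$3-l$3)))"
    unfolding vim using le' by (subst emeasure_lborel_box_eq) (auto simp: Basis_triple)
  also have "(u$1 - l$1) * ((u$2 - l$2) * (u$3-l$3)) = (\<Prod>b\<in>Basis. (u - l) \<bullet> b)"
    using ne by (simp add: Basis_vec3 inner_axis)
  finally show "emeasure (distr lborel borel cart) (box l u) = (\<Prod>b\<in>Basis. (u - l) \<bullet> b)" .
qed

section \<open>Spherical coordinates\<close>

text \<open>
  The coordinates of the argument are the sine of the latitude, the radius and the longitude.
\<close>

definition spherical :: "real^3 \<Rightarrow> real^3" where
  "spherical w = vector [w$2 * sqrt (1 - (w$1)\<^sup>2) * cos (w$3), w$2 * sqrt (1 - (w$1)\<^sup>2) * sin (w$3), w$2 * w$1]"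

text \<open>
  The Jacobian of \<open>spherical\<close>, with \<open>q\<close> the cosine of the latitude.
\<close>

definition spherical_deriv :: "real^3 \<Rightarrow> real^3 \<Rightarrow> real^3" where
  "spherical_deriv w h = (let q = sqrt (1 - (w$1)\<^sup>2) in vector [
      (h$2 * q - w$2 * (w$1 * h$1 / q)) * cos (w$3) - w$2 * q * sin (w$3) * h$3,
      (h$2 * q - w$2 * (w$1 * h$1 / q)) * sin (w$3) + w$2 * q * cos (w$3) * h$3,
      h$2 * w$1 + w$2 * h$1])"

lemma spherical_has_derivative:
  assumes "\<bar>w$1\<bar> < 1"
  shows "(spherical has_derivative spherical_deriv w) (at w within S)"
proof -
  have pos: "0 < 1 - (w$1)\<^sup>2" using assms by (simp add: abs_square_less_1)
  have nth: "((\<lambda>w::real^3. w $ i) has_derivative (\<lambda>h. h $ i)) (at w within S)" for i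
    by (rule bounded_linear.has_derivative[OF bounded_linear_vec_nth has_derivative_ident])
  have q: "((\<lambda>w::real^3. sqrt (1 - (w$1)\<^sup>2)) has_derivative (\<lambda>h. - (w$1 * h$1 / sqrt (1 - (w$1)\<^sup>2)))) (at w within S)"
    using pos by (auto intro!: derivative_eq_intros nth simp: field_simps)
  have vec: "(vector [p, q, r] :: real^3) = p *\<^sub>R axis 1 1 + q *\<^sub>R axis 2 1 + r *\<^sub>R axis 3 1" for p q r :: real
    by (simp add: vec_eq_iff forall_3 axis_def)
  show ?thesis
    unfolding spherical_def[abs_def] spherical_deriv_def[abs_def] Let_def vec
    by (rule derivative_eq_intros nth q refl | simp add: fun_eq_iff)+
       (simp add: algebra_simps)
qed

lemma det_spherical:
  assumes "\<bar>w$1\<bar> < 1"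
  shows "\<bar>det (matrix (spherical_deriv w))\<bar> = (w$2)\<^sup>2"
proof -
  define q where "q = sqrt (1 - (w$1)\<^sup>2)"
  define c where "c = cos (w$3)"
  define s where "s = sin (w$3)"
  have cs: "c\<^sup>2 + s\<^sup>2 = 1" by (simp add: c_def s_def)
  have q: "q > 0" "q\<^sup>2 = 1 - (w$1)\<^sup>2" using assms by (auto simp: q_def abs_square_less_1 abs_square_le_1)
  have "det (matrix (spherical_deriv w)) = (w$2)\<^sup>2 * ((w$1)\<^sup>2 + q\<^sup>2) * (c\<^sup>2 + s\<^sup>2)"
    unfolding det_3 matrix_def spherical_deriv_def Let_def q_def[symmetric] c_def[symmetric] s_def[symmetric]
    using q(1) by (simp add: axis_def power2_eq_square field_simps)
  then show ?thesis by (simp add: cs q)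
qed

definition spherical_box :: "real \<Rightarrow> (real^3) set" where
  "spherical_box \<rho> = {w. -1 < w$1 \<and> w$1 < 1 \<and> 0 < w$2 \<and> w$2 < \<rho> \<and> 0 < w$3 \<and> w$3 < 2 * pi}"

lemma cos_sin_inj_on_period:
  assumes "cos a = cos b" "sin a = sin b" "0 < a" "a < 2 * pi" "0 < b" "b < 2 * pi"
  shows "a = b"
proof -
  have "cos (a - b) = 1" by (simp add: cos_diff assms(1,2) flip: power2_eq_square)
  then obtain n :: int where n: "a - b = of_int n * 2 * pi" using cos_one_2pi_int by blast
  have "\<bar>of_int n * 2 * pi\<bar> < 2 * pi" using assms(3-) unfolding n[symmetric] by linarith
  then have "\<bar>real_of_int n\<bar> < 1" by (simp add: abs_mult)
  then have "n = 0" by linarith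
  with n show ?thesis by simp
qed

lemma norm_vec3: "norm (x :: real^3) = sqrt ((x$1)\<^sup>2 + (x$2)\<^sup>2 + (x$3)\<^sup>2)"
  by (simp add: norm_vec_def L2_set_def sum_3)

lemma spherical_nth [simp]: 
  "spherical w $ 1 = w$2 * sqrt (1 - (w$1)\<^sup>2) * cos (w$3)"
  "spherical w $ 2 = w$2 * sqrt (1 - (w$1)\<^sup>2) * sin (w$3)"
  "spherical w $ 3 = w$2 * w$1"
  by (simp_all add: spherical_def)

lemma norm_spherical:
  assumes "\<bar>w$1\<bar> \<le> 1" "0 \<le> w$2" shows "norm (spherical w) = w$2"
proof -
  have "(w$1)\<^sup>2 \<le> 1" using assms(1) by (simp add: abs_square_le_1)
  then have "(spherical w $ 1)\<^sup>2 + (spherical w $ 2)\<^sup>2 + (spherical w $ 3)\<^sup>2 = (w$2)\<^sup>2"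
    by (simp add: power_mult_distrib sin_squared_eq algebra_simps)
  then show ?thesis using assms(2) by (simp add: norm_vec3)
qed

lemma inj_on_spherical: "inj_on spherical (spherical_box \<rho>)"
proof (rule inj_onI)
  fix v w assume v: "v \<in> spherical_box \<rho>" and w: "w \<in> spherical_box \<rho>" and eq: "spherical v = spherical w"
  have 2: "v$2 = w$2" using norm_spherical[of v] norm_spherical[of w] eq v w
    by (simp add: spherical_box_def abs_le_iff)
  have p: "w$2 > 0" using w by (simp add: spherical_box_def)
  have 1: "v$1 = w$1" using arg_cong[OF eq, of "\<lambda>x. x$3"] 2 p by simp
  have "(w$1)\<^sup>2 < 1" using w by (simp add: spherical_box_def abs_square_less_1 abs_less_iff)
  then have q: "w$2 * sqrt (1 - (w$1)\<^sup>2) \<noteq> 0" using p by simp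
  have cs: "cos (v$3) = cos (w$3)" "sin (v$3) = sin (w$3)"
    using arg_cong[OF eq, of "\<lambda>x. x$1"] arg_cong[OF eq, of "\<lambda>x. x$2"] q
    unfolding spherical_nth 1 2 mult_cancel_left by blast+
  have "0 < v$3" "v$3 < 2 * pi" "0 < w$3" "w$3 < 2 * pi" using v w by (simp_all add: spherical_box_def)
  with cs have "v$3 = w$3" by (rule cos_sin_inj_on_period)
  with 1 2 show "v = w" by (simp add: vec_eq_iff forall_3)
qed

text \<open>
  The open box covers the ball up to a subset of the plane \<open>y = 0\<close>, which contains the polar axis and
  the half plane of longitude 0.
\<close>

lemma spherical_image_box:
  "ball 0 \<rho> - {x. x$2 = 0} \<subseteq> spherical ` spherical_box \<rho>" "spherical ` spherical_box \<rho> \<subseteq> ball 0 \<rho>"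
proof -
  show "spherical ` spherical_box \<rho> \<subseteq> ball 0 \<rho>"
    by (auto simp: norm_spherical spherical_box_def)
  show "ball 0 \<rho> - {x. x$2 = 0} \<subseteq> spherical ` spherical_box \<rho>"
  proof
    fix x :: "real^3" assume x: "x \<in> ball 0 \<rho> - {x. x$2 = 0}"
    define r where "r = norm x"
    define d where "d = sqrt ((x$1)\<^sup>2 + (x$2)\<^sup>2)"
    have x2: "x$2 \<noteq> 0" using x by simp
    have rr: "r\<^sup>2 = (x$1)\<^sup>2 + (x$2)\<^sup>2 + (x$3)\<^sup>2" by (simp add: r_def norm_vec3)
    have dd: "d\<^sup>2 = (x$1)\<^sup>2 + (x$2)\<^sup>2" by (simp add: d_def)
    have d0: "d > 0" using x2 by (simp add: d_def add_nonneg_pos)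
    have r: "0 < r" "r < \<rho>" using x x2 by (auto simp: r_def)
    have "(x$1 / d)\<^sup>2 + (x$2 / d)\<^sup>2 = 1" using d0 by (simp add: power_divide flip: add_divide_distrib dd)
    then obtain b where b: "0 \<le> b" "b < 2 * pi" "x$1 / d = cos b" "x$2 / d = sin b"
      using sincos_total_2pi by metis
    have "b \<noteq> 0" using b(4) x2 d0 by auto
    have z: "1 - (x$3 / r)\<^sup>2 = (d / r)\<^sup>2" 
    proof -
      have "(d / r)\<^sup>2 + (x$3 / r)\<^sup>2 = ((x$1)\<^sup>2 + (x$2)\<^sup>2 + (x$3)\<^sup>2) / r\<^sup>2"
        by (simp add: power_divide dd add_divide_distrib)
      then show ?thesis using r by (simp flip: rr)
    qed
    have "(x$3 / r)\<^sup>2 < 1" using z d0 r by (smt (verit) divide_pos_pos zero_less_power)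
    then have z1: "\<bar>x$3 / r\<bar> < 1" by (simp only: abs_square_less_1)
    define w :: "real^3" where "w = vector [x$3 / r, r, b]"
    have "w \<in> spherical_box \<rho>" using z1[unfolded abs_less_iff] r b(1,2) \<open>b \<noteq> 0\<close>
      unfolding w_def spherical_box_def by simp
    moreover
    have q: "sqrt (1 - (x$3 / r)\<^sup>2) = d / r" using r d0 unfolding z by simp
    have "x$1 = d * cos b" "x$2 = d * sin b" using b(3,4) d0 by (simp_all add: field_simps)
    then have "spherical w = x" using r by (simp add: vec_eq_iff forall_3 w_def q)
    ultimately show "x \<in> spherical ` spherical_box \<rho>" by blast
  qed
qed

lemma negligible_coordinate_plane: "negligible {x::real^3. x $ i = 0}"
  using negligible_standard_hyperplane[of "axis i 1 :: real^3" 0]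
  by (simp add: inner_axis axis_in_Basis_iff)

text \<open>
  Both sides are stated as one equivalence because the substitution is used in both directions: to
  compute integrals over the ball, and to deduce that \<open>1 / |y|\<close> is integrable there.
\<close>

lemma spherical_change_of_variables:
  fixes F :: "real^3 \<Rightarrow> real"
  shows "(\<lambda>w. (w$2)\<^sup>2 * F (spherical w)) absolutely_integrable_on spherical_box \<rho> \<and>
         integral (spherical_box \<rho>) (\<lambda>w. (w$2)\<^sup>2 * F (spherical w)) = b \<longleftrightarrow>
         F absolutely_integrable_on ball 0 \<rho> \<and> integral (ball 0 \<rho>) F = b"
proof -
  let ?S = "spherical_box \<rho>"
  have "?S = box (vector [-1, 0, 0]) (vector [1, \<rho>, 2 * pi])"
    by (auto simp: spherical_box_def box_def Basis_vec3 inner_axis)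
  then have S: "?S \<in> sets lebesgue" by simp
  have "(\<lambda>w. \<bar>det (matrix (spherical_deriv w))\<bar> *\<^sub>R (vec (F (spherical w)) :: real^1)) absolutely_integrable_on ?S \<and>
        integral ?S (\<lambda>w. \<bar>det (matrix (spherical_deriv w))\<bar> *\<^sub>R vec (F (spherical w))) = (vec b :: real^1) \<longleftrightarrow>
        (\<lambda>y. vec (F y) :: real^1) absolutely_integrable_on (spherical ` ?S) \<and>
        integral (spherical ` ?S) (\<lambda>y. vec (F y) :: real^1) = vec b"
    by (rule has_absolute_integral_change_of_variables[OF S _ inj_on_spherical])
       (auto simp: spherical_box_def intro!: spherical_has_derivative)
  then have "(\<lambda>w. \<bar>det (matrix (spherical_deriv w))\<bar> * F (spherical w)) absolutely_integrable_on ?S \<and>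
        integral ?S (\<lambda>w. \<bar>det (matrix (spherical_deriv w))\<bar> * F (spherical w)) = b \<longleftrightarrow>
        F absolutely_integrable_on (spherical ` ?S) \<and> integral (spherical ` ?S) F = b"
    by (auto simp: absolutely_integrable_on_1_iff integral_on_1_eq vec_eq_iff)
  also have "(\<lambda>w. \<bar>det (matrix (spherical_deriv w))\<bar> * F (spherical w)) absolutely_integrable_on ?S \<longleftrightarrow>
     (\<lambda>w. (w$2)\<^sup>2 * F (spherical w)) absolutely_integrable_on ?S"
    by (intro set_integrable_cong) (auto simp: det_spherical spherical_box_def)
  also have "integral ?S (\<lambda>w. \<bar>det (matrix (spherical_deriv w))\<bar> * F (spherical w)) =
     integral ?S (\<lambda>w. (w$2)\<^sup>2 * F (spherical w))"
    by (intro integral_cong) (auto simp: det_spherical spherical_box_def)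
  also have "F absolutely_integrable_on (spherical ` ?S) \<longleftrightarrow> F absolutely_integrable_on ball 0 \<rho>"
    by (rule absolutely_integrable_spike_set_eq)
       (use spherical_image_box[of \<rho>] in \<open>auto intro!: negligible_subset[OF negligible_coordinate_plane[of 2]]\<close>)
  also have "integral (spherical ` ?S) F = integral (ball 0 \<rho>) F"
    by (rule integral_spike_set)
       (use spherical_image_box[of \<rho>] in \<open>auto intro!: negligible_subset[OF negligible_coordinate_plane[of 2]]\<close>)
  finally show ?thesis .
qed

lemma AE_lborel_negligible: "N \<in> sets borel \<Longrightarrow> negligible N \<Longrightarrow> AE x in lborel. x \<notin> N"
  by (rule AE_not_in) (simp add: negligible_iff_null_sets null_sets_completion_iff)

lemma absolutely_integrable_on_lborel_iff:
  fixes F :: "'a::euclidean_space \<Rightarrow> real"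
  assumes [measurable]: "F \<in> borel_measurable borel" "S \<in> sets borel"
  shows "F absolutely_integrable_on S \<longleftrightarrow> integrable lborel (\<lambda>x. indicator S x * F x)"
    and "F absolutely_integrable_on S \<Longrightarrow> integral S F = (LBINT x. indicator S x * F x)"
proof -
  have "(\<lambda>x. indicator S x *\<^sub>R F x) \<in> borel_measurable lborel" by simp
  then show "F absolutely_integrable_on S \<longleftrightarrow> integrable lborel (\<lambda>x. indicator S x * F x)"
    by (simp add: set_integrable_def integrable_completion)
  show "integral S F = (LBINT x. indicator S x * F x)" if "F absolutely_integrable_on S"
    using set_lebesgue_integral_eq_integral(2)[OF that]
    by (simp add: set_lebesgue_integral_def integral_completion)
qed

definition sph_domain :: "real \<Rightarrow> ((real \<times> real) \<times> real) set" where
  "sph_domain \<rho> = ({-1..1} \<times> {0..\<rho>}) \<times> {0..2 * pi}"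

lemma sph_domain_borel [measurable]: "sph_domain \<rho> \<in> sets borel"
  by (auto simp: sph_domain_def intro!: borel_closed closed_Times)

lemma spherical_measurable [measurable]: "spherical \<in> borel_measurable borel"
  unfolding spherical_def[abs_def] by (intro borel_measurable_continuous_onI continuous_intros)

lemma spherical_lborel_has_integral:
  fixes F :: "real^3 \<Rightarrow> real"
  assumes F [measurable]: "F \<in> borel_measurable borel"
  shows "integrable lborel (\<lambda>p. indicator (sph_domain \<rho>) p * ((snd (fst p))\<^sup>2 * F (spherical (cart p)))) \<and>
         (LBINT p. indicator (sph_domain \<rho>) p * ((snd (fst p))\<^sup>2 * F (spherical (cart p)))) = b \<longleftrightarrow>
         integrable lborel (\<lambda>y. indicator (cball 0 \<rho>) y * F y) \<and> 
         (LBINT y. indicator (cball 0 \<rho>) y * F y) = b"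
proof -
  let ?S = "spherical_box \<rho>" and ?G = "\<lambda>w. (w$2)\<^sup>2 * F (spherical w)"
  let ?I = "\<lambda>w. indicator ?S w * ?G w"
  have S: "?S = box (vector [-1, 0, 0]) (vector [1, \<rho>, 2 * pi])"
    by (auto simp: spherical_box_def box_def Basis_vec3 inner_axis)
  have [measurable]: "?S \<in> sets borel" unfolding S by simp
  have G [measurable]: "?G \<in> borel_measurable borel" by measurable
  \<comment> \<open>Passing from the open box and the open ball to their closures changes null sets only.\<close>
  have "negligible (sphere 0 \<rho> :: (real^3) set)" by (rule negligible_sphere)
  then have "AE y :: real^3 in lborel. y \<notin> sphere 0 \<rho>"
    by (intro AE_lborel_negligible) auto
  then have ae1: "AE y in lborel. indicator (ball 0 \<rho>) y * F y = indicator (cball 0 \<rho>) y * F y"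
    by eventually_elim (auto simp: indicator_def)
  let ?C = "cbox (vector [-1, 0, 0]) (vector [1, \<rho>, 2 * pi]) :: (real^3) set"
  have ae2': "AE w in lborel. w \<notin> ?C - ?S"
    unfolding S by (intro AE_lborel_negligible negligible_frontier_interval) auto
  have ae2: "AE w in distr lborel borel cart. ?I w = indicator ?C w * ?G w"
    unfolding lborel_distr_cart using ae2'
    by eventually_elim (use box_subset_cbox in \<open>auto simp: indicator_def S\<close>)
  have C: "indicator ?C (cart p) = (indicator (sph_domain \<rho>) p :: real)" for p
    by (cases p) (auto simp: indicator_def sph_domain_def mem_box Basis_vec3 inner_axis)
  have m: "(\<lambda>y. indicator (ball 0 \<rho>) y * F y) \<in> borel_measurable lborel"
    "(\<lambda>y. indicator (cball 0 \<rho>) y * F y) \<in> borel_measurable lborel"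
    using F by (auto intro!: borel_measurable_times borel_measurable_indicator)
  have 1: "integrable lborel (\<lambda>y. indicator (ball 0 \<rho>) y * F y) \<longleftrightarrow> integrable lborel (\<lambda>y. indicator (cball 0 \<rho>) y * F y)"
    by (rule integrable_cong_AE[OF m ae1])
  have 2: "(LBINT y. indicator (ball 0 \<rho>) y * F y) = (LBINT y. indicator (cball 0 \<rho>) y * F y)"
    by (rule integral_cong_AE[OF m ae1])
  have "integrable lborel ?I \<longleftrightarrow> integrable (distr lborel borel cart) ?I" by (simp only: lborel_distr_cart)
  also have "\<dots> \<longleftrightarrow> integrable (distr lborel borel cart) (\<lambda>w. indicator ?C w * ?G w)"
    by (rule integrable_cong_AE[OF _ _ ae2]) auto
  also have "\<dots> \<longleftrightarrow> integrable lborel (\<lambda>p. indicator ?C (cart p) * ?G (cart p))"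
    by (rule integrable_distr_eq) auto
  finally have 3: "integrable lborel ?I \<longleftrightarrow>
      integrable lborel (\<lambda>p. indicator (sph_domain \<rho>) p * ((snd (fst p))\<^sup>2 * F (spherical (cart p))))"
    by (simp add: C)
  have "(LBINT w. ?I w) = integral\<^sup>L (distr lborel borel cart) ?I" by (simp only: lborel_distr_cart)
  also have "\<dots> = integral\<^sup>L (distr lborel borel cart) (\<lambda>w. indicator ?C w * ?G w)"
    by (rule integral_cong_AE[OF _ _ ae2]) auto
  also have "\<dots> = (LBINT p. indicator ?C (cart p) * ?G (cart p))"
    by (rule integral_distr) auto
  finally have 4: "(LBINT w. ?I w) =
      (LBINT p. indicator (sph_domain \<rho>) p * ((snd (fst p))\<^sup>2 * F (spherical (cart p))))"
    by (simp add: C)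
  have bs: "ball (0::real^3) \<rho> \<in> sets borel" by simp
  have S': "?S \<in> sets borel" unfolding S by simp
  have 5: "?G absolutely_integrable_on ?S \<and> integral ?S ?G = b \<longleftrightarrow> integrable lborel ?I \<and> integral\<^sup>L lborel ?I = b"
    using absolutely_integrable_on_lborel_iff[OF G S'] by argo
  have 6: "F absolutely_integrable_on ball 0 \<rho> \<and> integral (ball 0 \<rho>) F = b \<longleftrightarrow>
      integrable lborel (\<lambda>y. indicator (ball 0 \<rho>) y * F y) \<and> (LBINT y. indicator (ball 0 \<rho>) y * F y) = b"
    using absolutely_integrable_on_lborel_iff[OF F bs] by argo
  show ?thesis
    unfolding 1[symmetric] 2[symmetric] 3[symmetric] 4[symmetric] 5[symmetric] 6[symmetric]
    by (rule spherical_change_of_variables)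
qed

lemma spherical_lborel_integral:
  fixes F :: "real^3 \<Rightarrow> real"
  assumes F: "F \<in> borel_measurable borel"
  shows "integrable lborel (\<lambda>p. indicator (sph_domain \<rho>) p * ((snd (fst p))\<^sup>2 * F (spherical (cart p)))) \<longleftrightarrow>
         integrable lborel (\<lambda>y. indicator (cball 0 \<rho>) y * F y)"
   and "(LBINT y. indicator (cball 0 \<rho>) y * F y) = 
        (LBINT p. indicator (sph_domain \<rho>) p * ((snd (fst p))\<^sup>2 * F (spherical (cart p))))"
proof -
  let ?I = "\<lambda>p. indicator (sph_domain \<rho>) p * ((snd (fst p))\<^sup>2 * F (spherical (cart p)))"
  let ?J = "\<lambda>y. indicator (cball 0 \<rho>) y * F y"
  note iff = spherical_lborel_has_integral[OF F, of \<rho>]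
  show 1: "integrable lborel ?I \<longleftrightarrow> integrable lborel ?J"
    using iff[of "integral\<^sup>L lborel ?I"] iff[of "integral\<^sup>L lborel ?J"] by blast
  show "integral\<^sup>L lborel ?J = integral\<^sup>L lborel ?I"
  proof (cases "integrable lborel ?J")
    case True
    then show ?thesis using iff[of "integral\<^sup>L lborel ?J"] by simp
  next
    case False
    with 1 have "\<not> integrable lborel ?I" by blast
    with False show ?thesis
      using not_integrable_integral_eq[of lborel ?I] not_integrable_integral_eq[of lborel ?J] by argo
  qed
qed

text \<open>
  The inner integral over \<open>\<beta>\<close> is only prescribed for \<open>s > 0\<close>; at \<open>s = 0\<close> the weight \<open>s\<^sup>2\<close> removes it.
\<close>

lemma spherical_fubini:
  fixes F :: "real^3 \<Rightarrow> real"
  assumes F [measurable]: "F \<in> borel_measurable borel"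
    and int: "integrable lborel (\<lambda>y. indicator (cball 0 \<rho>) y * F y)"
    and \<Phi>: "\<And>\<zeta> s. \<zeta> \<in> {-1..1} \<Longrightarrow> s \<in> {0<..\<rho>} \<Longrightarrow>
           (LBINT \<beta>:{0..2*pi}. F (spherical (cart ((\<zeta>, s), \<beta>)))) = \<Phi> \<zeta> s"
  shows "(LBINT y. indicator (cball 0 \<rho>) y * F y) = (LBINT \<zeta>:{-1..1}. (LBINT s:{0..\<rho>}. \<Phi> \<zeta> s * s\<^sup>2))"
    and "(LBINT y. indicator (cball 0 \<rho>) y * F y) = (LBINT s:{0..\<rho>}. (LBINT \<zeta>:{-1..1}. \<Phi> \<zeta> s) * s\<^sup>2)"
proof -
  let ?I = "\<lambda>p. indicator (sph_domain \<rho>) p * ((snd (fst p))\<^sup>2 * F (spherical (cart p)))"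
  have 1: "integrable (lborel \<Otimes>\<^sub>M lborel) ?I"
    using int spherical_lborel_integral(1)[OF F, of \<rho>] by (simp add: lborel_prod)
  define H where "H = (\<lambda>q. LBINT \<beta>. ?I (q, \<beta>))"
  have H: "H (\<zeta>, s) = indicator {-1..1} \<zeta> * (indicator {0..\<rho>} s * (\<Phi> \<zeta> s * s\<^sup>2))" for \<zeta> s
  proof (cases "\<zeta> \<in> {-1..1} \<and> s \<in> {0<..\<rho>}")
    case True
    have "H (\<zeta>, s) = (LBINT \<beta>. s\<^sup>2 * (indicator {0..2*pi} \<beta> * F (spherical (cart ((\<zeta>, s), \<beta>)))))"
      unfolding H_def using True by (intro Bochner_Integration.integral_cong) (auto simp: sph_domain_def indicator_def)
    also have "\<dots> = s\<^sup>2 * (LBINT \<beta>:{0..2*pi}. F (spherical (cart ((\<zeta>, s), \<beta>))))"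
      by (simp add: set_lebesgue_integral_def)
    finally show ?thesis using True \<Phi>[of \<zeta> s] by (auto simp: indicator_def)
  next
    case False
    then have "?I ((\<zeta>, s), \<beta>) = 0" for \<beta> by (auto simp: sph_domain_def indicator_def)
    then have "H (\<zeta>, s) = (LBINT \<beta>::real. 0)" unfolding H_def by (simp only: )
    then have "H (\<zeta>, s) = 0" by simp
    then show ?thesis using False by (auto simp: indicator_def)
  qed
  have 2: "integrable lborel H" unfolding H_def by (rule lborel_pair.integrable_fst'[OF 1])
  then have 3: "integrable (lborel \<Otimes>\<^sub>M lborel) (\<lambda>(\<zeta>, s). H (\<zeta>, s))" by (simp add: lborel_prod)
  have "(LBINT y. indicator (cball 0 \<rho>) y * F y) = integral\<^sup>L (lborel \<Otimes>\<^sub>M lborel) ?I"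
    using spherical_lborel_integral(2)[OF F, of \<rho>] by (simp add: lborel_prod)
  also have "\<dots> = integral\<^sup>L lborel H" unfolding H_def by (rule lborel_pair.integral_fst'[OF 1, symmetric])
  finally have 4: "(LBINT y. indicator (cball 0 \<rho>) y * F y) = integral\<^sup>L (lborel \<Otimes>\<^sub>M lborel) (\<lambda>(\<zeta>, s). H (\<zeta>, s))"
    by (simp add: lborel_prod)
  show "(LBINT y. indicator (cball 0 \<rho>) y * F y) = (LBINT \<zeta>:{-1..1}. (LBINT s:{0..\<rho>}. \<Phi> \<zeta> s * s\<^sup>2))"
    unfolding 4 lborel_pair.integral_fst[OF 3, symmetric] unfolding H set_lebesgue_integral_def by simp
  have "(LBINT y. indicator (cball 0 \<rho>) y * F y) = (LBINT s. indicator {0..\<rho>} s * ((LBINT \<zeta>. indicator {-1..1} \<zeta> * \<Phi> \<zeta> s) * s\<^sup>2))"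
    unfolding 4 lborel_pair.integral_snd[OF 3, symmetric] unfolding H
  proof (rule Bochner_Integration.integral_cong)
    fix s :: real
    have "(LBINT \<zeta>. indicator {-1..1} \<zeta> * (indicator {0..\<rho>} s * (\<Phi> \<zeta> s * s\<^sup>2))) =
          (LBINT \<zeta>. (indicator {0..\<rho>} s * s\<^sup>2) * (indicator {-1..1} \<zeta> * \<Phi> \<zeta> s))"
      by (simp add: mult_ac)
    then show "(LBINT \<zeta>. indicator {-1..1} \<zeta> * (indicator {0..\<rho>} s * (\<Phi> \<zeta> s * s\<^sup>2))) = 
       indicator {0..\<rho>} s * ((LBINT \<zeta>. indicator {-1..1} \<zeta> * \<Phi> \<zeta> s) * s\<^sup>2)"
      by (simp only: Bochner_Integration.integral_mult_right_zero) (simp add: mult_ac)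
  qed simp
  then show "(LBINT y. indicator (cball 0 \<rho>) y * F y) = (LBINT s:{0..\<rho>}. (LBINT \<zeta>:{-1..1}. \<Phi> \<zeta> s) * s\<^sup>2)"
    by (simp add: set_lebesgue_integral_def)
qed

lemma cball_borel_measurable [measurable]: "cball (a::'a::euclidean_space) r \<in> sets borel"
  by simp

lemma newton_integrand_measurable:
  fixes F :: "real^3 \<Rightarrow> real"
  assumes [measurable]: "F \<in> borel_measurable borel"
  shows "(\<lambda>y. indicator (cball 0 \<rho>) y * (F y / norm (x - y))) \<in> borel_measurable borel"
  by measurable

text \<open>
  In spherical coordinates the volume element \<open>s\<^sup>2\<close> absorbs the singularity \<open>1 / s\<close>.
\<close>

section \<open>Newtonian potentials on a ball\<close>

lemma inverse_norm_integrable_cball: 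
  "integrable lborel (\<lambda>y::real^3. indicator (cball 0 \<rho>) y * (1 / norm y))"
proof -
  have F: "(\<lambda>y::real^3. 1 / norm y) \<in> borel_measurable borel" by measurable
  have fin: "emeasure lborel (sph_domain \<rho>) < \<infinity>"
    unfolding sph_domain_def by (intro emeasure_bounded_finite bounded_Times bounded_closed_interval)
  have "integrable lborel (\<lambda>p. indicator (sph_domain \<rho>) p * \<bar>\<rho>\<bar>)"
    using fin by (intro integrable_real_mult_indicator integrable_mult_left) auto
  then have "integrable lborel (\<lambda>p. indicator (sph_domain \<rho>) p * ((snd (fst p))\<^sup>2 * (1 / norm (spherical (cart p)))))"
  proof (rule Bochner_Integration.integrable_bound)
    have "(\<lambda>p :: (real \<times> real) \<times> real. (snd (fst p))\<^sup>2) \<in> borel_measurable borel"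
      by (intro borel_measurable_continuous_onI continuous_intros)
    moreover have "(\<lambda>p. 1 / norm (spherical (cart p))) \<in> borel_measurable borel" by measurable
    ultimately show "(\<lambda>p. indicator (sph_domain \<rho>) p * ((snd (fst p))\<^sup>2 * (1 / norm (spherical (cart p))))) \<in> borel_measurable lborel"
      by (simp only: measurable_lborel2) (intro borel_measurable_times borel_measurable_indicator sph_domain_borel)
    show "AE p in lborel. norm (indicator (sph_domain \<rho>) p * ((snd (fst p))\<^sup>2 * (1 / norm (spherical (cart p))))) \<le>
        norm (indicator (sph_domain \<rho>) p * \<bar>\<rho>\<bar>)"
    proof (rule AE_I2)
      fix p :: "(real \<times> real) \<times> real"
      show "norm (indicator (sph_domain \<rho>) p * ((snd (fst p))\<^sup>2 * (1 / norm (spherical (cart p))))) \<le>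
        norm (indicator (sph_domain \<rho>) p * \<bar>\<rho>\<bar>)"
        by (cases "p \<in> sph_domain \<rho>")
           (auto simp: sph_domain_def norm_spherical abs_le_iff power2_eq_square)
    qed
  qed
  then show ?thesis unfolding spherical_lborel_integral(1)[OF F] .
qed

lemma lborel_distr_point_reflection: "distr lborel borel (\<lambda>y. x - y) = (lborel :: (real^3) measure)"
proof -
  have o: "orthogonal_transformation (\<lambda>y::real^3. - y)" by (simp add: orthogonal_transformation_neg)
  have "distr lborel borel (\<lambda>y. x - y) = distr (distr lborel borel (\<lambda>y. - y)) borel ((+) x)"
    by (subst distr_distr) (auto simp: o_def)
  then show ?thesis by (simp only: lborel_distr_orthogonal[OF o] lborel_distr_plus)
qed

lemma newton_kernel_integrable:
  fixes x :: "real^3"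
  shows "integrable lborel (\<lambda>y. indicator (cball 0 \<rho>) y * (1 / norm (x - y)))"
proof -
  let ?K = "\<lambda>y::real^3. indicator (cball 0 (\<rho> + norm x)) y * (1 / norm y)"
  have "integrable (distr lborel borel (\<lambda>y. x - y)) ?K"
    unfolding lborel_distr_point_reflection by (rule inverse_norm_integrable_cball)
  then have "integrable lborel (\<lambda>y. ?K (x - y))"
    using newton_integrand_measurable[of "\<lambda>_. 1" "\<rho> + norm x" 0] by (subst (asm) integrable_distr_eq) auto
  then show ?thesis
  proof (rule Bochner_Integration.integrable_bound)
    show "(\<lambda>y. indicator (cball 0 \<rho>) y * (1 / norm (x - y))) \<in> borel_measurable lborel"
      using newton_integrand_measurable[of "\<lambda>_. 1" \<rho> x] by simp
    show "AE y in lborel. norm (indicator (cball 0 \<rho>) y * (1 / norm (x - y))) \<le> norm (?K (x - y))"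
      by (rule AE_I2) (auto simp: indicator_def, smt (verit) norm_triangle_ineq4)
  qed
qed

lemma newton_integrable:
  fixes F :: "real^3 \<Rightarrow> real"
  assumes [measurable]: "F \<in> borel_measurable borel" and B: "\<And>y. norm y \<le> \<rho> \<Longrightarrow> \<bar>F y\<bar> \<le> B"
  shows "integrable lborel (\<lambda>y. indicator (cball 0 \<rho>) y * (F y / norm (x - y)))"
proof -
  have "integrable lborel (\<lambda>y. B * (indicator (cball 0 \<rho>) y * (1 / norm (x - y))))"
    by (intro integrable_mult_right newton_kernel_integrable)
  then show ?thesis
  proof (rule Bochner_Integration.integrable_bound)
    show "(\<lambda>y. indicator (cball 0 \<rho>) y * (F y / norm (x - y))) \<in> borel_measurable lborel"
      using newton_integrand_measurable[of F \<rho> x] by simp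
    show "AE y in lborel. norm (indicator (cball 0 \<rho>) y * (F y / norm (x - y)))
       \<le> norm (B * (indicator (cball 0 \<rho>) y * (1 / norm (x - y))))"
      using B by (intro AE_I2) (auto simp: indicator_def abs_mult intro!: divide_right_mono order_trans[OF _ abs_ge_self])
  qed
qed

text \<open>
  The potential is normalised so that \<open>-\<Delta>\<close> of it is the density. At the pole \<open>y = x\<close> the integrand is
  0 because division by 0 is 0.
\<close>

definition newton :: "real \<Rightarrow> (real^3 \<Rightarrow> real) \<Rightarrow> real^3 \<Rightarrow> real" where
  "newton \<rho> F x = 1 / (4 * pi) * (LBINT y. indicator (cball 0 \<rho>) y * (F y / norm (x - y)))"

lemma newton_orthogonal:
  assumes A: "orthogonal_transformation A" and [measurable]: "F \<in> borel_measurable borel"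
  shows "newton \<rho> (\<lambda>y. F (A y)) x = newton \<rho> F (A x)"
proof -
  have lin: "linear A" by (rule orthogonal_transformation_linear[OF A])
  have [measurable]: "A \<in> borel_measurable borel"
    by (intro borel_measurable_continuous_onI linear_continuous_on linear_conv_bounded_linear[THEN iffD1] lin)
  let ?G = "\<lambda>y. indicator (cball 0 \<rho>) y * (F y / norm (A x - y))"
  have "integral\<^sup>L lborel ?G = integral\<^sup>L (distr lborel borel A) ?G"
    by (simp only: lborel_distr_orthogonal[OF A])
  also have "\<dots> = (LBINT y. ?G (A y))"
    using newton_integrand_measurable[of F \<rho> "A x"] by (intro integral_distr) auto
  also have "\<dots> = (LBINT y. indicator (cball 0 \<rho>) y * (F (A y) / norm (x - y)))"
    using A by (simp add: indicator_def orthogonal_transformation_norm flip: linear_diff[OF lin])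
  finally show ?thesis by (simp add: newton_def)
qed

text \<open>
  The reflection in the plane orthogonal to \<open>d\<close>. For \<open>d = 0\<close> it is the identity, so that
  \<open>householder_swap\<close> holds without a case distinction.
\<close>

definition householder :: "'a::real_inner \<Rightarrow> 'a \<Rightarrow> 'a" where
  "householder d y = y - (2 * (y \<bullet> d) / (d \<bullet> d)) *\<^sub>R d"

lemma orthogonal_transformation_householder: "orthogonal_transformation (householder d)"
  unfolding orthogonal_transformation_def
proof
  show "linear (householder d)"
    by (rule linearI) (simp_all add: householder_def algebra_simps add_divide_distrib inner_add_left)
  show "\<forall>v w. householder d v \<bullet> householder d w = v \<bullet> w"
    by (cases "d = 0") (simp_all add: householder_def algebra_simps inner_commute)
qed

lemma householder_swap:
  assumes "norm x = norm y" shows "householder (x - y) x = y"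
proof (cases "x = y")
  case False
  have "x \<bullet> x = y \<bullet> y" using assms by (simp add: norm_eq)
  then have "2 * (x \<bullet> (x - y)) = (x - y) \<bullet> (x - y)" by (simp add: algebra_simps inner_commute)
  then show ?thesis using False by (simp add: householder_def)
qed (simp add: householder_def)


section \<open>The shell theorem for monopoles and dipoles\<close>

lemma cos_sin_period_integral:
  "(LBINT \<beta>:{0..2*pi}. P * cos \<beta> + Q * sin \<beta> + C) = 2 * pi * (C::real)"
proof -
  have cont: "continuous_on {0..2*pi} (\<lambda>\<beta>. P * cos \<beta> + Q * sin \<beta> + C)" by (intro continuous_intros)
  have "((\<lambda>\<beta>. P * cos \<beta> + Q * sin \<beta> + C) has_integral
          ((P * sin (2*pi) - Q * cos (2*pi) + C * (2*pi)) - (P * sin 0 - Q * cos 0 + C * 0))) {0..2*pi}"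
    by (rule fundamental_theorem_of_calculus)
       (auto intro!: derivative_eq_intros simp flip: has_real_derivative_iff_has_vector_derivative)
  then have "integral {0..2*pi} (\<lambda>\<beta>. P * cos \<beta> + Q * sin \<beta> + C) = 2 * pi * C"
    by (simp add: integral_unique)
  moreover have "set_integrable lborel {0..2*pi} (\<lambda>\<beta>. P * cos \<beta> + Q * sin \<beta> + C)"
    by (rule borel_integrable_atLeastAtMost'[OF cont])
  ultimately show ?thesis using set_borel_integral_eq_integral(2) by metis
qed

text \<open>
  The two lowest Legendre moments of the kernel, \<open>2 m^l / ((2l + 1) M^(l + 1))\<close> for \<open>l = 0, 1\<close>,
  where \<open>m\<close> and \<open>M\<close> are the minimum and the maximum of \<open>r\<close> and \<open>s\<close>. Explicit
  primitives exist, and they extend continuously to \<open>\<zeta> = 1\<close>, where the integrand is singular for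
  \<open>r = s\<close>.
\<close>

lemma sphere_mean_has_integral:
  fixes r s :: real
  assumes r: "0 < r" and s: "0 < s"
  defines "Q \<equiv> (\<lambda>\<zeta>. r\<^sup>2 + s\<^sup>2 - 2 * r * s * \<zeta>)"
  shows "((\<lambda>\<zeta>. 1 / sqrt (Q \<zeta>)) has_integral 2 / max r s) {-1..1}"
    and "((\<lambda>\<zeta>. \<zeta> / sqrt (Q \<zeta>)) has_integral 2 / 3 * min r s / (max r s)\<^sup>2) {-1..1}"
proof -
  have Qpos: "Q \<zeta> > 0" if "\<zeta> < 1" for \<zeta>
  proof -
    have "Q \<zeta> = (r - s)\<^sup>2 + 2 * (r * s * (1 - \<zeta>))" by (simp add: Q_def power2_eq_square algebra_simps)
    moreover have "r * s * (1 - \<zeta>) > 0" using r s that by simp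
    ultimately show ?thesis by (simp add: add_nonneg_pos)
  qed
  have "Q 1 = (r - s)\<^sup>2" "Q (-1) = (r + s)\<^sup>2" by (simp_all add: Q_def power2_eq_square algebra_simps)
  then have Q1: "sqrt (Q 1) = \<bar>r - s\<bar>" "sqrt (Q (-1)) = r + s" using r s by (simp_all)
  define b where "b = 2 * r * s"
  have b: "b > 0" using r s by (simp add: b_def)
  have dQ: "(Q has_real_derivative - b) (at \<zeta>)" for \<zeta>
    unfolding Q_def b_def by (auto intro!: derivative_eq_intros)
  have contQ: "continuous_on S Q" for S unfolding Q_def by (intro continuous_intros)
  define G where "G = (\<lambda>\<zeta>. - 2 * sqrt (Q \<zeta>) / b)"
  have "((\<lambda>\<zeta>. 1 / sqrt (Q \<zeta>)) has_integral (G 1 - G (-1))) {-1..1}"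
  proof (rule fundamental_theorem_of_calculus_interior)
    show "continuous_on {-1..1} G" unfolding G_def using b by (intro continuous_intros contQ) auto
    fix \<zeta> :: real assume "\<zeta> \<in> {-1<..<1}"
    then have "Q \<zeta> > 0" using Qpos by simp
    then have "(G has_real_derivative 1 / sqrt (Q \<zeta>)) (at \<zeta>)"
      unfolding G_def using b by (auto intro!: derivative_eq_intros dQ simp: field_simps)
    then show "(G has_vector_derivative 1 / sqrt (Q \<zeta>)) (at \<zeta>)"
      by (simp add: has_real_derivative_iff_has_vector_derivative)
  qed simp
  moreover have "G 1 - G (-1) = 2 / max r s"
    using r s by (simp add: G_def Q1 b_def max_def abs_if field_simps)
  ultimately show "((\<lambda>\<zeta>. 1 / sqrt (Q \<zeta>)) has_integral 2 / max r s) {-1..1}" by simp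
  define H where "H = (\<lambda>\<zeta>. - 2 / (3 * b\<^sup>2) * (sqrt (Q \<zeta>) * (2 * (r\<^sup>2 + s\<^sup>2) + b * \<zeta>)))"
  have "((\<lambda>\<zeta>. \<zeta> / sqrt (Q \<zeta>)) has_integral (H 1 - H (-1))) {-1..1}"
  proof (rule fundamental_theorem_of_calculus_interior)
    show "continuous_on {-1..1} H" unfolding H_def using b by (intro continuous_intros contQ) auto
    fix \<zeta> :: real assume "\<zeta> \<in> {-1<..<1}"
    then have Q: "Q \<zeta> > 0" using Qpos by simp
    \<comment> \<open>With \<open>q = sqrt (Q \<zeta>)\<close>, substituting \<open>r\<^sup>2 + s\<^sup>2 = q\<^sup>2 + b \<zeta>\<close> turns this into a polynomial identity.\<close>
    have eq: "- 2 / (3 * b\<^sup>2) * (- b / (2 * sqrt (Q \<zeta>)) * (2 * (r\<^sup>2 + s\<^sup>2) + b * \<zeta>) + b * sqrt (Q \<zeta>)) = \<zeta> / sqrt (Q \<zeta>)"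
    proof -
      define q where "q = sqrt (Q \<zeta>)"
      have q: "q > 0" using Q by (simp add: q_def)
      have qq: "r\<^sup>2 + s\<^sup>2 = q * q + b * \<zeta>" using Q by (simp add: q_def) (simp add: Q_def b_def)
      show ?thesis unfolding q_def[symmetric] qq using q b by (simp add: field_simps power2_eq_square)
    qed
    have "(H has_real_derivative - 2 / (3 * b\<^sup>2) * (- b / (2 * sqrt (Q \<zeta>)) * (2 * (r\<^sup>2 + s\<^sup>2) + b * \<zeta>) + b * sqrt (Q \<zeta>))) (at \<zeta>)"
    proof -
      have dS: "((\<lambda>\<zeta>. sqrt (Q \<zeta>)) has_real_derivative - b / (2 * sqrt (Q \<zeta>))) (at \<zeta>)"
        using Q by (auto intro!: derivative_eq_intros dQ simp: field_simps)
      have dL: "((\<lambda>\<zeta>. 2 * (r\<^sup>2 + s\<^sup>2) + b * \<zeta>) has_real_derivative b) (at \<zeta>)"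
        by (auto intro!: derivative_eq_intros)
      show ?thesis unfolding H_def by (rule DERIV_cmult[OF DERIV_mult[OF dS dL]])
    qed
    then show "(H has_vector_derivative \<zeta> / sqrt (Q \<zeta>)) (at \<zeta>)"
      unfolding eq by (simp add: has_real_derivative_iff_has_vector_derivative)
  qed simp
  moreover have "H 1 - H (-1) = 2 / 3 * min r s / (max r s)\<^sup>2"
  proof -
    have "H 1 - H (-1) = 1 / (6 * r\<^sup>2 * s\<^sup>2) * ((r + s) * (2 * (r\<^sup>2 + s\<^sup>2) - b) - \<bar>r - s\<bar> * (2 * (r\<^sup>2 + s\<^sup>2) + b))"
      using r s by (simp add: H_def Q1 b_def power_mult_distrib field_simps)
    also have "(r + s) * (2 * (r\<^sup>2 + s\<^sup>2) - b) - \<bar>r - s\<bar> * (2 * (r\<^sup>2 + s\<^sup>2) + b) = 4 * min r s ^ 3"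
      by (simp add: b_def min_def abs_if power2_eq_square power3_eq_cube algebra_simps)
    also have "1 / (6 * r\<^sup>2 * s\<^sup>2) * (4 * min r s ^ 3) = 2 / 3 * min r s / (max r s)\<^sup>2"
      using r s by (simp add: min_def max_def power2_eq_square power3_eq_cube field_simps)
    finally show ?thesis .
  qed
  ultimately show "((\<lambda>\<zeta>. \<zeta> / sqrt (Q \<zeta>)) has_integral 2 / 3 * min r s / (max r s)\<^sup>2) {-1..1}" by simp
qed

lemma sphere_mean:
  fixes r s c a :: real
  assumes r: "0 \<le> r" and s: "0 < s"
  shows "(LBINT \<zeta>:{-1..1}. (c + a * \<zeta>) / sqrt (r\<^sup>2 + s\<^sup>2 - 2 * r * s * \<zeta>)) =
         2 * c / max r s + 2 / 3 * a * min r s / (max r s)\<^sup>2"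
proof -
  define Q where "Q = (\<lambda>\<zeta>. r\<^sup>2 + s\<^sup>2 - 2 * r * s * \<zeta>)"
  have i0: "((\<lambda>\<zeta>. 1 / sqrt (Q \<zeta>)) has_integral 2 / max r s) {-1..1}"
  proof (cases "r = 0")
    case True
    then show ?thesis using s has_integral_const_real[of "1/s" "-1" 1] by (simp add: Q_def max_def)
  qed (use sphere_mean_has_integral[of r s] r s in \<open>simp add: Q_def\<close>)
  have i1: "((\<lambda>\<zeta>. \<zeta> / sqrt (Q \<zeta>)) has_integral 2 / 3 * min r s / (max r s)\<^sup>2) {-1..1}"
  proof (cases "r = 0")
    case True
    have "((\<lambda>x::real. x) has_integral 0) {-1..1}" using ident_has_integral[of "-1" 1] by simp
    from has_integral_divide[OF this, of s] show ?thesis using s True by (simp add: Q_def min_def)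
  qed (use sphere_mean_has_integral[of r s] r s in \<open>simp add: Q_def\<close>)
  have Q0: "Q \<zeta> \<ge> 0" if "\<zeta> \<le> 1" for \<zeta>
  proof -
    have "Q \<zeta> = (r - s)\<^sup>2 + 2 * (r * s * (1 - \<zeta>))" by (simp add: Q_def power2_eq_square algebra_simps)
    then show ?thesis using r s that by simp
  qed
  \<comment> \<open>Lebesgue integrability comes from nonnegativity; \<open>\<zeta> / sqrt (Q \<zeta>)\<close> changes sign, so
    \<open>(1 + \<zeta>) / sqrt (Q \<zeta>)\<close> is used instead.\<close>
  have a0: "(\<lambda>\<zeta>. 1 / sqrt (Q \<zeta>)) absolutely_integrable_on {-1..1}"
    using i0 Q0 by (intro nonnegative_absolutely_integrable_1) (auto simp: has_integral_integrable)
  have "((\<lambda>\<zeta>. 1 / sqrt (Q \<zeta>) + \<zeta> / sqrt (Q \<zeta>)) has_integral (2 / max r s + 2 / 3 * min r s / (max r s)\<^sup>2)) {-1..1}"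
    by (rule has_integral_add[OF i0 i1])
  then have a1: "(\<lambda>\<zeta>. 1 / sqrt (Q \<zeta>) + \<zeta> / sqrt (Q \<zeta>)) absolutely_integrable_on {-1..1}"
    using Q0 by (intro nonnegative_absolutely_integrable_1) (auto simp: has_integral_integrable simp flip: add_divide_distrib)
  have "(\<lambda>\<zeta>. (c - a) * (1 / sqrt (Q \<zeta>)) + a * (1 / sqrt (Q \<zeta>) + \<zeta> / sqrt (Q \<zeta>))) absolutely_integrable_on {-1..1}"
    by (intro set_integral_add(1) set_integrable_mult_right a0 a1)
  also have "(\<lambda>\<zeta>. (c - a) * (1 / sqrt (Q \<zeta>)) + a * (1 / sqrt (Q \<zeta>) + \<zeta> / sqrt (Q \<zeta>))) = (\<lambda>\<zeta>. (c + a * \<zeta>) / sqrt (Q \<zeta>))"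
    by (simp add: fun_eq_iff algebra_simps add_divide_distrib diff_divide_distrib)
  finally have abs: "(\<lambda>\<zeta>. (c + a * \<zeta>) / sqrt (Q \<zeta>)) absolutely_integrable_on {-1..1}" .
  have "((\<lambda>\<zeta>. c * (1 / sqrt (Q \<zeta>)) + a * (\<zeta> / sqrt (Q \<zeta>))) has_integral c * (2 / max r s) + a * (2 / 3 * min r s / (max r s)\<^sup>2)) {-1..1}"
    by (intro has_integral_add has_integral_mult_right i0 i1)
  then have "((\<lambda>\<zeta>. (c + a * \<zeta>) / sqrt (Q \<zeta>)) has_integral (2 * c / max r s + 2 / 3 * a * min r s / (max r s)\<^sup>2)) {-1..1}"
    by (simp add: add_divide_distrib mult_ac)
  moreover have "(\<lambda>\<zeta>. (c + a * \<zeta>) / sqrt (Q \<zeta>)) \<in> borel_measurable borel" unfolding Q_def by measurable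
  ultimately show ?thesis
    using absolutely_integrable_on_lborel_iff(2)[OF _ _ abs] by (simp add: integral_unique Q_def set_lebesgue_integral_def)
qed

lemma norm_diff_spherical:
  fixes x :: "real^3"
  assumes "\<bar>\<zeta>\<bar> \<le> 1" "0 \<le> s"
  shows "norm (x - spherical (cart ((\<zeta>, s), \<beta>))) = 
    sqrt ((norm x)\<^sup>2 + s\<^sup>2 - 2 * s * (x$1 * sqrt (1 - \<zeta>\<^sup>2) * cos \<beta> + x$2 * sqrt (1 - \<zeta>\<^sup>2) * sin \<beta> + x$3 * \<zeta>))"
proof -
  define y where "y = spherical (cart ((\<zeta>, s), \<beta>))"
  have ny: "norm y = s" using assms by (simp add: y_def norm_spherical)
  have "(norm (x - y))\<^sup>2 = (norm x)\<^sup>2 + (norm y)\<^sup>2 - 2 * (x \<bullet> y)"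
    by (simp add: power2_norm_eq_inner algebra_simps inner_commute)
  also have "x \<bullet> y = s * (x$1 * sqrt (1 - \<zeta>\<^sup>2) * cos \<beta> + x$2 * sqrt (1 - \<zeta>\<^sup>2) * sin \<beta> + x$3 * \<zeta>)"
    by (simp add: y_def inner_vec_def sum_3 algebra_simps)
  finally have "(norm (x - y))\<^sup>2 = (norm x)\<^sup>2 + s\<^sup>2 - 2 * s * (x$1 * sqrt (1 - \<zeta>\<^sup>2) * cos \<beta> + x$2 * sqrt (1 - \<zeta>\<^sup>2) * sin \<beta> + x$3 * \<zeta>)"
    by (simp add: ny)
  then show ?thesis by (metis norm_ge_zero real_sqrt_unique y_def)
qed

text \<open>
  For a point on the polar axis the distance to \<open>y\<close> does not depend on the longitude, so the
  components of \<open>a\<close> orthogonal to the axis integrate to 0 over \<open>\<beta>\<close>.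
\<close>

lemma newton_shell_axis:
  fixes \<phi> :: "real \<Rightarrow> real" and a :: "real^3"
  assumes [measurable]: "\<phi> \<in> borel_measurable borel" and B: "\<And>s. 0 \<le> s \<Longrightarrow> s \<le> \<rho> \<Longrightarrow> \<bar>\<phi> s\<bar> \<le> B"
    and r: "0 \<le> r"
  shows "newton \<rho> (\<lambda>y. \<phi> (norm y) * (c + y \<bullet> a / norm y)) (r *\<^sub>R axis 3 1) =
         (LBINT s:{0..\<rho>}. \<phi> s * (c / max r s + a$3 * min r s / (3 * (max r s)\<^sup>2)) * s\<^sup>2)"
proof -
  let ?x = "r *\<^sub>R axis 3 1 :: real^3"
  let ?F = "\<lambda>y. \<phi> (norm y) * (c + y \<bullet> a / norm y)"
  have F [measurable]: "?F \<in> borel_measurable borel" by measurable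
  have bd: "\<bar>?F y\<bar> \<le> \<bar>B\<bar> * (\<bar>c\<bar> + norm a)" if "norm y \<le> \<rho>" for y
  proof -
    have "\<bar>y \<bullet> a / norm y\<bar> \<le> norm a"
      using Cauchy_Schwarz_ineq2[of y a] by (cases "y = 0") (auto simp: field_simps)
    moreover have "\<bar>\<phi> (norm y)\<bar> \<le> \<bar>B\<bar>" using B[of "norm y"] that by simp
    ultimately show ?thesis unfolding abs_mult
      by (intro mult_mono order_trans[OF abs_triangle_ineq] add_mono) auto
  qed
  have int: "integrable lborel (\<lambda>y. indicator (cball 0 \<rho>) y * (?F y / norm (?x - y)))"
    by (rule newton_integrable[OF F bd])
  define \<Phi> where "\<Phi> = (\<lambda>\<zeta> s. 2 * pi * (\<phi> s * (c + a$3 * \<zeta>) / sqrt (r\<^sup>2 + s\<^sup>2 - 2 * r * s * \<zeta>)))"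
  have "(LBINT y. indicator (cball 0 \<rho>) y * (?F y / norm (?x - y))) =
     (LBINT s:{0..\<rho>}. (LBINT \<zeta>:{-1..1}. \<Phi> \<zeta> s) * s\<^sup>2)"
  proof (rule spherical_fubini(2)[OF _ int])
    show "(\<lambda>y. ?F y / norm (?x - y)) \<in> borel_measurable borel" by measurable
    fix \<zeta> s :: real assume z: "\<zeta> \<in> {-1..1}" and s: "s \<in> {0<..\<rho>}"
    have z1: "\<bar>\<zeta>\<bar> \<le> 1" using z by auto
    define w where "w = sqrt (1 - \<zeta>\<^sup>2)"
    define k where "k = \<phi> s / sqrt (r\<^sup>2 + s\<^sup>2 - 2 * r * s * \<zeta>)"
    have nx1: "norm ?x = r" using r by simp
    have nx2: "?x$1 = 0" "?x$2 = 0" "?x$3 = r" by (simp_all add: axis_def)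
    have nd: "norm (?x - spherical (cart ((\<zeta>, s), \<beta>))) = sqrt (r\<^sup>2 + s\<^sup>2 - 2 * r * s * \<zeta>)" for \<beta>
      using norm_diff_spherical[OF z1, of s ?x \<beta>] s unfolding nx1 nx2 by (simp add: mult_ac)
    have "?F (spherical (cart ((\<zeta>, s), \<beta>))) / norm (?x - spherical (cart ((\<zeta>, s), \<beta>))) =
        (k * w * a$1) * cos \<beta> + (k * w * a$2) * sin \<beta> + k * (c + a$3 * \<zeta>)" for \<beta>
      unfolding nd using s z1
      by (simp add: norm_spherical k_def inner_vec_def sum_3 w_def add_divide_distrib algebra_simps)
    then show "(LBINT \<beta>:{0..2*pi}. ?F (spherical (cart ((\<zeta>, s), \<beta>))) / norm (?x - spherical (cart ((\<zeta>, s), \<beta>)))) = \<Phi> \<zeta> s"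
      by (simp only: cos_sin_period_integral) (simp add: \<Phi>_def k_def)
  qed
  also have "\<dots> = (LBINT s:{0..\<rho>}. 4 * pi * (\<phi> s * (c / max r s + a$3 * min r s / (3 * (max r s)\<^sup>2)) * s\<^sup>2))"
  proof (rule set_lebesgue_integral_cong)
    show "\<forall>s. s \<in> {0..\<rho>} \<longrightarrow> (LBINT \<zeta>:{-1..1}. \<Phi> \<zeta> s) * s\<^sup>2 = 
        4 * pi * (\<phi> s * (c / max r s + a$3 * min r s / (3 * (max r s)\<^sup>2)) * s\<^sup>2)"
    proof (intro allI impI)
      fix s assume s: "s \<in> {0..\<rho>}"
      show "(LBINT \<zeta>:{-1..1}. \<Phi> \<zeta> s) * s\<^sup>2 = 
        4 * pi * (\<phi> s * (c / max r s + a$3 * min r s / (3 * (max r s)\<^sup>2)) * s\<^sup>2)"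
      proof (cases "s = 0")
        case False
        have "(LBINT \<zeta>:{-1..1}. \<Phi> \<zeta> s) = (LBINT \<zeta>:{-1..1}. (2 * pi * \<phi> s) * ((c + a$3 * \<zeta>) / sqrt (r\<^sup>2 + s\<^sup>2 - 2 * r * s * \<zeta>)))"
          by (simp add: \<Phi>_def mult_ac)
        also have "\<dots> = (2 * pi * \<phi> s) * (2 * c / max r s + 2 / 3 * a$3 * min r s / (max r s)\<^sup>2)"
          using s False r by (simp only: set_integral_mult_right) (subst sphere_mean, auto)
        finally show ?thesis by (simp add: algebra_simps)
      qed simp
    qed
  qed simp
  finally show ?thesis by (simp add: newton_def)
qed

text \<open>
  A reflection moves \<open>x\<close> to the polar axis. The monopole part \<open>c\<close> is Newton's shell theorem; the
  dipole part \<open>a\<close> is what identifies the directional derivatives of a radial potential.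
\<close>

lemma newton_shell:
  fixes \<phi> :: "real \<Rightarrow> real" and a x :: "real^3"
  assumes \<phi> [measurable]: "\<phi> \<in> borel_measurable borel" and B: "\<And>s. 0 \<le> s \<Longrightarrow> s \<le> \<rho> \<Longrightarrow> \<bar>\<phi> s\<bar> \<le> B"
  shows "newton \<rho> (\<lambda>y. \<phi> (norm y) * (c + y \<bullet> a / norm y)) x =
         (LBINT s:{0..\<rho>}. \<phi> s * (c / max (norm x) s + x \<bullet> a / norm x * min (norm x) s / (3 * (max (norm x) s)\<^sup>2)) * s\<^sup>2)"
proof -
  define A where "A = householder (x - norm x *\<^sub>R axis 3 1)"
  have orth: "orthogonal_transformation A" unfolding A_def by (rule orthogonal_transformation_householder)
  have Ax: "A x = norm x *\<^sub>R axis 3 1" unfolding A_def by (rule householder_swap) simp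
  have inner: "A v \<bullet> A w = v \<bullet> w" for v w using orth by (simp add: orthogonal_transformation_def)
  have nA: "norm (A v) = norm v" for v by (rule orthogonal_transformation_norm[OF orth])
  let ?G = "\<lambda>y. \<phi> (norm y) * (c + y \<bullet> A a / norm y)"
  have "newton \<rho> (\<lambda>y. \<phi> (norm y) * (c + y \<bullet> a / norm y)) x = newton \<rho> (\<lambda>y. ?G (A y)) x"
    by (simp add: inner nA)
  also have "\<dots> = newton \<rho> ?G (A x)" by (rule newton_orthogonal[OF orth]) measurable
  also have "\<dots> = (LBINT s:{0..\<rho>}. \<phi> s * (c / max (norm x) s + A a $ 3 * min (norm x) s / (3 * (max (norm x) s)\<^sup>2)) * s\<^sup>2)"
    unfolding Ax by (rule newton_shell_axis[OF \<phi> B]) auto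
  also have "\<dots> = (LBINT s:{0..\<rho>}. \<phi> s * (c / max (norm x) s + x \<bullet> a / norm x * min (norm x) s / (3 * (max (norm x) s)\<^sup>2)) * s\<^sup>2)"
  proof (cases "x = 0")
    case True
    then show ?thesis by (intro set_lebesgue_integral_cong) (auto simp: min_def)
  next
    case False
    have "norm x * A a $ 3 = A x \<bullet> A a" unfolding Ax by (simp add: inner_axis')
    then have "A a $ 3 = x \<bullet> a / norm x" using False by (simp add: inner field_simps)
    then show ?thesis by simp
  qed
  finally show ?thesis .
qed

section \<open>Axisymmetric densities and the integral operator\<close>

text \<open>
  An element of \<open>E_space\<close>, which is only constrained on a rectangle, becomes a measurable
  function on the whole space by extension with 0.
\<close>

definition lift_axisym :: "real \<Rightarrow> (real \<Rightarrow> real \<Rightarrow> real) \<Rightarrow> real^3 \<Rightarrow> real" where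
  "lift_axisym \<rho> f y = (if norm y \<le> \<rho> then f (norm y) (y$3 / norm y) else 0)"

lemma cos_polar_angle_bound: "y$3 / norm y \<in> {-1..1}" for y :: "real^3"
proof -
  define q where "q = y$3 / norm y"
  have "\<bar>q\<bar> \<le> 1" using component_le_norm_cart[of y 3] by (cases "y = 0") (simp_all add: q_def)
  then show ?thesis unfolding q_def[symmetric] by auto
qed

lemma lift_axisym_measurable:
  assumes f: "continuous_on ({0..\<rho>} \<times> {-1..1}) (\<lambda>(r, \<zeta>). f r \<zeta>)"
  shows "lift_axisym \<rho> f \<in> borel_measurable borel"
proof -
  let ?S = "{0..\<rho>} \<times> {-1..1::real}" and ?q = "\<lambda>y::real^3. (norm y, y$3 / norm y)"
  have 1: "(\<lambda>p. indicator ?S p *\<^sub>R (\<lambda>(r, \<zeta>). f r \<zeta>) p) \<in> borel_measurable borel"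
    by (rule borel_measurable_continuous_on_indicator[OF _ f]) (intro borel_closed closed_Times closed_atLeastAtMost)
  have 2: "?q \<in> borel_measurable borel"
    by (intro borel_measurable_Pair) measurable
  have "lift_axisym \<rho> f = (\<lambda>y. indicator ?S (?q y) *\<^sub>R (\<lambda>(r, \<zeta>). f r \<zeta>) (?q y))"
    using cos_polar_angle_bound by (auto simp: lift_axisym_def fun_eq_iff indicator_def)
  also have "\<dots> \<in> borel_measurable borel" by (rule measurable_compose[OF 2 1])
  finally show ?thesis .
qed

lemma lift_axisym_bounded:
  assumes f: "continuous_on ({0..\<rho>} \<times> {-1..1}) (\<lambda>(r, \<zeta>). f r \<zeta>)"
  obtains B where "B \<ge> 0" "\<And>y. \<bar>lift_axisym \<rho> f y\<bar> \<le> B"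
proof -
  have "compact ((\<lambda>(r, \<zeta>). f r \<zeta>) ` ({0..\<rho>} \<times> {-1..1}))"
    by (rule compact_continuous_image[OF f]) (intro compact_Times compact_Icc)
  then obtain B where B: "\<forall>r\<in>{0..\<rho>}. \<forall>\<zeta>\<in>{-1..1}. \<bar>f r \<zeta>\<bar> \<le> B"
    by (auto dest!: compact_imp_bounded simp: bounded_iff)
  have "\<bar>lift_axisym \<rho> f y\<bar> \<le> max B 0" for y
    
  proof (cases "norm y \<le> \<rho>")
    case True
    then have "\<bar>f (norm y) (y$3 / norm y)\<bar> \<le> B"
      using B[rule_format, OF _ cos_polar_angle_bound[of y], of "norm y"] by simp
    then show ?thesis using True by (simp add: lift_axisym_def)
  qed (simp add: lift_axisym_def)
  then show ?thesis using that[of "max B 0"] by simp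
qed

text \<open>
  The point with coordinates \<open>(r, \<zeta>)\<close> in the meridian plane of longitude 0.
\<close>

definition meridian :: "real \<Rightarrow> real \<Rightarrow> real^3" where
  "meridian r \<zeta> = vector [r * sqrt (1 - \<zeta>\<^sup>2), 0, r * \<zeta>]"

lemma meridian_nth [simp]: "meridian r \<zeta> $ 1 = r * sqrt (1 - \<zeta>\<^sup>2)" "meridian r \<zeta> $ 2 = 0" "meridian r \<zeta> $ 3 = r * \<zeta>"
  by (simp_all add: meridian_def)

lemma norm_meridian: "0 \<le> r \<Longrightarrow> \<bar>\<zeta>\<bar> \<le> 1 \<Longrightarrow> norm (meridian r \<zeta>) = r"
  by (simp add: norm_vec3 power_mult_distrib abs_square_le_1 algebra_simps)

lemma K_op_eq_newton:
  assumes f: "continuous_on ({0..\<rho>} \<times> {-1..1}) (\<lambda>(r, \<zeta>). f r \<zeta>)" and r: "0 \<le> r" and \<zeta>: "\<bar>\<zeta>\<bar> \<le> 1"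
  shows "K_op \<rho> f r \<zeta> = newton \<rho> (lift_axisym \<rho> f) (meridian r \<zeta>)"
proof -
  let ?x = "meridian r \<zeta>"
  let ?F = "lift_axisym \<rho> f"
  obtain B where B: "\<And>y. \<bar>?F y\<bar> \<le> B" using lift_axisym_bounded[OF f] by metis
  have F [measurable]: "?F \<in> borel_measurable borel" by (rule lift_axisym_measurable[OF f])
  have int: "integrable lborel (\<lambda>y. indicator (cball 0 \<rho>) y * (?F y / norm (?x - y)))"
    by (rule newton_integrable[OF F B])
  have "(LBINT y. indicator (cball 0 \<rho>) y * (?F y / norm (?x - y))) =
      (LBINT \<zeta>':{-1..1}. (LBINT s:{0..\<rho>}. (K_kernel r \<zeta> s \<zeta>' * f s \<zeta>') * s\<^sup>2))"
  proof (rule spherical_fubini(1)[OF _ int])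
    show "(\<lambda>y. ?F y / norm (?x - y)) \<in> borel_measurable borel" by measurable
    fix \<zeta>' s :: real assume "\<zeta>' \<in> {-1..1}" and s: "s \<in> {0<..\<rho>}"
    then have z: "\<bar>\<zeta>'\<bar> \<le> 1" by auto
    have "?F (spherical (cart ((\<zeta>', s), \<beta>))) = f s \<zeta>'" for \<beta>
      using s z by (simp add: lift_axisym_def norm_spherical)
    moreover have "norm (?x - spherical (cart ((\<zeta>', s), \<beta>))) =
       sqrt (r\<^sup>2 + s\<^sup>2 - 2 * r * s * (sqrt (1 - \<zeta>\<^sup>2) * sqrt (1 - \<zeta>'\<^sup>2) * cos \<beta> + \<zeta> * \<zeta>'))" for \<beta>
      using norm_diff_spherical[OF z, of s ?x \<beta>] s r \<zeta> by (simp add: norm_meridian algebra_simps)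
    ultimately show "(LBINT \<beta>:{0..2*pi}. ?F (spherical (cart ((\<zeta>', s), \<beta>))) / norm (?x - spherical (cart ((\<zeta>', s), \<beta>)))) =
        K_kernel r \<zeta> s \<zeta>' * f s \<zeta>'"
      by (simp add: K_kernel_def divide_inverse mult.commute)
  qed
  then show ?thesis by (simp add: K_op_def newton_def)
qed

section \<open>Symmetry and positivity of the Newtonian potential\<close>

lemma newton_add:
  assumes "F \<in> borel_measurable borel" "\<And>y. norm y \<le> \<rho> \<Longrightarrow> \<bar>F y\<bar> \<le> B"
      and "G \<in> borel_measurable borel" "\<And>y. norm y \<le> \<rho> \<Longrightarrow> \<bar>G y\<bar> \<le> C"
  shows "newton \<rho> (\<lambda>y. F y + G y) x = newton \<rho> F x + newton \<rho> G x"
  using newton_integrable[OF assms(1,2), where x = x] newton_integrable[OF assms(3,4), where x = x]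
  by (simp add: newton_def add_divide_distrib distrib_left)

lemma newton_uminus: "newton \<rho> (\<lambda>y. - F y) x = - newton \<rho> F x"
  by (simp add: newton_def)

lemma newton_diff:
  assumes "F \<in> borel_measurable borel" "\<And>y. norm y \<le> \<rho> \<Longrightarrow> \<bar>F y\<bar> \<le> B"
      and "G \<in> borel_measurable borel" "\<And>y. norm y \<le> \<rho> \<Longrightarrow> \<bar>G y\<bar> \<le> C"
  shows "newton \<rho> (\<lambda>y. F y - G y) x = newton \<rho> F x - newton \<rho> G x"
  using newton_integrable[OF assms(1,2), where x = x] newton_integrable[OF assms(3,4), where x = x]
  by (simp add: newton_def diff_divide_distrib right_diff_distrib)

lemma newton_cong_AE:
  assumes [measurable]: "F \<in> borel_measurable borel" "G \<in> borel_measurable borel"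
    and ae: "AE y in lborel. norm y \<le> \<rho> \<longrightarrow> F y = G y"
  shows "newton \<rho> F x = newton \<rho> G x"
proof -
  have "(LBINT y. indicator (cball 0 \<rho>) y * (F y / norm (x - y))) = (LBINT y. indicator (cball 0 \<rho>) y * (G y / norm (x - y)))"
    using ae newton_integrand_measurable[OF assms(1)] newton_integrand_measurable[OF assms(2)]
    by (intro integral_cong_AE) (auto elim!: eventually_mono simp: indicator_def)
  then show ?thesis by (simp add: newton_def)
qed

text \<open>
  The potential of the uniform density, estimated by the shell theorem; uniformity in \<open>x\<close>
  is what Fubini needs in \<open>newton_symmetric\<close>.
\<close>

lemma newton_kernel_mass_bound:
  "0 \<le> \<rho> \<Longrightarrow> (LBINT y. indicator (cball 0 \<rho>) y * (1 / norm (x - y))) \<le> 4 * pi * \<rho>\<^sup>2"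
  for x :: "real^3"
proof -
  assume \<rho>: "0 \<le> \<rho>"
  have "newton \<rho> (\<lambda>y. 1) x = (LBINT s. indicator {0..\<rho>} s * (1 / max (norm x) s * s\<^sup>2))"
    using newton_shell[of "\<lambda>_. 1" \<rho> 1 1 0 x] by (simp add: set_lebesgue_integral_def)
  also have "\<dots> \<le> (LBINT s. indicator {0..\<rho>} s * \<rho>)"
  proof (rule integral_mono')
    show "integrable lborel (\<lambda>s. indicator {0..\<rho>} s * \<rho>)" using emeasure_bounded_finite[of "{0..\<rho>}"] by (intro integrable_mult_left integrable_real_indicator) auto
    fix s :: real
    show "indicator {0..\<rho>} s * (1 / max (norm x) s * s\<^sup>2) \<le> indicator {0..\<rho>} s * \<rho>"
    proof (cases "s \<in> {0<..\<rho>}")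
      case True
      have "s * s \<le> \<rho> * max (norm x) s" using True \<rho> by (intro mult_mono) auto
      then have "1 / max (norm x) s * s\<^sup>2 \<le> \<rho>"
        using True by (simp add: power2_eq_square pos_divide_le_eq less_max_iff_disj)
      then show ?thesis by (auto simp: indicator_def)
    qed (use \<rho> in \<open>auto simp: indicator_def\<close>)
    show "0 \<le> indicator {0..\<rho>} s * \<rho>" using \<rho> by simp
  qed
  also have "\<dots> = \<rho>\<^sup>2" using \<rho> by (simp add: power2_eq_square)
  finally show ?thesis by (simp add: newton_def field_simps)
qed

lemma newton_symmetric:
  fixes F G :: "real^3 \<Rightarrow> real"
  assumes \<rho>: "0 \<le> \<rho>"
      and F [measurable]: "F \<in> borel_measurable borel" and FB: "\<And>y. norm y \<le> \<rho> \<Longrightarrow> \<bar>F y\<bar> \<le> B"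
      and G [measurable]: "G \<in> borel_measurable borel" and GC: "\<And>y. norm y \<le> \<rho> \<Longrightarrow> \<bar>G y\<bar> \<le> C"
  shows "(LBINT x. indicator (cball 0 \<rho>) x * (F x * newton \<rho> G x)) = (LBINT x. indicator (cball 0 \<rho>) x * (G x * newton \<rho> F x))"
    and "integrable lborel (\<lambda>x. indicator (cball 0 \<rho>) x * (F x * newton \<rho> G x))"
proof -
  let ?b = "indicator (cball (0::real^3) \<rho>) :: _ \<Rightarrow> real"
  define k where "k = (\<lambda>x y. ?b x * F x * (?b y * (G y / norm (x - y))))"
  have km: "case_prod k \<in> borel_measurable (lborel \<Otimes>\<^sub>M lborel)" unfolding k_def by measurable
  have iG: "integrable lborel (\<lambda>y. ?b y * (G y / norm (x - y)))" for x by (rule newton_integrable[OF G GC])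
  have B0: "B \<ge> 0" "C \<ge> 0" using FB[of 0] GC[of 0] \<rho> by auto
  have bound: "(LBINT y. norm (k x y)) \<le> ?b x * (B * (C * (4 * pi * \<rho>\<^sup>2)))" for x
  proof -
    have "(LBINT y. norm (k x y)) \<le> (LBINT y. (?b x * B * C) * (?b y * (1 / norm (x - y))))"
    proof (rule integral_mono')
      show "integrable lborel (\<lambda>y. (?b x * B * C) * (?b y * (1 / norm (x - y))))"
        by (intro integrable_mult_right newton_kernel_integrable)
      fix y
      show "0 \<le> (?b x * B * C) * (?b y * (1 / norm (x - y)))" using B0 by simp
      have "\<bar>F x\<bar> * \<bar>G y\<bar> \<le> B * C" if "norm x \<le> \<rho>" "norm y \<le> \<rho>"
        using FB[OF that(1)] GC[OF that(2)] B0 by (intro mult_mono) auto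
      then show "norm (k x y) \<le> (?b x * B * C) * (?b y * (1 / norm (x - y)))"
        by (auto simp: k_def indicator_def abs_mult intro!: divide_right_mono)
    qed
    also have "\<dots> = (?b x * B * C) * (LBINT y. ?b y * (1 / norm (x - y)))"
      by (rule Bochner_Integration.integral_mult_right_zero)
    also have "\<dots> \<le> (?b x * B * C) * (4 * pi * \<rho>\<^sup>2)"
      using B0 newton_kernel_mass_bound[OF \<rho>, of x] by (intro mult_left_mono) auto
    finally show ?thesis by (simp add: mult_ac)
  qed
  have int: "integrable (lborel \<Otimes>\<^sub>M lborel) (case_prod k)"
  proof (rule lborel_pair.Fubini_integrable[OF km])
    show "AE x in lborel. integrable lborel (\<lambda>y. case_prod k (x, y))"
    proof (rule AE_I2)
      fix x
      have "integrable lborel (\<lambda>y. k x y)" unfolding k_def by (rule integrable_mult_right[OF iG])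
      then show "integrable lborel (\<lambda>y. case_prod k (x, y))" by simp
    qed
    have "integrable lborel (\<lambda>x::real^3. ?b x * (B * (C * (4 * pi * \<rho>\<^sup>2))))"
      using emeasure_bounded_finite[of "cball (0::real^3) \<rho>"]
      by (intro integrable_mult_left integrable_real_indicator) auto
    then show "integrable lborel (\<lambda>x. LBINT y. norm (case_prod k (x, y)))"
    proof (rule Bochner_Integration.integrable_bound)
      have "(\<lambda>x. LBINT y. norm (k x y)) \<in> borel_measurable lborel"
        using km by measurable
      then show "(\<lambda>x. LBINT y. norm (case_prod k (x, y))) \<in> borel_measurable lborel" by simp
      show "AE x in lborel. norm (LBINT y. norm (case_prod k (x, y))) \<le> norm (?b x * (B * (C * (4 * pi * \<rho>\<^sup>2))))"
        using bound by (intro AE_I2) (auto intro!: order_trans[OF _ abs_ge_self])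
    qed
  qed
  have eq1: "?b x * (F x * newton \<rho> G x) = 1 / (4 * pi) * (LBINT y. k x y)" for x
  proof -
    have "(LBINT y. k x y) = (?b x * F x) * (LBINT y. ?b y * (G y / norm (x - y)))"
      unfolding k_def by (rule Bochner_Integration.integral_mult_right_zero)
    then show ?thesis by (simp add: newton_def)
  qed
  have eq2: "?b y * (G y * newton \<rho> F y) = 1 / (4 * pi) * (LBINT x. k x y)" for y
  proof -
    have "(LBINT x. k x y) = (LBINT x. ?b y * G y * (?b x * (F x / norm (y - x))))"
      by (simp add: k_def mult_ac norm_minus_commute)
    also have "\<dots> = (?b y * G y) * (LBINT x. ?b x * (F x / norm (y - x)))"
      by (rule Bochner_Integration.integral_mult_right_zero)
    finally have "(LBINT x. k x y) = (?b y * G y) * (LBINT x. ?b x * (F x / norm (y - x)))" .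
    then show ?thesis by (simp add: newton_def)
  qed
  show "(LBINT x. indicator (cball 0 \<rho>) x * (F x * newton \<rho> G x)) = (LBINT x. indicator (cball 0 \<rho>) x * (G x * newton \<rho> F x))"
    unfolding eq1 eq2 using lborel_pair.Fubini_integral[OF int] by simp
  show "integrable lborel (\<lambda>x. indicator (cball 0 \<rho>) x * (F x * newton \<rho> G x))"
    unfolding eq1 using lborel_pair.integrable_fst[OF int] by simp
qed

text \<open>
  Since \<open>\<phi>\<close> is odd under the reflection \<open>\<sigma>\<close>, twice its potential at \<open>x\<close> is the integral of \<open>\<phi>\<close> against
  \<open>1 / |x - y| - 1 / |\<sigma> x - y|\<close>. For \<open>x\<close> in the half space this difference has the sign of \<open>y \<bullet> e\<close>,
  which is also the sign of \<open>\<phi>\<close>; so the integrand is nonnegative on the whole ball. The difference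
  of the kernels is \<open>4 \<pi>\<close> times the Green function of the half space with Dirichlet condition.
\<close>

lemma newton_odd_nonneg:
  fixes \<phi> :: "real^3 \<Rightarrow> real"
  assumes m [measurable]: "\<phi> \<in> borel_measurable borel" and B: "\<And>y. norm y \<le> \<rho> \<Longrightarrow> \<bar>\<phi> y\<bar> \<le> B"
    and odd: "\<And>y. \<phi> (householder e y) = - \<phi> y"
    and sign: "\<And>y. norm y \<le> \<rho> \<Longrightarrow> 0 \<le> \<phi> y * (y \<bullet> e)"
    and x: "0 < x \<bullet> e"
  shows "0 \<le> newton \<rho> \<phi> x"
    and "newton \<rho> \<phi> x = 0 \<Longrightarrow> AE y in lborel. norm y \<le> \<rho> \<longrightarrow> \<phi> y = 0"
proof -
  let ?\<sigma> = "householder e"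
  let ?b = "indicator (cball (0::real^3) \<rho>) :: _ \<Rightarrow> real"
  have e: "e \<bullet> e > 0" using x by auto
  define I where "I = (\<lambda>y. ?b y * (\<phi> y / norm (x - y)) - ?b y * (\<phi> y / norm (?\<sigma> x - y)))"
  have iI: "integrable lborel I" unfolding I_def
    by (intro Bochner_Integration.integrable_diff newton_integrable[OF m B])
  have "newton \<rho> \<phi> (?\<sigma> x) = newton \<rho> (\<lambda>y. - \<phi> y) x"
    using newton_orthogonal[OF orthogonal_transformation_householder m, of \<rho> e x] by (simp add: odd)
  then have "newton \<rho> \<phi> x - newton \<rho> \<phi> (?\<sigma> x) = 2 * newton \<rho> \<phi> x" by (simp add: newton_uminus)
  moreover have "newton \<rho> \<phi> x - newton \<rho> \<phi> (?\<sigma> x) = 1 / (4 * pi) * integral\<^sup>L lborel I"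
    unfolding I_def newton_def
    by (subst Bochner_Integration.integral_diff[OF newton_integrable[OF m B] newton_integrable[OF m B]]) (auto simp: right_diff_distrib)
  ultimately have N: "newton \<rho> \<phi> x = 1 / (8 * pi) * integral\<^sup>L lborel I" by simp
  have dist: "(norm (?\<sigma> x - y))\<^sup>2 = (norm (x - y))\<^sup>2 + 4 * (x \<bullet> e) * (y \<bullet> e) / (e \<bullet> e)" for y
  proof -
    have "(norm (?\<sigma> x))\<^sup>2 = (norm x)\<^sup>2"
      by (simp add: orthogonal_transformation_norm[OF orthogonal_transformation_householder])
    moreover have "?\<sigma> x \<bullet> y = x \<bullet> y - 2 * (x \<bullet> e) * (y \<bullet> e) / (e \<bullet> e)"
      by (simp add: householder_def inner_diff_left inner_commute[of e y])
    moreover have "(norm (u - y))\<^sup>2 = (norm u)\<^sup>2 + (norm y)\<^sup>2 - 2 * (u \<bullet> y)" for u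
      by (simp add: power2_norm_eq_inner algebra_simps inner_commute)
    ultimately show ?thesis by simp
  qed
  have ker: "(1 / norm (x - y) - 1 / norm (?\<sigma> x - y)) * (y \<bullet> e) > 0" if "y \<noteq> x" "y \<noteq> ?\<sigma> x" "y \<bullet> e \<noteq> 0" for y
  proof (cases "y \<bullet> e > 0")
    case True
    have "(norm (x - y))\<^sup>2 < (norm (?\<sigma> x - y))\<^sup>2" using True x e by (simp add: dist)
    then have "norm (x - y) < norm (?\<sigma> x - y)" by (rule power2_less_imp_less) simp
    then have "1 / norm (?\<sigma> x - y) < 1 / norm (x - y)" using that by (intro divide_strict_left_mono) auto
    with True show ?thesis by simp
  next
    case False
    with that have neg: "y \<bullet> e < 0" by simp
    then have "(x \<bullet> e) * (y \<bullet> e) / (e \<bullet> e) < 0" using x e by (simp add: divide_neg_pos mult_pos_neg)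
    then have "(norm (?\<sigma> x - y))\<^sup>2 < (norm (x - y))\<^sup>2" by (simp add: dist)
    then have "norm (?\<sigma> x - y) < norm (x - y)" by (rule power2_less_imp_less) simp
    then have "1 / norm (x - y) < 1 / norm (?\<sigma> x - y)" using that by (intro divide_strict_left_mono) auto
    with neg show ?thesis by (simp add: mult_neg_neg)
  qed
  have plane: "\<phi> y = 0" if "y \<bullet> e = 0" for y
    using odd[of y] that by (simp add: householder_def)
  \<comment> \<open>The two poles are excluded: there one of the quotients is 0 by convention and the sign is lost.\<close>
  have pt: "0 \<le> I y \<and> (I y = 0 \<longrightarrow> norm y \<le> \<rho> \<longrightarrow> \<phi> y = 0)" if ne: "y \<noteq> x" "y \<noteq> ?\<sigma> x" for y
  proof (cases "norm y \<le> \<rho> \<and> y \<bullet> e \<noteq> 0")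
    case True
    define d where "d = 1 / norm (x - y) - 1 / norm (?\<sigma> x - y)"
    have d: "d * (y \<bullet> e) > 0" unfolding d_def using ker[OF ne] True by simp
    have I: "I y = \<phi> y * d" using True by (simp add: I_def d_def right_diff_distrib)
    have s: "0 \<le> \<phi> y * (y \<bullet> e)" using sign True by simp
    have "0 \<le> (\<phi> y * d) * (y \<bullet> e)\<^sup>2"
      using mult_nonneg_nonneg[OF s less_imp_le[OF d]] by (simp add: power2_eq_square mult_ac)
    then have "0 \<le> \<phi> y * d" using True by (simp add: zero_le_mult_iff)
    moreover have "d \<noteq> 0" using d by auto
    ultimately show ?thesis using I by simp
  next
    case False
    then show ?thesis using plane by (auto simp: I_def)
  qed
  have ae: "AE y in lborel. y \<noteq> x \<and> y \<noteq> ?\<sigma> x"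
    using AE_lborel_singleton[of x] AE_lborel_singleton[of "?\<sigma> x"] by eventually_elim simp
  have nonneg: "AE y in lborel. 0 \<le> I y" using ae by eventually_elim (use pt in blast)
  show "0 \<le> newton \<rho> \<phi> x" unfolding N using integral_nonneg_AE[OF nonneg] by simp
  show "AE y in lborel. norm y \<le> \<rho> \<longrightarrow> \<phi> y = 0" if "newton \<rho> \<phi> x = 0"
  proof -
    have "integral\<^sup>L lborel I = 0" using that unfolding N by simp
    then have "AE y in lborel. I y = 0" using integral_nonneg_eq_0_iff_AE[OF iI nonneg] by simp
    with ae show ?thesis by eventually_elim (use pt in blast)
  qed
qed

section \<open>Even solutions of the linearised equation are radial\<close>

lemma AE_lborel_open_obtain:
  fixes S :: "'a::euclidean_space set"
  assumes "AE x in lborel. P x" "open S" "S \<noteq> {}"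
  obtains x where "x \<in> S" "P x"
proof (rule ccontr)
  assume "\<not> thesis"
  with that have no: "\<And>x. x \<in> S \<Longrightarrow> \<not> P x" by blast
  then have "AE x in lborel. x \<notin> S" using assms(1) by (auto elim!: eventually_mono)
  then have "S \<in> null_sets lborel" using assms(2) AE_iff_null_sets[of S lborel] by auto
  then have "negligible S" using assms(2) by (simp add: negligible_iff_null_sets null_sets_completionI)
  then show False using open_not_negligible assms by blast
qed

lemma sgn_mult_abs_bound: "\<bar>sgn a * b\<bar> \<le> \<bar>b\<bar>" for a b :: real
  by (cases "a = 0") (simp_all add: abs_mult abs_sgn_eq)

text \<open>
  The Perron argument for the operator \<open>T \<phi> = newton \<rho> (p \<phi>)\<close> on functions odd under a reflection \<open>\<sigma>\<close>.
  The function \<open>z(y) = v(|y|) (y \<bullet> e) / |y|\<close> is a positive eigenfunction on the half space, by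
  \<open>fix_v\<close>. For \<open>w = H \<circ> \<sigma> - H\<close>, positivity gives \<open>|w| \<le> T|w|\<close> there (with \<open>|w|\<close> continued as an odd
  function \<open>W\<close>), and pairing with \<open>p z\<close> forces equality, since \<open>T\<close> is symmetric with respect to the
  weight \<open>p\<close>. Equality at a single point, together with the strict form of positivity, makes
  \<open>w\<close> of one sign; oddness under \<open>\<tau> = -\<sigma>\<close> then leaves only \<open>w = 0\<close>.
  
  Any two points of equal norm are exchanged by such a reflection, so \<open>H\<close> depends on the norm
  only.
\<close>

lemma rotation_invariant_of_newton_fixed_point:
  fixes H :: "real^3 \<Rightarrow> real" and p v :: "real \<Rightarrow> real"
  assumes R: "0 < R" "R \<le> \<rho>"
    and p [measurable]: "p \<in> borel_measurable borel" and p0: "\<And>s. 0 \<le> s \<Longrightarrow> 0 \<le> p s" and pR: "\<And>s. 0 \<le> s \<Longrightarrow> s < R \<Longrightarrow> 0 < p s"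
    and pB: "\<And>s. 0 \<le> s \<Longrightarrow> s \<le> \<rho> \<Longrightarrow> p s \<le> P"
    and v [measurable]: "v \<in> borel_measurable borel" and v0: "\<And>s. 0 < s \<Longrightarrow> s \<le> \<rho> \<Longrightarrow> 0 < v s"
    and vB: "\<And>s. 0 \<le> s \<Longrightarrow> s \<le> \<rho> \<Longrightarrow> \<bar>v s\<bar> \<le> V"
    and fix_v: "\<And>x e. x \<noteq> 0 \<Longrightarrow> norm x \<le> \<rho> \<Longrightarrow>
        newton \<rho> (\<lambda>y. p (norm y) * (v (norm y) * (y \<bullet> e / norm y))) x = v (norm x) * (x \<bullet> e / norm x)"
    and H [measurable]: "H \<in> borel_measurable borel" and HB: "\<And>y. \<bar>H y\<bar> \<le> B"
    and even: "\<And>y. H (- y) = H y"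
    and fix_H: "\<And>x. norm x \<le> \<rho> \<Longrightarrow> H x = newton \<rho> (\<lambda>y. p (norm y) * H y) x - C"
    and xy: "norm x\<^sub>1 = norm x\<^sub>2" "norm x\<^sub>1 \<le> \<rho>"
  shows "H x\<^sub>1 = H x\<^sub>2"
proof (cases "x\<^sub>1 = x\<^sub>2")
  case False
  define e where "e = x\<^sub>1 - x\<^sub>2"
  have e: "e \<noteq> 0" using False by (simp add: e_def)
  let ?\<sigma> = "householder e"
  define \<tau> where "\<tau> = (\<lambda>y. - ?\<sigma> y)"
  have o\<sigma>: "orthogonal_transformation ?\<sigma>" by (rule orthogonal_transformation_householder)
  have o\<tau>: "orthogonal_transformation \<tau>"
    unfolding \<tau>_def using o\<sigma> by (simp add: orthogonal_transformation_neg)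
  have n: "norm (?\<sigma> y) = norm y" "norm (\<tau> y) = norm y" for y
    using orthogonal_transformation_norm[OF o\<sigma>] orthogonal_transformation_norm[OF o\<tau>] by auto
  have invol: "?\<sigma> (?\<sigma> y) = y" for y
    using e by (simp add: householder_def algebra_simps inner_diff_left)
  have neg: "?\<sigma> (- y) = - ?\<sigma> y" for y by (simp add: householder_def)
  have ye: "?\<sigma> y \<bullet> e = - (y \<bullet> e)" "\<tau> y \<bullet> e = y \<bullet> e" for y
    using e by (simp_all add: householder_def inner_diff_left \<tau>_def)
  have \<sigma>m [measurable]: "?\<sigma> \<in> borel_measurable borel" unfolding householder_def by measurable

  define w where "w = (\<lambda>y. H (?\<sigma> y) - H y)"
  define W where "W = (\<lambda>y. sgn (y \<bullet> e) * \<bar>w y\<bar>)"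
  have w [measurable]: "w \<in> borel_measurable borel" unfolding w_def by measurable
  have W [measurable]: "W \<in> borel_measurable borel" unfolding W_def by measurable
  have w\<sigma>: "w (?\<sigma> y) = - w y" and w\<tau>: "w (\<tau> y) = - w y" for y
    by (simp_all add: w_def invol \<tau>_def even neg)
  have W\<sigma>: "W (?\<sigma> y) = - W y" and W\<tau>: "W (\<tau> y) = W y" for y
    by (simp_all add: W_def w\<sigma> w\<tau> ye sgn_minus)
  have P0: "0 \<le> P" using p0[of 0] pB[of 0] R by linarith
  have pabs: "\<bar>p (norm y)\<bar> \<le> P" if "norm y \<le> \<rho>" for y :: "real^3" using p0[of "norm y"] pB[of "norm y"] that by simp
  have pHB: "\<bar>p (norm y) * H (A y)\<bar> \<le> P * B" if "norm y \<le> \<rho>" for y :: "real^3" and A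
    unfolding abs_mult using pabs[OF that] HB by (intro mult_mono) auto
  have wB: "\<bar>w y\<bar> \<le> 2 * B" for y using HB[of y] HB[of "?\<sigma> y"] unfolding w_def by linarith
  have WB: "\<bar>W y\<bar> \<le> 2 * B" for y unfolding W_def using sgn_mult_abs_bound[of "y \<bullet> e" "\<bar>w y\<bar>"] wB[of y] by simp
  have B0: "0 \<le> B" using HB[of 0] by linarith
  have pwB: "\<bar>p (norm y) * w y\<bar> \<le> P * (2 * B)" and pWB: "\<bar>p (norm y) * W y\<bar> \<le> P * (2 * B)" if "norm y \<le> \<rho>" for y
    unfolding abs_mult using pabs[OF that] wB WB P0 by (auto intro!: mult_mono)
  have pw [measurable]: "(\<lambda>y. p (norm y) * w y) \<in> borel_measurable borel" by measurable
  have pW [measurable]: "(\<lambda>y. p (norm y) * W y) \<in> borel_measurable borel" by measurable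
  have pH [measurable]: "(\<lambda>y. p (norm y) * H y) \<in> borel_measurable borel" by measurable
  have pH\<sigma> [measurable]: "(\<lambda>y. p (norm y) * H (?\<sigma> y)) \<in> borel_measurable borel" by measurable

  have fix_w: "w x = newton \<rho> (\<lambda>y. p (norm y) * w y) x" if x: "norm x \<le> \<rho>" for x
  proof -
    have "H (?\<sigma> x) = newton \<rho> (\<lambda>y. p (norm y) * H y) (?\<sigma> x) - C" by (rule fix_H) (simp add: n x)
    also have "newton \<rho> (\<lambda>y. p (norm y) * H y) (?\<sigma> x) = newton \<rho> (\<lambda>y. p (norm y) * H (?\<sigma> y)) x"
      using newton_orthogonal[OF o\<sigma> pH, of \<rho> x] by (simp add: n)
    finally have "w x = newton \<rho> (\<lambda>y. p (norm y) * H (?\<sigma> y)) x - newton \<rho> (\<lambda>y. p (norm y) * H y) x"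
      using fix_H[OF x] by (simp add: w_def)
    also have "\<dots> = newton \<rho> (\<lambda>y. p (norm y) * H (?\<sigma> y) - p (norm y) * H y) x"
      by (rule newton_diff[OF pH\<sigma> pHB[of _ ?\<sigma>] pH pHB[of _ "\<lambda>y. y"], symmetric])
    finally show ?thesis by (simp add: w_def right_diff_distrib)
  qed

  define TW where "TW = newton \<rho> (\<lambda>y. p (norm y) * W y)"
  have TW\<sigma>: "TW (?\<sigma> x) = - TW x" for x
    unfolding TW_def using newton_orthogonal[OF o\<sigma> pW, of \<rho> x] by (simp add: n W\<sigma> newton_uminus)
  have TW\<tau>: "TW (\<tau> x) = TW x" for x
    unfolding TW_def using newton_orthogonal[OF o\<tau> pW, of \<rho> x] by (simp add: n W\<tau>)

  define \<phi>1 where "\<phi>1 = (\<lambda>y. p (norm y) * W y - p (norm y) * w y)"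
  define \<phi>2 where "\<phi>2 = (\<lambda>y. p (norm y) * W y + p (norm y) * w y)"
  have \<phi>m [measurable]: "\<phi>1 \<in> borel_measurable borel" "\<phi>2 \<in> borel_measurable borel"
    unfolding \<phi>1_def \<phi>2_def by measurable
  have \<phi>B: "\<bar>\<phi>1 y\<bar> \<le> P * (2 * B) + P * (2 * B)" "\<bar>\<phi>2 y\<bar> \<le> P * (2 * B) + P * (2 * B)" if "norm y \<le> \<rho>" for y
    unfolding \<phi>1_def \<phi>2_def using pwB[OF that] pWB[OF that] by linarith+
  have \<phi>\<sigma>: "\<phi>1 (?\<sigma> y) = - \<phi>1 y" "\<phi>2 (?\<sigma> y) = - \<phi>2 y" for y
    by (simp_all add: \<phi>1_def \<phi>2_def n w\<sigma> W\<sigma> algebra_simps)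
  have \<phi>s: "0 \<le> \<phi>1 y * (y \<bullet> e)" "0 \<le> \<phi>2 y * (y \<bullet> e)" for y
  proof -
    have a: "W y * (y \<bullet> e) = \<bar>y \<bullet> e\<bar> * \<bar>w y\<bar>" by (simp add: W_def abs_sgn mult_ac)
    have b: "\<bar>w y * (y \<bullet> e)\<bar> = \<bar>y \<bullet> e\<bar> * \<bar>w y\<bar>" by (simp add: abs_mult mult_ac)
    have "\<phi>1 y * (y \<bullet> e) = p (norm y) * (W y * (y \<bullet> e) - w y * (y \<bullet> e))" "\<phi>2 y * (y \<bullet> e) = p (norm y) * (W y * (y \<bullet> e) + w y * (y \<bullet> e))"
      by (simp_all add: \<phi>1_def \<phi>2_def algebra_simps)
    moreover have "0 \<le> W y * (y \<bullet> e) - w y * (y \<bullet> e)" "0 \<le> W y * (y \<bullet> e) + w y * (y \<bullet> e)" using a b by linarith+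
    ultimately show "0 \<le> \<phi>1 y * (y \<bullet> e)" "0 \<le> \<phi>2 y * (y \<bullet> e)" using p0[of "norm y"] by auto
  qed
  have T\<phi>: "newton \<rho> \<phi>1 x = TW x - w x" "newton \<rho> \<phi>2 x = TW x + w x" if x: "norm x \<le> \<rho>" for x
    unfolding \<phi>1_def \<phi>2_def TW_def fix_w[OF x]
    by (rule newton_diff[OF pW pWB pw pwB] newton_add[OF pW pWB pw pwB]; assumption)+
  have \<phi>1_pos: "0 \<le> newton \<rho> \<phi>1 x" "newton \<rho> \<phi>1 x = 0 \<Longrightarrow> AE y in lborel. norm y \<le> \<rho> \<longrightarrow> \<phi>1 y = 0"
    if "0 < x \<bullet> e" for x
    using newton_odd_nonneg[where \<rho> = \<rho>, OF \<phi>m(1) _ \<phi>\<sigma>(1) \<phi>s(1) that] \<phi>B(1) by blast+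
  have \<phi>2_pos: "0 \<le> newton \<rho> \<phi>2 x" "newton \<rho> \<phi>2 x = 0 \<Longrightarrow> AE y in lborel. norm y \<le> \<rho> \<longrightarrow> \<phi>2 y = 0"
    if "0 < x \<bullet> e" for x
    using newton_odd_nonneg[where \<rho> = \<rho>, OF \<phi>m(2) _ \<phi>\<sigma>(2) \<phi>s(2) that] \<phi>B(2) by blast+
  have TW_ge: "\<bar>w x\<bar> \<le> TW x" if "norm x \<le> \<rho>" "0 < x \<bullet> e" for x
    using \<phi>1_pos(1)[OF that(2)] \<phi>2_pos(1)[OF that(2)] T\<phi>[OF that(1)] by linarith
  \<comment> \<open>The inequality \<open>|w| \<le> T|w|\<close>, continued oddly to the other half space.\<close>
  have diff_sign: "0 \<le> (TW x - W x) * (x \<bullet> e)" if x: "norm x \<le> \<rho>" for x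
  proof (cases "x \<bullet> e" "0::real" rule: linorder_cases)
    case greater
    then show ?thesis using TW_ge[OF x] by (simp add: W_def)
  next
    case less
    then have "\<bar>w (?\<sigma> x)\<bar> \<le> TW (?\<sigma> x)" using x by (intro TW_ge) (simp_all add: n ye)
    then have "TW x - W x \<le> 0" using less by (simp add: w\<sigma> TW\<sigma> W_def)
    then show ?thesis using less by (simp add: mult_nonpos_nonpos)
  qed simp

  define z where "z = (\<lambda>y. v (norm y) * (y \<bullet> e / norm y))"
  have [measurable]: "z \<in> borel_measurable borel" unfolding z_def by measurable
  have pz [measurable]: "(\<lambda>y. p (norm y) * z y) \<in> borel_measurable borel" by measurable
  have pzB: "\<bar>p (norm y) * z y\<bar> \<le> P * (\<bar>V\<bar> * norm e)" if "norm y \<le> \<rho>" for y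
  proof -
    have "\<bar>y \<bullet> e / norm y\<bar> \<le> norm e"
      using Cauchy_Schwarz_ineq2[of y e] by (cases "y = 0") (auto simp: field_simps)
    moreover have "\<bar>v (norm y)\<bar> \<le> \<bar>V\<bar>" using vB[of "norm y"] that by simp
    ultimately have "\<bar>z y\<bar> \<le> \<bar>V\<bar> * norm e" unfolding z_def abs_mult by (intro mult_mono) auto
    then show ?thesis unfolding abs_mult using pabs[OF that] P0 by (intro mult_mono) auto
  qed
  have \<rho>: "0 \<le> \<rho>" using R by simp
  let ?b = "indicator (cball (0::real^3) \<rho>) :: _ \<Rightarrow> real"
  have sym: "(LBINT x. ?b x * (p (norm x) * z x * TW x)) =
      (LBINT x. ?b x * (p (norm x) * W x * newton \<rho> (\<lambda>y. p (norm y) * z y) x))"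
    unfolding TW_def by (rule newton_symmetric(1)[OF \<rho> pz pzB pW pWB])
  have iT: "integrable lborel (\<lambda>x. ?b x * (p (norm x) * z x * TW x))"
    unfolding TW_def by (rule newton_symmetric(2)[OF \<rho> pz pzB pW pWB])
  have iZ: "integrable lborel (\<lambda>x. ?b x * (p (norm x) * W x * newton \<rho> (\<lambda>y. p (norm y) * z y) x))"
    by (rule newton_symmetric(2)[OF \<rho> pW pWB pz pzB])
  \<comment> \<open>Only almost everywhere, because \<open>fix_v\<close> excludes the origin.\<close>
  have z_fix: "AE x in lborel. ?b x * (p (norm x) * W x * newton \<rho> (\<lambda>y. p (norm y) * z y) x) = ?b x * (p (norm x) * z x * W x)"
    using AE_lborel_singleton[of "0::real^3"]
  proof eventually_elim
    case (elim x)
    show ?case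
    proof (cases "norm x \<le> \<rho>")
      case True
      show ?thesis using fix_v[OF elim True, of e] by (simp add: z_def)
    qed simp
  qed
  define I where "I = (\<lambda>x. ?b x * (p (norm x) * z x * (TW x - W x)))"
  have iW: "integrable lborel (\<lambda>x. ?b x * (p (norm x) * z x * W x))"
    by (rule integrable_cong_AE_imp[OF iZ _ z_fix]) measurable
  have int_z: "(LBINT x. ?b x * (p (norm x) * z x * TW x)) = (LBINT x. ?b x * (p (norm x) * z x * W x))"
    unfolding sym
    by (rule integral_cong_AE[OF borel_measurable_integrable[OF iZ] borel_measurable_integrable[OF iW] z_fix])
  have I_eq: "I = (\<lambda>x. ?b x * (p (norm x) * z x * TW x) - ?b x * (p (norm x) * z x * W x))"
    by (simp add: I_def fun_eq_iff algebra_simps)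
  have iI: "integrable lborel I" unfolding I_eq by (rule Bochner_Integration.integrable_diff[OF iT iW])
  have "integral\<^sup>L lborel I = 0"
    unfolding I_eq by (subst Bochner_Integration.integral_diff[OF iT iW]) (simp add: int_z)
  moreover have I0: "0 \<le> I x" for x
  proof (cases "norm x \<le> \<rho> \<and> x \<noteq> 0")
    case True
    have "I x = p (norm x) * (v (norm x) / norm x) * ((TW x - W x) * (x \<bullet> e))" using True by (simp add: I_def z_def)
    moreover have "0 < v (norm x)" using v0[of "norm x"] True by simp
    ultimately show ?thesis using diff_sign[of x] p0[of "norm x"] True by simp
  qed (auto simp: I_def z_def)
  ultimately have ae: "AE x in lborel. I x = 0" using integral_nonneg_eq_0_iff_AE[OF iI] by simp
  let ?S = "ball (0::real^3) R \<inter> {x. 0 < e \<bullet> x}"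
  have "open ?S" by (intro open_Int open_ball open_halfspace_gt)
  moreover have "(R / (2 * norm e)) *\<^sub>R e \<in> ?S" using e R by simp
  then have "?S \<noteq> {}" by blast
  ultimately obtain x where xS: "x \<in> ?S" and Ix: "I x = 0" by (rule AE_lborel_open_obtain[OF ae])
  then have x: "norm x < R" "norm x \<le> \<rho>" "0 < x \<bullet> e" "x \<noteq> 0" using R by (auto simp: inner_commute)
  have "p (norm x) \<noteq> 0" "v (norm x) \<noteq> 0" using pR[of "norm x"] v0[of "norm x"] x by auto
  then have TWx: "TW x = \<bar>w x\<bar>" using Ix x by (simp add: I_def z_def W_def)
  have x': "norm (\<tau> x) \<le> \<rho>" "0 < \<tau> x \<bullet> e" using x by (simp_all add: n ye)
  \<comment> \<open>As \<open>T W\<close> and \<open>W\<close> are even under \<open>\<tau>\<close> while \<open>w\<close> is odd, \<open>T (W - w)\<close> vanishes at one of the points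
    \<open>x\<close>, \<open>\<tau> x\<close>, and \<open>T (W + w)\<close> at the other.\<close>
  have "(AE y in lborel. norm y \<le> \<rho> \<longrightarrow> \<phi>1 y = 0) \<and> (AE y in lborel. norm y \<le> \<rho> \<longrightarrow> \<phi>2 y = 0)"
  proof (cases "0 \<le> w x")
    case True
    have "newton \<rho> \<phi>1 x = 0" "newton \<rho> \<phi>2 (\<tau> x) = 0" using T\<phi>(1)[OF x(2)] T\<phi>(2)[OF x'(1)] True TWx by (simp_all add: TW\<tau> w\<tau>)
    then show ?thesis using \<phi>1_pos(2)[OF x(3)] \<phi>2_pos(2)[OF x'(2)] by blast
  next
    case False
    have "newton \<rho> \<phi>1 (\<tau> x) = 0" "newton \<rho> \<phi>2 x = 0" using T\<phi>(1)[OF x'(1)] T\<phi>(2)[OF x(2)] False TWx by (simp_all add: TW\<tau> w\<tau>)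
    then show ?thesis using \<phi>1_pos(2)[OF x'(2)] \<phi>2_pos(2)[OF x(3)] by blast
  qed
  then have "AE y in lborel. norm y \<le> \<rho> \<longrightarrow> \<phi>1 y = 0" "AE y in lborel. norm y \<le> \<rho> \<longrightarrow> \<phi>2 y = 0" by auto
  then have "AE y in lborel. norm y \<le> \<rho> \<longrightarrow> p (norm y) * w y = 0"
    by eventually_elim (auto simp: \<phi>1_def \<phi>2_def)
  then have "newton \<rho> (\<lambda>y. p (norm y) * w y) x\<^sub>1 = newton \<rho> (\<lambda>y. 0) x\<^sub>1" by (intro newton_cong_AE) auto
  then have "w x\<^sub>1 = 0" using fix_w[OF xy(2)] by (simp add: newton_def)
  moreover have "?\<sigma> x\<^sub>1 = x\<^sub>2" unfolding e_def by (rule householder_swap[OF xy(1)])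
  ultimately show ?thesis by (simp add: w_def)
qed simp

section \<open>The source term of the equation of state\<close>

locale enthalpy_inverse =
  fixes A \<gamma> :: real and \<Lambda> P \<Lambda>\<^sub>\<rho> :: "real \<Rightarrow> real"
  assumes eos: "equation_of_state A \<gamma> \<Lambda> P" and inversion: "enthalpy_inversion A \<gamma> P \<Lambda>\<^sub>\<rho>"
begin

definition "\<nu> = 1 / (\<gamma> - 1)"
definition "rho_coeff = ((\<gamma> - 1) / (\<gamma> * A)) powr \<nu>"
definition "rho_of w = rho_coeff * w powr \<nu> * (1 + \<Lambda>\<^sub>\<rho> w)"
text \<open>
  The enthalpy as a Henstock-Kurzweil integral over a closed interval, to which the fundamental
  theorem of calculus applies directly.
\<close>

definition "enth x = integral {0..x} (\<lambda>s. deriv P s / s)"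

lemma \<nu>_gt_1: "\<nu> > 1" and rho_coeff_pos: "rho_coeff > 0"
  using eos by (auto simp: \<nu>_def rho_coeff_def equation_of_state_def)

lemma P_deriv: "s > 0 \<Longrightarrow> deriv P s > 0" "s > 0 \<Longrightarrow> isCont (deriv P) s"
proof -
  assume s: "s > 0"
  show "deriv P s > 0" using eos s by (auto simp: equation_of_state_def)
  have "((deriv ^^ 1) P) differentiable (at s)" using eos s unfolding equation_of_state_def smooth_on_def by blast
  then show "isCont (deriv P) s" by (simp add: differentiable_imp_continuous_within)
qed

lemma Lambda_rho_smooth:
  "(\<Lambda>\<^sub>\<rho> has_real_derivative deriv \<Lambda>\<^sub>\<rho> x) (at x)" "isCont (deriv \<Lambda>\<^sub>\<rho>) x"
proof -
  have "((deriv ^^ n) \<Lambda>\<^sub>\<rho>) differentiable (at x)" for n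
    using inversion unfolding enthalpy_inversion_def smooth_on_def by blast
  from this[of 0] this[of 1] have "\<Lambda>\<^sub>\<rho> differentiable (at x)" "deriv \<Lambda>\<^sub>\<rho> differentiable (at x)" by simp_all
  then show "(\<Lambda>\<^sub>\<rho> has_real_derivative deriv \<Lambda>\<^sub>\<rho> x) (at x)" "isCont (deriv \<Lambda>\<^sub>\<rho>) x"
    using DERIV_deriv_iff_real_differentiable differentiable_imp_continuous_within by blast+
qed

lemma rho_of_enthalpy: "\<rho> > 0 \<Longrightarrow> rho_of (enthalpy P \<rho>) = \<rho>"
  using inversion unfolding enthalpy_inversion_def rho_of_def rho_coeff_def \<nu>_def by auto

text \<open>
  The integral of a non-integrable function is 0 by convention, but enthalpy 0 would be inverted to
  density 0.
\<close>

lemma integrable_enthalpy: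
  assumes "\<rho> > 0" shows "set_integrable lborel {0<..\<rho>} (\<lambda>s. deriv P s / s)"
proof (rule ccontr)
  assume "\<not> ?thesis"
  then have "enthalpy P \<rho> = 0"
    unfolding enthalpy_def set_lebesgue_integral_def set_integrable_def by (rule not_integrable_integral_eq)
  then show False using rho_of_enthalpy[OF assms] assms by (simp add: rho_of_def)
qed

lemma enth_integral: 
  assumes "\<rho> > 0" 
  shows "(\<lambda>s. deriv P s / s) integrable_on {0..\<rho>}" "enthalpy P \<rho> = enth \<rho>"
proof -
  note i = set_borel_integral_eq_integral[OF integrable_enthalpy[OF assms]]
  let ?g = "\<lambda>s. deriv P s / s"
  have "{x \<in> {0<..\<rho>} - {0..\<rho>}. ?g x \<noteq> 0} \<subseteq> {0}" "{x \<in> {0..\<rho>} - {0<..\<rho>}. ?g x \<noteq> 0} \<subseteq> {0}"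
    by auto
  then have neg: "negligible {x \<in> {0<..\<rho>} - {0..\<rho>}. ?g x \<noteq> 0}" "negligible {x \<in> {0..\<rho>} - {0<..\<rho>}. ?g x \<noteq> 0}"
    by (meson negligible_sing negligible_subset)+
  show "?g integrable_on {0..\<rho>}" by (rule integrable_spike_set[OF i(1) neg])
  show "enthalpy P \<rho> = enth \<rho>"
    unfolding enthalpy_def enth_def i(2) by (rule integral_spike_set[OF neg])
qed

lemma enth_continuous: "continuous_on {0..\<rho>} enth"
proof (cases "\<rho> > 0")
  case True
  show ?thesis unfolding enth_def by (rule indefinite_integral_continuous_1[OF enth_integral(1)[OF True]])
next
  case False
  then have "{0..\<rho>} \<subseteq> {0}" by auto
  then show ?thesis by (metis continuous_on_sing continuous_on_subset)
qed

lemma enth_deriv: assumes "\<rho> > 0" shows "(enth has_real_derivative deriv P \<rho> / \<rho>) (at \<rho>)"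
proof -
  let ?g = "\<lambda>s. deriv P s / s"
  let ?a = "\<rho> / 2" and ?b = "2 * \<rho>"
  have cont: "continuous_on {?a..?b} ?g"
    using assms P_deriv(2) by (intro continuous_at_imp_continuous_on ballI continuous_intros) auto
  have "((\<lambda>x. integral {?a..x} ?g) has_real_derivative ?g \<rho>) (at \<rho> within {?a..?b})"
    using assms by (intro integral_has_real_derivative cont) auto
  moreover have "at \<rho> within {?a..?b} = at \<rho>" using assms by (intro at_within_interior) auto
  ultimately have D: "((\<lambda>x. integral {0..?a} ?g + integral {?a..x} ?g) has_real_derivative ?g \<rho>) (at \<rho>)"
    by (auto intro!: derivative_eq_intros)
  have eq: "integral {0..?a} ?g + integral {?a..x} ?g = enth x" if "x \<in> {?a<..<?b}" for x
    unfolding enth_def using that assms by (intro Henstock_Kurzweil_Integration.integral_combine enth_integral(1)) auto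
  show ?thesis
    by (rule has_field_derivative_transform_within_open[OF D, where S = "{?a<..<?b}"]) (use assms eq in auto)
qed

text \<open>
  A bounded enthalpy would stay in a compact interval, on which the inverse \<open>rho_of\<close> is bounded
  by continuity; but \<open>rho_of\<close> recovers every density.
\<close>

lemma enth_surj: assumes "w > 0" obtains \<rho> where "\<rho> > 0" "enth \<rho> = w"
proof -
  have cont: "continuous_on {0..w} rho_of"
  proof -
    have "continuous_on {0..w} \<Lambda>\<^sub>\<rho>" using Lambda_rho_smooth(1) by (meson DERIV_isCont continuous_at_imp_continuous_on)
    then show ?thesis unfolding rho_of_def using \<nu>_gt_1 by (intro continuous_intros continuous_on_powr') auto
  qed
  then obtain M where M: "\<forall>t\<in>{0..w}. \<bar>rho_of t\<bar> \<le> M"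
    using compact_imp_bounded[OF compact_continuous_image[OF cont compact_Icc]] by (auto simp: bounded_iff)
  define \<rho> where "\<rho> = max M 0 + 1"
  have \<rho>: "\<rho> > 0" by (simp add: \<rho>_def)
  have e0: "enth 0 = 0" by (simp add: enth_def)
  have "enth 0 < enth \<rho>"
    by (rule DERIV_pos_imp_increasing_open[OF \<rho> _ enth_continuous])
       (use enth_deriv P_deriv(1) in \<open>force intro!: divide_pos_pos\<close>)
  have "w \<le> enth \<rho>"
  proof (rule ccontr)
    assume "\<not> w \<le> enth \<rho>"
    with \<open>enth 0 < enth \<rho>\<close> e0 have "\<bar>rho_of (enth \<rho>)\<bar> \<le> M" using M by auto
    then have "\<bar>\<rho>\<bar> \<le> M" using rho_of_enthalpy[OF \<rho>] enth_integral(2)[OF \<rho>] by simp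
    then show False unfolding \<rho>_def by linarith
  qed
  then obtain x where x: "0 \<le> x" "x \<le> \<rho>" "enth x = w"
    using IVT'[of enth 0 w \<rho>] enth_continuous[of \<rho>] e0 assms \<rho> by auto
  then have "x \<noteq> 0" using e0 assms by auto
  with x show ?thesis using that[of x] by simp
qed

lemma rho_of_pos: assumes "w > 0" shows "rho_of w > 0"
proof -
  obtain \<rho> where "\<rho> > 0" "enth \<rho> = w" using enth_surj[OF assms] .
  then show ?thesis using rho_of_enthalpy[of \<rho>] enth_integral(2)[of \<rho>] by simp
qed

text \<open>
  Differentiate \<open>rho_of (enth \<rho>) = \<rho>\<close>; the enthalpy has derivative \<open>P'(\<rho>) / \<rho> > 0\<close>.
\<close>

lemma rho_of_deriv_pos:
  assumes w: "w > 0" and D: "(rho_of has_real_derivative D) (at w)" shows "D > 0"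
proof -
  obtain \<rho> where \<rho>: "\<rho> > 0" "enth \<rho> = w" using enth_surj[OF w] .
  let ?g = "deriv P \<rho> / \<rho>"
  have "((\<lambda>x. rho_of (enth x)) has_real_derivative D * ?g) (at \<rho>)"
    by (rule DERIV_chain2[OF _ enth_deriv[OF \<rho>(1)]]) (simp add: \<rho> D)
  moreover have "((\<lambda>x. rho_of (enth x)) has_real_derivative 1) (at \<rho>)"
    by (rule has_field_derivative_transform_within_open[OF DERIV_ident, where S = "{0<..}"])
       (use \<rho> rho_of_enthalpy enth_integral(2) in auto)
  ultimately have "D * ?g = 1" by (rule DERIV_unique)
  moreover have "?g > 0" using P_deriv(1)[OF \<rho>(1)] \<rho>(1) by simp
  ultimately show ?thesis by (metis zero_less_mult_pos2 zero_less_one)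
qed

end

lemma max_powr_has_derivative:
  fixes \<nu> u :: real
  assumes "\<nu> > 1"
  shows "((\<lambda>u. max u 0 powr \<nu>) has_real_derivative \<nu> * max u 0 powr (\<nu> - 1)) (at u)"
proof (cases u "0::real" rule: linorder_cases)
  case greater
  have "((\<lambda>u. u powr \<nu>) has_real_derivative \<nu> * u powr (\<nu> - 1)) (at u)"
    using greater by (rule has_real_derivative_powr)
  then have "((\<lambda>u. max u 0 powr \<nu>) has_real_derivative \<nu> * u powr (\<nu> - 1)) (at u)"
    by (rule has_field_derivative_transform_within_open[where S = "{0<..}"]) (use greater in auto)
  then show ?thesis using greater by simp
next
  case less
  have "((\<lambda>u. max u 0 powr \<nu>) has_real_derivative 0) (at u)"
    by (rule has_field_derivative_transform_within_open[OF DERIV_const[of 0], where S = "{..<0}"]) (use less in auto)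
  then show ?thesis using less by simp
next
  case equal
  have "continuous_on UNIV (\<lambda>h::real. max h 0)" by (intro continuous_intros)
  then have "continuous_on UNIV (\<lambda>h::real. max h 0 powr (\<nu> - 1))"
    by (rule continuous_on_powr') (use assms in \<open>auto intro: continuous_intros\<close>)
  then have "isCont (\<lambda>h::real. max h 0 powr (\<nu> - 1)) 0" by (rule continuous_on_interior) simp
  then have lim: "((\<lambda>h::real. max h 0 powr (\<nu> - 1)) \<longlongrightarrow> 0) (at 0)" by (simp add: isCont_def)
  have quot: "max h 0 powr (\<nu> - 1) = (max (0 + h) 0 powr \<nu> - max 0 0 powr \<nu>) / h" if "h \<noteq> 0" for h :: real
    using that by (cases "h > 0") (auto simp: powr_diff)
  have "((\<lambda>h::real. (max (0 + h) 0 powr \<nu> - max 0 0 powr \<nu>) / h) \<longlongrightarrow> 0) (at 0)"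
    by (rule Lim_transform_eventually[OF lim]) (use quot in \<open>auto simp: eventually_at_filter\<close>)
  then show ?thesis by (simp add: equal DERIV_def)
qed

text \<open>
  Up to scaling the source is \<open>rho_of\<close>, so positivity and monotonicity come from the inversion
  formula, while \<open>\<nu> > 1\<close> gives a continuous derivative across \<open>u = 0\<close>.
\<close>

lemma (in enthalpy_inverse) source_regular:
  assumes uO: "u\<^sub>O > 0" and f: "f = f_source \<nu> \<Lambda>\<^sub>\<rho> u\<^sub>O"
  shows "(f has_real_derivative deriv f u) (at u)" "continuous_on UNIV (deriv f)"
    "u > 0 \<Longrightarrow> f u > 0" "u > 0 \<Longrightarrow> deriv f u > 0" "u \<le> 0 \<Longrightarrow> f u = 0" "u \<le> 0 \<Longrightarrow> deriv f u = 0"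
proof -
  define d where "d = (\<lambda>u. \<nu> * max u 0 powr (\<nu> - 1) * (1 + \<Lambda>\<^sub>\<rho> (u\<^sub>O * u)) + max u 0 powr \<nu> * (deriv \<Lambda>\<^sub>\<rho> (u\<^sub>O * u) * u\<^sub>O))"
  have D: "(f has_real_derivative d u) (at u)" for u
  proof -
    have "((\<lambda>u. \<Lambda>\<^sub>\<rho> (u\<^sub>O * u)) has_real_derivative deriv \<Lambda>\<^sub>\<rho> (u\<^sub>O * u) * u\<^sub>O) (at u)"
      by (rule DERIV_chain2[OF Lambda_rho_smooth(1)]) (auto intro!: derivative_eq_intros)
    then have L: "((\<lambda>u. 1 + \<Lambda>\<^sub>\<rho> (u\<^sub>O * u)) has_real_derivative deriv \<Lambda>\<^sub>\<rho> (u\<^sub>O * u) * u\<^sub>O) (at u)"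
      by (auto intro!: derivative_eq_intros)
    show ?thesis unfolding f f_source_def[abs_def]
      by (rule DERIV_cong[OF DERIV_mult[OF max_powr_has_derivative[OF \<nu>_gt_1] L]]) (simp add: d_def mult_ac)
  qed
  then have df: "deriv f = d" using DERIV_imp_deriv by blast
  show "(f has_real_derivative deriv f u) (at u)" using D df by simp
  have cL: "continuous_on UNIV (deriv \<Lambda>\<^sub>\<rho>)" "continuous_on UNIV \<Lambda>\<^sub>\<rho>"
    by (intro continuous_at_imp_continuous_on ballI Lambda_rho_smooth(2) DERIV_isCont[OF Lambda_rho_smooth(1)])+
  have lin: "continuous_on UNIV (\<lambda>u. u\<^sub>O * u)" by (intro continuous_intros)
  have L: "continuous_on UNIV (\<lambda>u. deriv \<Lambda>\<^sub>\<rho> (u\<^sub>O * u))" "continuous_on UNIV (\<lambda>u. \<Lambda>\<^sub>\<rho> (u\<^sub>O * u))"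
    using continuous_on_compose2[OF cL(1) lin] continuous_on_compose2[OF cL(2) lin] by simp_all
  show "continuous_on UNIV (deriv f)"
    unfolding df d_def using \<nu>_gt_1 by (intro continuous_intros continuous_on_powr' L) auto
  have k: "rho_coeff * u\<^sub>O powr \<nu> > 0" using rho_coeff_pos uO by simp
  have fd: "f u = rho_of (u\<^sub>O * u) / (rho_coeff * u\<^sub>O powr \<nu>)" if "u > 0" for u
    using that uO rho_coeff_pos by (simp add: f f_source_def rho_of_def powr_mult)
  show "u > 0 \<Longrightarrow> f u > 0" using fd[of u] rho_of_pos[of "u\<^sub>O * u"] uO k by simp
  show "u > 0 \<Longrightarrow> deriv f u > 0"
  proof -
    assume u: "u > 0"
    have "((\<lambda>w. (rho_coeff * u\<^sub>O powr \<nu>) * f (w / u\<^sub>O)) has_real_derivative (rho_coeff * u\<^sub>O powr \<nu>) * (d u * (1 / u\<^sub>O))) (at (u\<^sub>O * u))"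
      by (rule DERIV_cmult, rule DERIV_chain2) (use uO D[of u] in \<open>auto intro!: derivative_eq_intros\<close>)
    then have "(rho_of has_real_derivative (rho_coeff * u\<^sub>O powr \<nu>) * (d u * (1 / u\<^sub>O))) (at (u\<^sub>O * u))"
      by (rule has_field_derivative_transform_within_open[where S = "{0<..}"]) (use uO u k fd in auto)
    then have "(rho_coeff * u\<^sub>O powr \<nu>) * (d u * (1 / u\<^sub>O)) > 0" by (rule rho_of_deriv_pos[rotated]) (use uO u in simp)
    then have "(rho_coeff * u\<^sub>O powr \<nu> / u\<^sub>O) * d u > 0" by (simp add: mult_ac)
    moreover have "rho_coeff * u\<^sub>O powr \<nu> / u\<^sub>O > 0" using k uO by simp
    ultimately show "deriv f u > 0" unfolding df by (rule zero_less_mult_pos)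
  qed
  show "u \<le> 0 \<Longrightarrow> f u = 0" by (simp add: f f_source_def max_def)
  show "u \<le> 0 \<Longrightarrow> deriv f u = 0" by (simp add: df d_def max_def)
qed

section \<open>The radial initial value problem\<close>

text \<open>
  Up to the factor \<open>4 \<pi>\<close>, the mass inside radius \<open>r\<close> of the radial density \<open>g\<close>.
\<close>

definition mass :: "(real \<Rightarrow> real) \<Rightarrow> real \<Rightarrow> real" where
  "mass g r = integral {0..r} (\<lambda>t. g t * t\<^sup>2)"

definition potential :: "(real \<Rightarrow> real) \<Rightarrow> real \<Rightarrow> real" where
  "potential g r = integral {0..r} (\<lambda>t. g t * t)"

text \<open>
  The value at radius \<open>r\<close> of the Newtonian potential of \<open>g\<close>, shifted by a constant so that it is 1 at
  the centre; the density outside radius \<open>r\<close> cancels in the shift. For \<open>r \<le> 0\<close> the integrals are 0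
  and the value is 1.
\<close>

definition profile :: "(real \<Rightarrow> real) \<Rightarrow> real \<Rightarrow> real" where
  "profile g r = 1 - (potential g r - mass g r / r)"

lemma integral_from_0_deriv:
  fixes k :: "real \<Rightarrow> real"
  assumes k: "continuous_on {0..} k" and r: "0 < r"
  shows "((\<lambda>r. integral {0..r} k) has_real_derivative k r) (at r)"
proof -
  have "((\<lambda>x. integral {0..x} k) has_real_derivative k r) (at r within {0..2*r})"
    using r by (intro integral_has_real_derivative continuous_on_subset[OF k]) auto
  moreover have "at r within {0..2*r} = at r" using r by (intro at_within_interior) auto
  ultimately show ?thesis by simp
qed

context
  fixes g :: "real \<Rightarrow> real"
  assumes g: "continuous_on {0..} g"
begin

lemma continuous_on_moments: "continuous_on {0..} (\<lambda>t. g t * t\<^sup>2)" "continuous_on {0..} (\<lambda>t. g t * t)"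
  by (intro continuous_intros g)+

lemma mass_deriv: "0 < r \<Longrightarrow> (mass g has_real_derivative g r * r\<^sup>2) (at r)"
  unfolding mass_def by (rule integral_from_0_deriv[OF continuous_on_moments(1)])

lemma potential_deriv: "0 < r \<Longrightarrow> (potential g has_real_derivative g r * r) (at r)"
  unfolding potential_def by (rule integral_from_0_deriv[OF continuous_on_moments(2)])

lemma profile_deriv: "0 < r \<Longrightarrow> (profile g has_real_derivative - (mass g r / r\<^sup>2)) (at r)"
  unfolding profile_def
  by (auto intro!: derivative_eq_intros mass_deriv potential_deriv simp: field_simps power2_eq_square)

lemma mass_nonpos_arg: "r \<le> 0 \<Longrightarrow> mass g r = 0" and potential_nonpos_arg: "r \<le> 0 \<Longrightarrow> potential g r = 0"
  by (cases "r = 0"; simp add: mass_def potential_def)+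

lemma continuous_on_mass: "continuous_on {0..r} (mass g)"
  unfolding mass_def
  by (intro indefinite_integral_continuous_1 integrable_continuous_real continuous_on_subset[OF continuous_on_moments(1)]) auto

lemma continuous_on_potential: "continuous_on {0..r} (potential g)"
  unfolding potential_def
  by (intro indefinite_integral_continuous_1 integrable_continuous_real continuous_on_subset[OF continuous_on_moments(2)]) auto

text \<open>
  This makes \<open>mass g r / r\<close> tend to 0 at the centre and keeps \<open>mass g r / r\<^sup>2\<close>, the slope of the
  profile, bounded.
\<close>

lemma mass_bound:
  assumes "0 \<le> r" "r \<le> \<rho>" "\<And>s. 0 \<le> s \<Longrightarrow> s \<le> \<rho> \<Longrightarrow> \<bar>g s\<bar> \<le> B"
  shows "\<bar>mass g r\<bar> \<le> B * r\<^sup>2 * r"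
proof -
  have "norm (integral {0..r} (\<lambda>t. g t * t\<^sup>2)) \<le> (B * r\<^sup>2) * (r - 0)"
  proof (rule integral_bound)
    show "0 \<le> r" "continuous_on {0..r} (\<lambda>t. g t * t\<^sup>2)" using assms(1) by (auto intro: continuous_on_subset[OF continuous_on_moments(1)])
    have B: "0 \<le> B" using assms(3)[of 0] assms(1,2) by linarith
    fix t assume "t \<in> {0..r}"
    then show "norm (g t * t\<^sup>2) \<le> B * r\<^sup>2"
      using assms B unfolding norm_mult by (intro mult_mono) (auto intro: power_mono)
  qed
  then show ?thesis by (simp add: mass_def)
qed

lemma continuous_on_profile: "continuous_on UNIV (profile g)"
proof (rule continuous_at_imp_continuous_on, rule ballI)
  fix r :: real
  consider "r > 0" | "r < 0" | "r = 0" by linarith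
  then show "isCont (profile g) r"
  proof cases
    case 1
    then show ?thesis by (rule DERIV_isCont[OF profile_deriv])
  next
    case 2
    have "\<forall>\<^sub>F x in nhds r. profile g x = 1"
      using 2 eventually_nhds_in_open[of "{..<0}" r]
      by (auto elim!: eventually_mono simp: profile_def mass_nonpos_arg potential_nonpos_arg)
    from isCont_cong[OF this] show ?thesis by simp
  next
    case 3
    obtain B where B: "\<forall>s\<in>{0..1}. \<bar>g s\<bar> \<le> B"
      using compact_imp_bounded[OF compact_continuous_image[OF continuous_on_subset[OF g, of "{0..1}"] compact_Icc]]
      by (auto simp: bounded_iff)
    have "(potential g \<longlongrightarrow> potential g 0) (at_right 0)"
      using continuous_on_potential[of 1] by (simp add: continuous_on_Icc_at_rightD)
    then have p: "(potential g \<longlongrightarrow> 0) (at_right 0)" by (simp add: potential_nonpos_arg)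
    have "((\<lambda>r. mass g r / r) \<longlongrightarrow> 0) (at_right 0)"
    proof (rule Lim_null_comparison)
      show "((\<lambda>r. B * r\<^sup>2) \<longlongrightarrow> 0) (at_right 0)" by (auto intro!: tendsto_eq_intros)
      show "\<forall>\<^sub>F r in at_right 0. norm (mass g r / r) \<le> B * r\<^sup>2"
        using eventually_at_right_real[OF zero_less_one]
      proof eventually_elim
        case (elim r)
        then show ?case using mass_bound[of r 1 B] B by (simp add: abs_divide divide_le_eq)
      qed
    qed
    from tendsto_diff[OF tendsto_const tendsto_diff[OF p this], of 1]
    have right: "(profile g \<longlongrightarrow> 1) (at_right 0)" by (simp add: profile_def[abs_def])
    have "((\<lambda>_. 1 :: real) \<longlongrightarrow> 1) (at_left 0)" by simp
    then have left: "(profile g \<longlongrightarrow> 1) (at_left 0)"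
      by (rule Lim_transform_eventually) (auto simp: eventually_at_filter profile_def mass_nonpos_arg potential_nonpos_arg)
    have "profile g 0 = 1" by (simp add: profile_def mass_nonpos_arg potential_nonpos_arg)
    with left right show ?thesis unfolding 3 isCont_def by (simp add: filterlim_split_at)
  qed
qed

end

text \<open>
  Let \<open>ub\<close> be \<open>u\<close> continued by its limits 1 and 0 at the end points, and let \<open>U\<close> be the profile of
  \<open>f \<circ> ub\<close>. Integrating the equation once gives \<open>s\<^sup>2 u' + mass = k\<close>, and once more
  \<open>u - U + k / s = c\<close> on \<open>(0, R)\<close>. Since \<open>u\<close> and \<open>U\<close> both tend to 1 at the centre, both constants
  vanish, so \<open>U = u\<close>. Beyond \<open>R\<close> the function \<open>U\<close> keeps decreasing and is negative, which is why
  \<open>f \<circ> U\<close> is again the density that generates it.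
\<close>

lemma radial_extension:
  fixes f u :: "real \<Rightarrow> real" and R :: real
  assumes f_cont: "continuous_on UNIV f" and f_pos: "\<And>t. t > 0 \<Longrightarrow> f t > 0" and f_0: "\<And>t. t \<le> 0 \<Longrightarrow> f t = 0"
    and R: "0 < R" and ivp: "radial_ivp_solution f R u"
    and pos: "\<And>r. 0 < r \<Longrightarrow> r < R \<Longrightarrow> u r > 0" and lim: "(u \<longlongrightarrow> 0) (at_left R)"
  obtains U where "continuous_on UNIV U" "\<And>r. 0 < r \<Longrightarrow> r < R \<Longrightarrow> U r = u r" "\<And>r. 0 \<le> r \<Longrightarrow> r < R \<Longrightarrow> 0 < U r"
    "U R = 0" "\<And>r. R < r \<Longrightarrow> U r < 0"
    "\<And>r. 0 < r \<Longrightarrow> 0 < mass (f \<circ> U) r" 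
    "\<And>r. 0 \<le> r \<Longrightarrow> U r = profile (f \<circ> U) r"
proof -
  have u1: "(u \<longlongrightarrow> 1) (at_right 0)"
  proof -
    have "(\<lambda>r. u r - 1) \<in> O[at_right 0](\<lambda>r. r\<^sup>2)" using ivp by (simp add: radial_ivp_solution_def)
    then obtain c where c: "\<forall>\<^sub>F r in at_right 0. norm (u r - 1) \<le> c * norm (r\<^sup>2)" by (rule landau_o.bigE)
    have "((\<lambda>r::real. c * norm (r\<^sup>2)) \<longlongrightarrow> 0) (at_right 0)" by (auto intro!: tendsto_eq_intros)
    from Lim_null_comparison[OF c this] show ?thesis by (simp add: LIM_zero_iff)
  qed
  have u_diff: "(u has_real_derivative deriv u r) (at r)" 
    and q_diff: "((\<lambda>s. s\<^sup>2 * deriv u s) has_real_derivative - f (u r) * r\<^sup>2) (at r)" if r: "0 < r" "r < R" for r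
  proof -
    have 1: "u differentiable (at r)" "(\<lambda>s. s\<^sup>2 * deriv u s) differentiable (at r)" 
      "- (1 / r\<^sup>2) * deriv (\<lambda>s. s\<^sup>2 * deriv u s) r = f (u r)"
      using ivp r by (auto simp: radial_ivp_solution_def)
    show "(u has_real_derivative deriv u r) (at r)" using 1(1) by (simp add: DERIV_deriv_iff_real_differentiable)
    have "deriv (\<lambda>s. s\<^sup>2 * deriv u s) r = - f (u r) * r\<^sup>2" using 1(3) r by (simp add: field_simps)
    then show "((\<lambda>s. s\<^sup>2 * deriv u s) has_real_derivative - f (u r) * r\<^sup>2) (at r)"
      using 1(2) by (metis DERIV_deriv_iff_real_differentiable)
  qed
  define ub where "ub = (\<lambda>s. if s \<le> 0 then 1 else if s < R then u s else 0)"
  have ub_cont: "continuous_on UNIV ub"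
  proof (rule continuous_at_imp_continuous_on, rule ballI)
    fix r :: real
    have u_cont: "isCont u r" if "0 < r" "r < R" using DERIV_isCont[OF u_diff[OF that]] .
    have transfer: "isCont ub r" if "isCont k r" "open S" "r \<in> S" "\<And>s. s \<in> S \<Longrightarrow> ub s = k s" for k S
    proof -
      have "\<forall>\<^sub>F s in nhds r. ub s = k s" using that(2-) eventually_nhds by blast
      then show ?thesis using that(1) isCont_cong by blast
    qed
    consider "r < 0" | "r = 0" | "0 < r" "r < R" | "r = R" | "r > R" by linarith
    then show "isCont ub r"
    proof cases
      case 1
      show ?thesis by (rule transfer[of "\<lambda>_. 1" "{..<0}"]) (use 1 in \<open>auto simp: ub_def\<close>)
    next
      case 2
      have "(ub \<longlongrightarrow> 1) (at_right 0)"
        by (rule Lim_transform_eventually[OF u1]) (use eventually_at_right_real[OF R] in \<open>auto elim!: eventually_mono simp: ub_def\<close>)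
      moreover have "((\<lambda>_. 1::real) \<longlongrightarrow> 1) (at_left 0)" by simp
      then have "(ub \<longlongrightarrow> 1) (at_left 0)"
        by (rule Lim_transform_eventually) (auto simp: eventually_at_filter ub_def)
      ultimately show ?thesis unfolding 2 isCont_def by (simp add: filterlim_split_at ub_def)
    next
      case 3
      show ?thesis by (rule transfer[of u "{0<..<R}"]) (use 3 u_cont in \<open>auto simp: ub_def\<close>)
    next
      case 4
      have "(ub \<longlongrightarrow> 0) (at_left R)"
        by (rule Lim_transform_eventually[OF lim]) (use eventually_at_left_real[OF R] in \<open>auto elim!: eventually_mono simp: ub_def\<close>)
      moreover have "((\<lambda>_. 0::real) \<longlongrightarrow> 0) (at_right R)" by simp
      then have "(ub \<longlongrightarrow> 0) (at_right R)"
        by (rule Lim_transform_eventually) (use R in \<open>auto simp: eventually_at_filter ub_def\<close>)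
      ultimately show ?thesis unfolding 4 isCont_def using R by (simp add: filterlim_split_at ub_def)
    next
      case 5
      show ?thesis by (rule transfer[of "\<lambda>_. 0" "{R<..}"]) (use 5 R in \<open>auto simp: ub_def\<close>)
    qed
  qed
  define g where "g = f \<circ> ub"
  have g_cont': "continuous_on UNIV g"
    unfolding g_def by (rule continuous_on_compose[OF ub_cont]) (rule continuous_on_subset[OF f_cont], simp)
  then have g_cont: "continuous_on {0..} g" by (rule continuous_on_subset) simp
  define U where "U = profile g"
  have U_cont: "continuous_on UNIV U" unfolding U_def by (rule continuous_on_profile[OF g_cont])
  have U_deriv: "(U has_real_derivative - (mass g r / r\<^sup>2)) (at r)" if "0 < r" for r
    unfolding U_def by (rule profile_deriv[OF g_cont that])
  have U0: "U 0 = 1" by (simp add: U_def profile_def mass_nonpos_arg[OF g_cont] potential_nonpos_arg[OF g_cont])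
  have U_right: "(U \<longlongrightarrow> 1) (at_right 0)"
    using U_cont U0 by (metis continuous_on_eq_continuous_at filterlim_at_split isCont_def open_UNIV UNIV_I)

  have "((\<lambda>s. s\<^sup>2 * deriv u s + mass g s) has_real_derivative 0) (at r within {0<..<R})" if "r \<in> {0<..<R}" for r
  proof (rule has_field_derivative_at_within)
    have r: "0 < r" "r < R" using that by auto
    show "((\<lambda>s. s\<^sup>2 * deriv u s + mass g s) has_real_derivative 0) (at r)"
      by (rule DERIV_cong[OF DERIV_add[OF q_diff[OF r] mass_deriv[OF g_cont r(1)]]]) (use r in \<open>simp add: g_def ub_def\<close>)
  qed
  then have "\<exists>k. \<forall>s\<in>{0<..<R}. s\<^sup>2 * deriv u s + mass g s = k"
    by (intro has_field_derivative_zero_constant) auto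
  then obtain k where k: "\<And>s. 0 < s \<Longrightarrow> s < R \<Longrightarrow> s\<^sup>2 * deriv u s + mass g s = k" by auto
  have "((\<lambda>s. u s - U s + k / s) has_real_derivative 0) (at r within {0<..<R})" if "r \<in> {0<..<R}" for r
  proof (rule has_field_derivative_at_within)
    have r: "0 < r" "r < R" using that by auto
    have "((\<lambda>s. u s - U s + k / s) has_real_derivative deriv u r - (- (mass g r / r\<^sup>2)) + - (k / r\<^sup>2)) (at r)"
      using r by (auto intro!: derivative_eq_intros u_diff U_deriv simp: power2_eq_square)
    moreover have "deriv u r - (- (mass g r / r\<^sup>2)) + - (k / r\<^sup>2) = 0"
      using k[OF r, symmetric] r by (simp add: field_simps)
    ultimately show "((\<lambda>s. u s - U s + k / s) has_real_derivative 0) (at r)" by simp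
  qed
  then have "\<exists>c. \<forall>s\<in>{0<..<R}. u s - U s + k / s = c"
    by (intro has_field_derivative_zero_constant) auto
  then obtain c where c: "\<And>s. 0 < s \<Longrightarrow> s < R \<Longrightarrow> u s - U s + k / s = c" by auto
  have ev: "\<forall>\<^sub>F s in at_right 0. s \<in> {0<..<R}" using eventually_at_right_real[OF R] .
  have d0: "((\<lambda>s. u s - U s) \<longlongrightarrow> 0) (at_right 0)" using tendsto_diff[OF u1 U_right] by simp
  have "k = 0"
  proof -
    have "((\<lambda>s. s * (c - (u s - U s))) \<longlongrightarrow> 0 * (c - 0)) (at_right 0)"
      by (intro tendsto_intros d0)
    moreover have "\<forall>\<^sub>F s in at_right 0. s * (c - (u s - U s)) = k"
      using ev by eventually_elim (use c in \<open>force simp: field_simps\<close>)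
    ultimately have "((\<lambda>s::real. k) \<longlongrightarrow> 0) (at_right 0)" by (simp add: tendsto_cong)
    then show ?thesis by (simp add: tendsto_const_iff)
  qed
  have "c = 0"
  proof -
    have "\<forall>\<^sub>F s in at_right 0. u s - U s = c"
      using ev by eventually_elim (use c \<open>k = 0\<close> in force)
    then have "((\<lambda>s::real. c) \<longlongrightarrow> 0) (at_right 0)" using d0 by (simp add: tendsto_cong)
    then show ?thesis by (simp add: tendsto_const_iff)
  qed
  have Uu: "U r = u r" if "0 < r" "r < R" for r using c[OF that] \<open>c = 0\<close> \<open>k = 0\<close> by simp
  have UR: "U R = 0"
  proof -
    have "(U \<longlongrightarrow> U R) (at_left R)"
      using U_cont by (metis continuous_on_eq_continuous_at filterlim_at_split isCont_def open_UNIV UNIV_I)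
    moreover have "(U \<longlongrightarrow> 0) (at_left R)"
      by (rule Lim_transform_eventually[OF lim]) (use eventually_at_left_real[OF R] Uu in \<open>auto elim!: eventually_mono\<close>)
    ultimately show ?thesis by (rule tendsto_unique[rotated]) simp
  qed
  have g_nonneg: "0 \<le> g t" for t unfolding g_def using f_pos[of "ub t"] f_0[of "ub t"] by (cases "ub t > 0") auto
  have mass_mono: "mass g a \<le> mass g b" if "0 \<le> a" "a \<le> b" for a b
    unfolding mass_def using that g_nonneg
    by (intro integral_subset_le integrable_continuous_real continuous_on_subset[OF continuous_on_moments(1)[OF g_cont]]) auto
  have mass_pos: "0 < mass g r" if r: "0 < r" for r
  proof -
    define a where "a = min r (R / 2)"
    have a: "0 < a" "a \<le> r" "a < R" using r R by (auto simp: a_def)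
    have "mass g 0 < mass g a"
    proof (rule DERIV_pos_imp_increasing_open[OF a(1) _ continuous_on_mass[OF g_cont]])
      fix x assume x: "0 < x" "x < a"
      then have "0 < g x" using f_pos pos[of x] a by (simp add: g_def ub_def)
      then show "\<exists>y. (mass g has_real_derivative y) (at x) \<and> 0 < y" using mass_deriv[OF g_cont x(1)] x by fastforce
    qed
    then show ?thesis using mass_mono[of a r] a by (simp add: mass_nonpos_arg[OF g_cont])
  qed
  have U_neg: "U r < 0" if r: "R < r" for r
  proof -
    have "U r < U R"
    proof (rule DERIV_neg_imp_decreasing[OF r])
      fix x assume x: "R \<le> x" "x \<le> r"
      then have "0 < x" using R by simp
      then show "\<exists>y. (U has_real_derivative y) (at x) \<and> y < 0" using U_deriv[of x] mass_pos[of x] by (intro exI[of _ "- (mass g x / x\<^sup>2)"]) auto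
    qed
    then show ?thesis by (simp add: UR)
  qed
  have fU: "(f \<circ> U) s = g s" if s: "0 \<le> s" for s
  proof -
    consider "s = 0" | "0 < s" "s < R" | "s = R" | "R < s" using s by linarith
    then show ?thesis
      by cases (use R in \<open>auto simp: g_def ub_def U0 Uu UR f_0 U_neg less_imp_le\<close>)
  qed
  have eqm: "mass (f \<circ> U) r = mass g r" "potential (f \<circ> U) r = potential g r" for r
    unfolding mass_def potential_def using fU by (auto intro!: integral_cong)
  show thesis
  proof (rule that[OF U_cont Uu _ UR U_neg])
    show "0 < U r" if "0 \<le> r" "r < R" for r using that U0 Uu[of r] pos[of r] by (cases "r = 0") auto
    show "0 < mass (f \<circ> U) r" if "0 < r" for r using mass_pos[OF that] by (simp add: eqm)
    show "U r = profile (f \<circ> U) r" if "0 \<le> r" for r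
    proof -
      have "U r = profile g r" by (simp add: U_def)
      then show ?thesis unfolding profile_def eqm .
    qed
  qed
qed

section \<open>Radial potentials, the translation mode and the Volterra equation\<close>

lemma newton_cong:
  assumes "\<And>y. norm y \<le> \<rho> \<Longrightarrow> F y = G y" shows "newton \<rho> F x = newton \<rho> G x"
proof -
  have "(\<lambda>y. indicator (cball 0 \<rho>) y * (F y / norm (x - y))) = (\<lambda>y. indicator (cball 0 \<rho>) y * (G y / norm (x - y)))"
    using assms by (auto simp: indicator_def)
  then show ?thesis by (simp only: newton_def)
qed

lemma bounded_on_Icc:
  fixes k :: "real \<Rightarrow> real"
  assumes "continuous_on UNIV k"
  obtains B where "\<And>s. a \<le> s \<Longrightarrow> s \<le> b \<Longrightarrow> \<bar>k s\<bar> \<le> B"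
proof -
  have "compact (k ` {a..b})" by (rule compact_continuous_image[OF continuous_on_subset[OF assms] compact_Icc]) simp
  then obtain B where "\<forall>s\<in>{a..b}. \<bar>k s\<bar> \<le> B" by (auto dest!: compact_imp_bounded simp: bounded_iff)
  then show ?thesis by (intro that[of B]) simp
qed

text \<open>
  By the shell theorem the shells outside \<open>|x|\<close> contribute the same amount at \<open>x\<close> and at the centre.
\<close>

lemma newton_radial_increment:
  assumes g: "continuous_on UNIV g" and x: "x \<noteq> 0" "norm x \<le> \<rho>"
  shows "newton \<rho> (\<lambda>y. g (norm y)) x - newton \<rho> (\<lambda>y. g (norm y)) 0 = mass g (norm x) / norm x - potential g (norm x)"
proof -
  define r where "r = norm x"
  have r: "0 < r" "r \<le> \<rho>" using x by (auto simp: r_def)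
  have gm: "g \<in> borel_measurable borel" by (rule borel_measurable_continuous_onI[OF g])
  obtain B where B: "\<And>s. 0 \<le> s \<Longrightarrow> s \<le> \<rho> \<Longrightarrow> \<bar>g s\<bar> \<le> B" using bounded_on_Icc[OF g, of 0 \<rho>] by blast
  have shell: "newton \<rho> (\<lambda>y. g (norm y)) z = (LBINT s:{0..\<rho>}. g s * (1 / max (norm z) s) * s\<^sup>2)" for z
    using newton_shell[OF gm B, where \<rho>=\<rho> and c=1 and a=0 and x=z] by simp
  have cont: "continuous_on S g" for S by (rule continuous_on_subset[OF g]) simp
  have c0: "continuous_on S (\<lambda>s. g s * s)" for S by (intro continuous_intros cont)
  have c1: "continuous_on S (\<lambda>s. g s * (1 / max r s) * s\<^sup>2)" for S
    using r by (intro continuous_intros cont) (auto simp: max_def)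
  have LB: "(LBINT s:{0..\<rho>}. k s) = integral {0..\<rho>} k" if "continuous_on {0..\<rho>} k" for k :: "real \<Rightarrow> real"
    using set_borel_integral_eq_integral(2)[OF borel_integrable_atLeastAtMost'[OF that]] .
  have "newton \<rho> (\<lambda>y. g (norm y)) 0 = (LBINT s:{0..\<rho>}. g s * s)"
    unfolding shell by (intro set_lebesgue_integral_cong) (auto simp: max_def power2_eq_square)
  also have "\<dots> = integral {0..\<rho>} (\<lambda>s. g s * s)" by (rule LB[OF c0])
  also have "\<dots> = integral {0..r} (\<lambda>s. g s * s) + integral {r..\<rho>} (\<lambda>s. g s * s)"
    using r by (intro Henstock_Kurzweil_Integration.integral_combine[symmetric] integrable_continuous_real c0) auto
  finally have 0: "newton \<rho> (\<lambda>y. g (norm y)) 0 = potential g r + integral {r..\<rho>} (\<lambda>s. g s * s)"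
    by (simp add: potential_def)
  have "newton \<rho> (\<lambda>y. g (norm y)) x = integral {0..\<rho>} (\<lambda>s. g s * (1 / max r s) * s\<^sup>2)"
    unfolding shell r_def[symmetric] by (rule LB[OF c1])
  also have "\<dots> = integral {0..r} (\<lambda>s. g s * (1 / max r s) * s\<^sup>2) + integral {r..\<rho>} (\<lambda>s. g s * (1 / max r s) * s\<^sup>2)"
    using r by (intro Henstock_Kurzweil_Integration.integral_combine[symmetric] integrable_continuous_real c1) auto
  also have "integral {r..\<rho>} (\<lambda>s. g s * (1 / max r s) * s\<^sup>2) = integral {r..\<rho>} (\<lambda>s. g s * s)"
    using r by (intro integral_cong) (auto simp: max_def power2_eq_square)
  also have "integral {0..r} (\<lambda>s. g s * (1 / max r s) * s\<^sup>2) = integral {0..r} (\<lambda>s. g s * s\<^sup>2 / r)"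
    by (intro integral_cong) (auto simp: max_def)
  also have "\<dots> = mass g r / r" by (simp add: mass_def)
  finally show ?thesis using 0 by (simp add: r_def[symmetric])
qed

text \<open>
  The integrand is \<open>-g'\<close> times \<open>s\<^sup>3 / (3 r\<^sup>2)\<close> inside \<open>r\<close> and times \<open>r / 3\<close> outside, so integration by
  parts reduces the inner part to the mass; the two boundary terms at \<open>r\<close> cancel and \<open>g\<close>
  vanishes at \<open>\<rho>\<close>.
\<close>

lemma dipole_moment:
  fixes g q :: "real \<Rightarrow> real"
  assumes g: "continuous_on UNIV g" and g\<rho>: "g \<rho> = 0" and r: "0 < r" "r \<le> \<rho>"
    and dg: "\<And>s. 0 < s \<Longrightarrow> (g has_real_derivative - q s) (at s)"
    and q0: "\<And>s. 0 \<le> s \<Longrightarrow> 0 \<le> q s" and q: "q \<in> borel_measurable borel"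
  shows "(LBINT s:{0..\<rho>}. q s * (min r s / (3 * (max r s)\<^sup>2)) * s\<^sup>2) = mass g r / r\<^sup>2"
proof -
  have gc: "continuous_on {0..} g" by (rule continuous_on_subset[OF g]) simp
  let ?k = "\<lambda>s. q s * (min r s / (3 * (max r s)\<^sup>2)) * s\<^sup>2"
  let ?F = "\<lambda>s. (3 * mass g s - g s * s ^ 3) / (3 * r\<^sup>2)"
  have "((\<lambda>s. q s * s ^ 3 / (3 * r\<^sup>2)) has_integral (?F r - ?F 0)) {0..r}"
  proof (rule fundamental_theorem_of_calculus_interior)
    show "continuous_on {0..r} ?F"
      using r by (intro continuous_intros continuous_on_mass[OF gc] continuous_on_subset[OF g]) auto
    fix s assume "s \<in> {0<..<r}"
    then have s: "0 < s" by simp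
    have "(?F has_real_derivative (3 * (g s * s\<^sup>2) - (- q s * s ^ 3 + (3 * s\<^sup>2) * g s)) / (3 * r\<^sup>2)) (at s)"
      by (rule DERIV_cdivide, rule DERIV_diff, rule DERIV_cmult[OF mass_deriv[OF gc s]], rule DERIV_mult[OF dg[OF s]])
         (auto intro!: derivative_eq_intros)
    then show "(?F has_vector_derivative q s * s ^ 3 / (3 * r\<^sup>2)) (at s)"
      by (simp add: has_real_derivative_iff_has_vector_derivative algebra_simps)
  qed (use r in simp)
  then have 1: "((\<lambda>s. q s * s ^ 3 / (3 * r\<^sup>2)) has_integral ?F r) {0..r}" by (simp add: mass_nonpos_arg[OF gc])
  have i1: "(?k has_integral ?F r) {0..r}"
    by (rule has_integral_eq[OF _ 1]) (use r in \<open>auto simp: min_def max_def power2_eq_square power3_eq_cube\<close>)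
  have "((\<lambda>s. q s * (r / 3)) has_integral (- g \<rho> * (r / 3) - - g r * (r / 3))) {r..\<rho>}"
  proof (rule fundamental_theorem_of_calculus_interior)
    show "continuous_on {r..\<rho>} (\<lambda>s. - g s * (r / 3))" by (intro continuous_intros continuous_on_subset[OF g]) auto
    fix s assume "s \<in> {r<..<\<rho>}"
    then have s: "0 < s" using r by simp
    show "((\<lambda>s. - g s * (r / 3)) has_vector_derivative q s * (r / 3)) (at s)"
      unfolding has_real_derivative_iff_has_vector_derivative[symmetric]
      using DERIV_cmult_right[OF DERIV_minus[OF dg[OF s]], of "r / 3"] by simp
  qed (use r in simp)
  then have 2: "((\<lambda>s. q s * (r / 3)) has_integral g r * (r / 3)) {r..\<rho>}" by (simp add: g\<rho>)
  have i2: "(?k has_integral g r * (r / 3)) {r..\<rho>}"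
    by (rule has_integral_eq[OF _ 2]) (use r in \<open>auto simp: min_def max_def power2_eq_square\<close>)
  have "(?k has_integral (?F r + g r * (r / 3))) {0..\<rho>}"
    using r by (intro has_integral_combine[OF _ _ i1 i2]) auto
  moreover have "?F r + g r * (r / 3) = mass g r / r\<^sup>2"
    using r by (simp add: field_simps power2_eq_square power3_eq_cube)
  ultimately have I: "(?k has_integral mass g r / r\<^sup>2) {0..\<rho>}" by simp
  have "?k absolutely_integrable_on {0..\<rho>}"
    by (rule nonnegative_absolutely_integrable_1) (use I q0 r in \<open>auto simp: has_integral_integrable\<close>)
  from absolutely_integrable_on_lborel_iff(2)[OF _ _ this] I q show ?thesis
    by (simp add: integral_unique set_lebesgue_integral_def)
qed

lemma gronwall_zero:
  fixes \<eta> :: "real \<Rightarrow> real"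
  assumes \<eta>: "continuous_on UNIV \<eta>" and C: "0 \<le> C"
    and le: "\<And>r. 0 < r \<Longrightarrow> r \<le> \<rho> \<Longrightarrow> \<bar>\<eta> r\<bar> \<le> C * integral {0..r} (\<lambda>s. \<bar>\<eta> s\<bar>)"
    and r: "0 < r" "r \<le> \<rho>"
  shows "\<eta> r = 0"
proof -
  define Y where "Y = (\<lambda>r. integral {0..r} (\<lambda>s. \<bar>\<eta> s\<bar>))"
  have c: "continuous_on S (\<lambda>s. \<bar>\<eta> s\<bar>)" for S
    by (intro continuous_on_rabs continuous_on_subset[OF \<eta>]) simp
  have dY: "(Y has_real_derivative \<bar>\<eta> s\<bar>) (at s)" if "0 < s" for s
    unfolding Y_def by (rule integral_from_0_deriv[OF c that])
  have cY: "continuous_on {0..r} Y"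
    unfolding Y_def by (intro indefinite_integral_continuous_1 integrable_continuous_real c)
  define Z where "Z = (\<lambda>s. exp (- (C * s)) * Y s)"
  have "Z r \<le> Z 0"
  proof (rule DERIV_nonpos_imp_decreasing_open[where f = Z])
    show "0 \<le> r" using r by simp
    show "continuous_on {0..r} Z" unfolding Z_def by (intro continuous_intros cY)
    fix s assume s: "0 < s" "s < r"
    have "(Z has_real_derivative (exp (- (C * s)) * (- C)) * Y s + \<bar>\<eta> s\<bar> * exp (- (C * s))) (at s)"
      unfolding Z_def by (rule DERIV_mult[OF _ dY[OF s(1)]]) (auto intro!: derivative_eq_intros)
    moreover have "(exp (- (C * s)) * (- C)) * Y s + \<bar>\<eta> s\<bar> * exp (- (C * s)) = exp (- (C * s)) * (\<bar>\<eta> s\<bar> - C * Y s)"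
      by (simp add: algebra_simps)
    moreover have "exp (- (C * s)) * (\<bar>\<eta> s\<bar> - C * Y s) \<le> 0"
      using le[of s] s r by (simp add: Y_def mult_le_0_iff)
    ultimately show "\<exists>y. (Z has_real_derivative y) (at s) \<and> y \<le> 0" by metis
  qed
  then have "Y r \<le> 0" by (simp add: Z_def Y_def mult_le_0_iff)
  then have "\<bar>\<eta> r\<bar> \<le> 0" using le[OF r] C by (metis Y_def mult_nonneg_nonpos order_trans)
  then show ?thesis by simp
qed

text \<open>
  The point \<open>x\<close> and its representative in the meridian plane have the same norm and height, so
  they are exchanged by a reflection that preserves axisymmetric functions.
\<close>

lemma meridian_rotation:
  fixes x :: "real^3"
  assumes F: "\<And>y. F y = k (norm y) (y$3)" and Fm: "F \<in> borel_measurable borel"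
  shows "newton \<rho> F (meridian (norm x) (x$3 / norm x)) = newton \<rho> F x"
proof -
  let ?x = "meridian (norm x) (x$3 / norm x)"
  define A where "A = householder (x - ?x)"
  have "\<bar>a\<bar> \<le> 1" if "a \<in> {-1..1}" for a :: real using that by auto
  from this[OF cos_polar_angle_bound] have z: "\<bar>x$3 / norm x\<bar> \<le> 1" .
  have o: "orthogonal_transformation A" unfolding A_def by (rule orthogonal_transformation_householder)
  have "(x - ?x)$3 = 0" by (cases "x = 0") simp_all
  then have 3: "A y $ 3 = y $ 3" for y by (simp add: A_def householder_def)
  have "A x = ?x" unfolding A_def by (rule householder_swap) (simp add: norm_meridian[OF _ z])
  moreover have "F (A y) = F y" for y by (simp add: F 3 orthogonal_transformation_norm[OF o])
  ultimately show ?thesis using newton_orthogonal[OF o Fm, of \<rho> x] by simp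
qed


lemma mass_borel_measurable:
  assumes g: "continuous_on {0..} g" shows "mass g \<in> borel_measurable borel"
proof -
  have "continuous_on {0<..} (mass g)"
    using mass_deriv[OF g] DERIV_isCont by (intro continuous_at_imp_continuous_on ballI) auto
  then have "(\<lambda>s. indicator {0<..} s *\<^sub>R mass g s) \<in> borel_measurable borel"
    by (intro borel_measurable_continuous_on_indicator) auto
  moreover have "(\<lambda>s. indicator {0<..} s *\<^sub>R mass g s) = mass g"
    using mass_nonpos_arg[OF g] by (auto simp: indicator_def fun_eq_iff not_less)
  ultimately show ?thesis by simp
qed

lemma lift_axisym_meridian:
  assumes "0 < r" "r \<le> \<rho>" "\<bar>\<zeta>\<bar> \<le> 1"
  shows "lift_axisym \<rho> h (meridian r \<zeta>) = h r \<zeta>"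
  using assms norm_meridian[of r \<zeta>] by (simp add: lift_axisym_def)

section \<open>Admissibility and condition (HL)\<close>

text \<open>
  A radial solution \<open>U\<close> of the fixed point equation with free boundary \<open>R\<close>, generated by the density
  \<open>f \<circ> U\<close>.
\<close>

locale radial_equilibrium =
  fixes f U :: "real \<Rightarrow> real" and R \<rho> :: real
  assumes f_deriv: "\<And>t. (f has_real_derivative deriv f t) (at t)"
    and f'_cont: "continuous_on UNIV (deriv f)"
    and f'_pos: "\<And>t. 0 < t \<Longrightarrow> 0 < deriv f t" and f_0: "\<And>t. t \<le> 0 \<Longrightarrow> f t = 0" and f'_0: "\<And>t. t \<le> 0 \<Longrightarrow> deriv f t = 0"
    and R: "0 < R" "R < \<rho>"
    and U_cont: "continuous_on UNIV U" and U_pos: "\<And>r. 0 \<le> r \<Longrightarrow> r < R \<Longrightarrow> 0 < U r"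
    and UR: "U R = 0" and U_neg: "\<And>r. R < r \<Longrightarrow> U r < 0"
    and mass_pos: "\<And>r. 0 < r \<Longrightarrow> 0 < mass (f \<circ> U) r"
    and U_profile: "\<And>r. 0 \<le> r \<Longrightarrow> U r = profile (f \<circ> U) r"
begin

abbreviation "g \<equiv> f \<circ> U"

lemma g_cont: "continuous_on UNIV g" "continuous_on {0..} g"
proof -
  have "continuous_on UNIV f" using DERIV_isCont[OF f_deriv] by (simp add: continuous_at_imp_continuous_on)
  then show "continuous_on UNIV g" using continuous_on_compose[OF U_cont] continuous_on_subset by blast
  then show "continuous_on {0..} g" by (rule continuous_on_subset) simp
qed

definition "p s = deriv f (U s)"

lemma p_cont: "continuous_on UNIV p"
  unfolding p_def by (rule continuous_on_compose2[OF f'_cont U_cont]) simp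

lemma p_nonneg: "0 \<le> p s" 
  unfolding p_def using f'_pos[of "U s"] f'_0[of "U s"] by (cases "0 < U s") auto

text \<open>
  The slope \<open>-U'\<close>; thus \<open>v(|y|) (y \<bullet> e) / |y|\<close> is the derivative of \<open>U\<close> in direction \<open>-e\<close>.
\<close>

definition "v s = mass g s / s\<^sup>2"

lemma v_pos: "0 < s \<Longrightarrow> 0 < v s" by (simp add: v_def mass_pos)

lemma U_deriv: "0 < r \<Longrightarrow> (U has_real_derivative - v r) (at r)"
proof -
  assume r: "0 < r"
  show ?thesis
    by (rule has_field_derivative_transform_within_open[OF profile_deriv[OF g_cont(2) r, folded v_def], where S = "{0<..}"])
       (use r U_profile in auto)
qed

lemma g_deriv: "0 < s \<Longrightarrow> (g has_real_derivative - (p s * v s)) (at s)"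
  unfolding comp_def using DERIV_chain2[OF f_deriv U_deriv] by (simp add: p_def)

lemma v_measurable: "v \<in> borel_measurable borel"
  unfolding v_def using mass_borel_measurable[OF g_cont(2)] by measurable

lemma v_bounded: obtains V where "\<And>s. 0 \<le> s \<Longrightarrow> s \<le> \<rho> \<Longrightarrow> \<bar>v s\<bar> \<le> V"
proof -
  obtain B where B: "\<And>s. 0 \<le> s \<Longrightarrow> s \<le> \<rho> \<Longrightarrow> \<bar>g s\<bar> \<le> B" using bounded_on_Icc[OF g_cont(1), of 0 \<rho>] by blast
  have "\<bar>v s\<bar> \<le> B * \<rho>" if s: "0 \<le> s" "s \<le> \<rho>" for s
  proof (cases "s = 0")
    case True
    have "0 \<le> B" using B[of 0] R by linarith
    then show ?thesis using True R by (simp add: v_def)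
  next
    case False
    then have "\<bar>v s\<bar> \<le> B * s" using mass_bound[OF g_cont(2) s B] s
      by (simp add: v_def abs_divide divide_le_eq mult_ac comp_def)
    also have "\<dots> \<le> B * \<rho>" using s B[of 0] R by (intro mult_left_mono) auto
    finally show ?thesis .
  qed
  then show ?thesis using that by blast
qed

text \<open>
  The derivative of the equation \<open>U = const + newton (f \<circ> U)\<close> in direction \<open>-e\<close>, verified by the
  dipole part of the shell theorem.
\<close>

lemma newton_translation_mode:
  assumes x: "x \<noteq> 0" "norm x \<le> \<rho>"
  shows "newton \<rho> (\<lambda>y. p (norm y) * (v (norm y) * (y \<bullet> e / norm y))) x = v (norm x) * (x \<bullet> e / norm x)"
proof -
  have pm: "p \<in> borel_measurable borel" by (rule borel_measurable_continuous_onI[OF p_cont])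
  have m: "(\<lambda>s. p s * v s) \<in> borel_measurable borel" using pm v_measurable by measurable
  obtain V where V: "\<And>s. 0 \<le> s \<Longrightarrow> s \<le> \<rho> \<Longrightarrow> \<bar>v s\<bar> \<le> V" using v_bounded by blast
  obtain B where B: "\<And>s. 0 \<le> s \<Longrightarrow> s \<le> \<rho> \<Longrightarrow> \<bar>p s\<bar> \<le> B" using bounded_on_Icc[OF p_cont, of 0 \<rho>] by blast
  have bd: "\<bar>p s * v s\<bar> \<le> B * V" if "0 \<le> s" "s \<le> \<rho>" for s
    unfolding abs_mult using B[OF that] V[OF that] by (intro mult_mono) auto
  have "newton \<rho> (\<lambda>y. (p (norm y) * v (norm y)) * (0 + y \<bullet> e / norm y)) x =
     (LBINT s:{0..\<rho>}. p s * v s * (0 / max (norm x) s + x \<bullet> e / norm x * min (norm x) s / (3 * (max (norm x) s)\<^sup>2)) * s\<^sup>2)"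
    by (rule newton_shell[OF m bd])
  also have "\<dots> = (LBINT s:{0..\<rho>}. (x \<bullet> e / norm x) * (p s * v s * (min (norm x) s / (3 * (max (norm x) s)\<^sup>2)) * s\<^sup>2))"
    by (simp add: mult_ac)
  also have "\<dots> = (x \<bullet> e / norm x) * (LBINT s:{0..\<rho>}. p s * v s * (min (norm x) s / (3 * (max (norm x) s)\<^sup>2)) * s\<^sup>2)"
    by (rule set_integral_mult_right)
  also have "(LBINT s:{0..\<rho>}. p s * v s * (min (norm x) s / (3 * (max (norm x) s)\<^sup>2)) * s\<^sup>2) = v (norm x)"
    unfolding v_def[of "norm x"]
  proof (rule dipole_moment[OF g_cont(1) _ _ x(2) g_deriv _ m])
    show "g \<rho> = 0" using f_0 U_neg[of \<rho>] R by simp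
    show "0 \<le> p s * v s" if "0 \<le> s" for s
    proof (rule mult_nonneg_nonneg[OF p_nonneg])
      show "0 \<le> v s" using less_imp_le[OF v_pos[of s]] that by (cases "s = 0") (simp_all add: v_def)
    qed
  qed (use x in auto)
  finally show ?thesis by (simp add: mult_ac)
qed

lemma lift_radial: "norm y \<le> \<rho> \<Longrightarrow> lift_axisym \<rho> (\<lambda>s \<eta>. k s) y = k (norm y)"
  by (simp add: lift_axisym_def)

lemma K_op_radial:
  assumes k: "continuous_on UNIV k" and r: "0 \<le> r" "r \<le> \<rho>" and \<zeta>: "\<bar>\<zeta>\<bar> \<le> 1"
  shows "K_op \<rho> (\<lambda>s \<eta>. k s) r \<zeta> - K_op \<rho> (\<lambda>s \<eta>. k s) 0 0 = mass k r / r - potential k r"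
proof -
  have c: "continuous_on ({0..\<rho>} \<times> {-1..1}) (\<lambda>(s, \<eta>). k s)"
    unfolding case_prod_beta by (rule continuous_on_compose2[OF k]) (auto intro: continuous_intros)
  have K: "K_op \<rho> (\<lambda>s \<eta>. k s) s \<eta> = newton \<rho> (\<lambda>y. k (norm y)) (meridian s \<eta>)" if "0 \<le> s" "\<bar>\<eta>\<bar> \<le> 1" for s \<eta>
    unfolding K_op_eq_newton[OF c that] by (rule newton_cong) (rule lift_radial)
  have m0: "meridian 0 0 = 0" by (simp add: vec_eq_iff forall_3)
  have n: "norm (meridian r \<zeta>) = r" by (rule norm_meridian[OF r(1) \<zeta>])
  show ?thesis
  proof (cases "r = 0")
    case True
    have "meridian r \<zeta> = 0" using n True by simp
    then show ?thesis using True K[OF r(1) \<zeta>] K[of 0 0] m0 by (simp add: mass_def potential_def)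
  next
    case False
    then have "meridian r \<zeta> \<noteq> 0" using n by auto
    from newton_radial_increment[OF k this] n r(2) show ?thesis
      by (simp add: K[OF r(1) \<zeta>] K[of 0 0] m0)
  qed
qed

lemma admissible: "admissible_solution f \<rho> (\<lambda>_. 0) (\<lambda>r \<zeta>. U r)"
  unfolding admissible_solution_def
proof (intro conjI)
  show "(\<lambda>_. 0) \<in> B_space \<rho>" by (auto simp: B_space_def intro!: exI[of _ "\<lambda>_. 0"])
  have "continuous_on ({0..\<rho>} \<times> {-1..1::real}) (\<lambda>(r, \<zeta>). U r)"
    unfolding case_prod_beta by (rule continuous_on_compose2[OF U_cont]) (auto intro: continuous_intros)
  then show "(\<lambda>r \<zeta>. U r) \<in> E_space \<rho>" by (simp add: E_space_def)
  show "\<forall>r\<in>{0..\<rho>}. \<forall>\<zeta>\<in>{-1..1}. U r = g_fun (\<lambda>_. 0) r \<zeta> + G_op f \<rho> (\<lambda>r \<zeta>. U r) r \<zeta>"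
  proof (intro ballI)
    fix r \<zeta> :: real assume "r \<in> {0..\<rho>}" "\<zeta> \<in> {-1..1}"
    then have r: "0 \<le> r" "r \<le> \<rho>" "\<bar>\<zeta>\<bar> \<le> 1" by auto
    show "U r = g_fun (\<lambda>_. 0) r \<zeta> + G_op f \<rho> (\<lambda>r \<zeta>. U r) r \<zeta>"
      using K_op_radial[OF g_cont(1) r] U_profile[OF r(1)] by (simp add: g_fun_def G_op_def profile_def comp_def)
  qed
  show "\<exists>r\<^sub>0 R. 0 < r\<^sub>0 \<and> r\<^sub>0 < \<rho> \<and> continuous_on {-1..1} R \<and> (\<forall>\<zeta>\<in>{-1..1}. R \<zeta> \<in> {r\<^sub>0<..<\<rho>}) \<and>
        (\<forall>r\<in>{r\<^sub>0..\<rho>}. \<forall>\<zeta>\<in>{-1..1::real}. \<exists>D<0. (U has_real_derivative D) (at r within {0..\<rho>})) \<and>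
        (\<forall>\<zeta>\<in>{-1..1}. (\<forall>r\<in>{0..<R \<zeta>}. 0 < U r) \<and> U (R \<zeta>) = 0 \<and> (\<forall>r\<in>{R \<zeta><..\<rho>}. U r < 0))"
  proof (rule exI[of _ "R / 2"], rule exI[of _ "\<lambda>_. R"], intro conjI ballI)
    fix r \<zeta> :: real assume "r \<in> {R / 2..\<rho>}" "\<zeta> \<in> {-1..1}"
    then have "0 < r" using R by auto
    then show "\<exists>D<0. (U has_real_derivative D) (at r within {0..\<rho>})"
      using v_pos[of r] U_deriv[of r] by (intro exI[of _ "- v r"]) (auto intro: has_field_derivative_at_within)
  qed (use R U_pos UR U_neg in auto)
qed

text \<open>
  The lift \<open>H\<close> of \<open>h\<close> is radial because \<open>H(-x) = H(x)\<close>, by axisymmetry and the equatorial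
  symmetry of \<open>h\<close>. The radial function \<open>\<eta>\<close> then satisfies \<open>\<eta>(r) = -\<integral>\<^sub>0\<^sup>r p \<eta> s (1 - s/r) ds\<close>, and
  Gronwall's inequality applies.
\<close>

lemma HL: "cond_HL f \<rho> (\<lambda>r \<zeta>. U r)"
  unfolding cond_HL_def
proof (intro ballI impI)
  fix h assume h: "h \<in> E_space \<rho>"
  assume eq: "\<forall>r\<in>{0..\<rho>}. \<forall>\<zeta>\<in>{-1..1}. h r \<zeta> = DG_op f \<rho> (\<lambda>r \<zeta>. U r) h r \<zeta>"
  have E: "continuous_on ({0..\<rho>} \<times> {-1..1}) (\<lambda>(r, \<zeta>). h r \<zeta>) \<and> (\<forall>\<zeta>\<in>{-1..1}. h 0 \<zeta> = h 0 0) \<and>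
      (\<forall>r\<in>{0..\<rho>}. \<forall>\<zeta>\<in>{-1..1}. h r (- \<zeta>) = h r \<zeta>)"
    using h unfolding E_space_def mem_Collect_eq .
  have hc: "continuous_on ({0..\<rho>} \<times> {-1..1}) (\<lambda>(r, \<zeta>). h r \<zeta>)" using E by blast
  have h0: "h 0 \<zeta> = h 0 0" if "\<bar>\<zeta>\<bar> \<le> 1" for \<zeta>
  proof -
    have "\<zeta> \<in> {-1..1}" using that by auto
    then show ?thesis using E by blast
  qed
  have he: "h r (- \<zeta>) = h r \<zeta>" if "0 \<le> r" "r \<le> \<rho>" "\<bar>\<zeta>\<bar> \<le> 1" for r \<zeta>
  proof -
    have "r \<in> {0..\<rho>}" "\<zeta> \<in> {-1..1}" using that by auto
    then show ?thesis using E by blast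
  qed
  define q where "q = (\<lambda>s \<eta>. p s * h s \<eta>)"
  define H where "H = lift_axisym \<rho> h"
  have eq': "h r \<zeta> = K_op \<rho> q r \<zeta> - K_op \<rho> q 0 0" if "0 \<le> r" "r \<le> \<rho>" "\<bar>\<zeta>\<bar> \<le> 1" for r \<zeta>
  proof -
    have "r \<in> {0..\<rho>}" "\<zeta> \<in> {-1..1}" using that by auto
    then have "h r \<zeta> = DG_op f \<rho> (\<lambda>r \<zeta>. U r) h r \<zeta>" using eq by blast
    then show ?thesis unfolding DG_op_def q_def p_def .
  qed
  have h00: "h 0 0 = 0" using eq'[of 0 0] R by simp
  have pc2: "continuous_on ({0..\<rho>} \<times> {-1..1::real}) (\<lambda>z. p (fst z))"
    by (rule continuous_on_compose2[OF p_cont]) (auto intro: continuous_intros)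
  have qc: "continuous_on ({0..\<rho>} \<times> {-1..1}) (\<lambda>(r, \<zeta>). q r \<zeta>)"
    using continuous_on_mult[OF pc2 hc] by (simp add: q_def case_prod_beta)
  have Hm [measurable]: "H \<in> borel_measurable borel" unfolding H_def by (rule lift_axisym_measurable[OF hc])
  have pm [measurable]: "p \<in> borel_measurable borel" by (rule borel_measurable_continuous_onI[OF p_cont])
  obtain B where HB: "\<And>y. \<bar>H y\<bar> \<le> B" unfolding H_def using lift_axisym_bounded[OF hc] by blast
  have lq: "lift_axisym \<rho> q = (\<lambda>y. p (norm y) * H y)" by (auto simp: fun_eq_iff lift_axisym_def q_def H_def)
  have abs1: "\<bar>a\<bar> \<le> 1" if "a \<in> {-1..1}" for a :: real using that by auto
  note ang = abs1[OF cos_polar_angle_bound]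
  have Hk: "H y = (if norm y \<le> \<rho> then h (norm y) (y$3 / norm y) else 0)" for y by (simp add: H_def lift_axisym_def)
  have pHm: "(\<lambda>y. p (norm y) * H y) \<in> borel_measurable borel" by measurable
  define C where "C = K_op \<rho> q 0 0"
  have fixH: "H x = newton \<rho> (\<lambda>y. p (norm y) * H y) x - C" if x: "norm x \<le> \<rho>" for x
  proof -
    have "H x = K_op \<rho> q (norm x) (x$3 / norm x) - C"
      using eq'[OF norm_ge_zero x ang] x by (simp add: Hk C_def)
    also have "K_op \<rho> q (norm x) (x$3 / norm x) = newton \<rho> (\<lambda>y. p (norm y) * H y) (meridian (norm x) (x$3 / norm x))"
      unfolding K_op_eq_newton[OF qc norm_ge_zero ang] lq ..
    also have "\<dots> = newton \<rho> (\<lambda>y. p (norm y) * H y) x"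
      by (rule meridian_rotation[where k = "\<lambda>s t. p s * (if s \<le> \<rho> then h s (t / s) else 0)"])
         (simp add: Hk, rule pHm)
    finally show ?thesis .
  qed
  have even: "H (- y) = H y" for y
    using he[OF norm_ge_zero[of y] _ ang[of y]] by (simp add: Hk)
  obtain V where V: "\<And>s. 0 \<le> s \<Longrightarrow> s \<le> \<rho> \<Longrightarrow> \<bar>v s\<bar> \<le> V" using v_bounded by blast
  obtain M where M: "\<And>s. 0 \<le> s \<Longrightarrow> s \<le> \<rho> \<Longrightarrow> \<bar>p s\<bar> \<le> M" using bounded_on_Icc[OF p_cont, of 0 \<rho>] by blast
  have M': "p s \<le> M" if "0 \<le> s" "s \<le> \<rho>" for s using M[OF that] by linarith
  have pR: "0 < p s" if "0 \<le> s" "s < R" for s unfolding p_def by (rule f'_pos[OF U_pos[OF that]])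
  have radial: "H x\<^sub>1 = H x\<^sub>2" if "norm x\<^sub>1 = norm x\<^sub>2" "norm x\<^sub>1 \<le> \<rho>" for x\<^sub>1 x\<^sub>2
    by (rule rotation_invariant_of_newton_fixed_point[where p = p and v = v and C = C and R = R and \<rho> = \<rho> and H = H,
          OF R(1) less_imp_le[OF R(2)] pm p_nonneg pR M' v_measurable v_pos V newton_translation_mode Hm HB even fixH that])
  \<comment> \<open>Clamping the argument makes the profile continuous on the whole line.\<close>
  define \<eta> where "\<eta> = (\<lambda>r. h (max 0 (min r \<rho>)) 0)"
  have \<eta>: "\<eta> r = h r 0" if "0 \<le> r" "r \<le> \<rho>" for r using that by (simp add: \<eta>_def)
  have \<eta>c: "continuous_on UNIV \<eta>"
  proof -
    have "continuous_on UNIV (\<lambda>r. (\<lambda>(r, \<zeta>). h r \<zeta>) (max 0 (min r \<rho>), 0))"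
      by (rule continuous_on_compose2[OF hc]) (use R in \<open>auto intro!: continuous_intros\<close>)
    then show ?thesis by (simp add: \<eta>_def)
  qed
  have h\<eta>: "h r \<zeta> = \<eta> r" if r: "0 \<le> r" "r \<le> \<rho>" "\<bar>\<zeta>\<bar> \<le> 1" for r \<zeta>
  proof (cases "r = 0")
    case True
    then show ?thesis using h0[OF r(3)] R by (simp add: \<eta>_def)
  next
    case False
    then have r0: "0 < r" using r by simp
    have "H (meridian r \<zeta>) = H (meridian r 0)" using r by (intro radial) (simp_all add: norm_meridian)
    then show ?thesis using lift_axisym_meridian[OF r0 r(2)] r by (simp add: H_def \<eta>)
  qed
  have k: "continuous_on UNIV (\<lambda>s. p s * \<eta> s)" by (intro continuous_intros p_cont \<eta>c)
  have \<eta>_eq: "\<eta> r = mass (\<lambda>s. p s * \<eta> s) r / r - potential (\<lambda>s. p s * \<eta> s) r" if r: "0 < r" "r \<le> \<rho>" for r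
  proof -
    have K: "K_op \<rho> q s \<zeta> = K_op \<rho> (\<lambda>s \<zeta>. p s * \<eta> s) s \<zeta>" if "0 \<le> s" "s \<le> \<rho>" "\<bar>\<zeta>\<bar> \<le> 1" for s \<zeta>
    proof -
      have kc: "continuous_on ({0..\<rho>} \<times> {-1..1}) (\<lambda>(s, \<zeta>). p s * \<eta> s)"
        unfolding case_prod_beta by (rule continuous_on_compose2[OF k]) (auto intro: continuous_intros)
      show ?thesis
        unfolding K_op_eq_newton[OF qc that(1,3)] K_op_eq_newton[OF kc that(1,3)]
        by (rule newton_cong) (simp add: lift_axisym_def q_def h\<eta>[OF norm_ge_zero _ ang])
    qed
    have "\<eta> r = K_op \<rho> q r 0 - K_op \<rho> q 0 0" using eq'[of r 0] r \<eta> by simp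
    also have "\<dots> = K_op \<rho> (\<lambda>s \<zeta>. p s * \<eta> s) r 0 - K_op \<rho> (\<lambda>s \<zeta>. p s * \<eta> s) 0 0"
      using r R by (simp add: K)
    also have "\<dots> = mass (\<lambda>s. p s * \<eta> s) r / r - potential (\<lambda>s. p s * \<eta> s) r"
      using r by (intro K_op_radial k) auto
    finally show ?thesis .
  qed
  have M0: "0 \<le> M" using M[of 0] R by linarith
  have \<eta>_le: "\<bar>\<eta> r\<bar> \<le> (M * \<rho>) * integral {0..r} (\<lambda>s. \<bar>\<eta> s\<bar>)" if r: "0 < r" "r \<le> \<rho>" for r
  proof -
    let ?k = "\<lambda>s. p s * \<eta> s"
    have kc: "continuous_on S ?k" for S by (rule continuous_on_subset[OF k]) simp
    have "\<eta> r = integral {0..r} (\<lambda>s. ?k s * s\<^sup>2 / r) - integral {0..r} (\<lambda>s. ?k s * s)"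
      unfolding \<eta>_eq[OF r] mass_def potential_def by simp
    also have "\<dots> = integral {0..r} (\<lambda>s. ?k s * s\<^sup>2 / r - ?k s * s)"
      using r by (intro integral_diff[symmetric] integrable_continuous_real continuous_intros kc) auto
    finally have "\<bar>\<eta> r\<bar> = norm (integral {0..r} (\<lambda>s. ?k s * s\<^sup>2 / r - ?k s * s))" by simp
    also have "\<dots> \<le> integral {0..r} (\<lambda>s. M * \<rho> * \<bar>\<eta> s\<bar>)"
    proof (rule integral_norm_bound_integral)
      show "(\<lambda>s. ?k s * s\<^sup>2 / r - ?k s * s) integrable_on {0..r}"
        using r by (intro integrable_continuous_real continuous_intros kc) auto
      show "(\<lambda>s. M * \<rho> * \<bar>\<eta> s\<bar>) integrable_on {0..r}"
        by (intro integrable_continuous_real continuous_intros continuous_on_subset[OF \<eta>c]) auto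
      fix s assume "s \<in> {0..r}"
      then have s: "0 \<le> s" "s \<le> r" "s \<le> \<rho>" using r by auto
      have "?k s * s\<^sup>2 / r - ?k s * s = - (p s * (s * (1 - s / r)) * \<eta> s)" by (simp add: power2_eq_square field_simps)
      moreover have "\<bar>p s * (s * (1 - s / r))\<bar> \<le> M * (\<rho> * 1)"
        unfolding abs_mult using s r M[OF s(1,3)] M0 by (intro mult_mono) auto
      ultimately show "norm (?k s * s\<^sup>2 / r - ?k s * s) \<le> M * \<rho> * \<bar>\<eta> s\<bar>"
        by (simp add: abs_mult mult_right_mono)
    qed
    finally show ?thesis by simp
  qed
  have \<eta>0: "\<eta> r = 0" if "0 \<le> r" "r \<le> \<rho>" for r
  proof (cases "r = 0")
    case True
    then show ?thesis using h00 R by (simp add: \<eta>_def)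
  next
    case False
    show ?thesis by (rule gronwall_zero[OF \<eta>c _ \<eta>_le]) (use M0 R that False in auto)
  qed
  fix r \<zeta> :: real assume "r \<in> {0..\<rho>}" "\<zeta> \<in> {-1..1}"
  then show "h r \<zeta> = 0" using h\<eta>[of r \<zeta>] \<eta>0[of r] by auto
qed

end

theorem theorem2:
  fixes A \<gamma> \<nu> u\<^sub>O R r_inf :: real
    and \<Lambda> P \<Lambda>\<^sub>\<rho> f u :: "real \<Rightarrow> real"
  assumes eos: "equation_of_state A \<gamma> \<Lambda> P"
    and inversion: "enthalpy_inversion A \<gamma> P \<Lambda>\<^sub>\<rho>"
    and nu: "\<nu> = 1 / (\<gamma> - 1)"
    and uO: "u\<^sub>O > 0"
    and f: "f = f_source \<nu> \<Lambda>\<^sub>\<rho> u\<^sub>O"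
    and R: "0 < R"
    and ivp: "radial_ivp_solution f R u"
    and pos: "\<And>r. 0 < r \<Longrightarrow> r < R \<Longrightarrow> u r > 0"
    and lim: "(u \<longlongrightarrow> 0) (at_left R)"
    and r_inf_gt: "R < r_inf"
  shows "\<exists>U :: real \<Rightarrow> real. (\<forall>r\<in>{0<..<R}. U r = u r) \<and>
           admissible_solution f r_inf (\<lambda>_. 0) (\<lambda>r \<zeta>. U r) \<and>
           cond_HL f r_inf (\<lambda>r \<zeta>. U r)"
proof -
  interpret enthalpy_inverse A \<gamma> \<Lambda> P \<Lambda>\<^sub>\<rho> by unfold_locales (fact eos, fact inversion)
  have f': "f = f_source (1 / (\<gamma> - 1)) \<Lambda>\<^sub>\<rho> u\<^sub>O" using f nu by simp
  note f_reg = source_regular[OF uO f'[folded \<nu>_def]]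
  have f_cont: "continuous_on UNIV f" using DERIV_isCont[OF f_reg(1)] by (simp add: continuous_at_imp_continuous_on)
  obtain U where U: "continuous_on UNIV U" "\<And>r. 0 < r \<Longrightarrow> r < R \<Longrightarrow> U r = u r" "\<And>r. 0 \<le> r \<Longrightarrow> r < R \<Longrightarrow> 0 < U r"
    "U R = 0" "\<And>r. R < r \<Longrightarrow> U r < 0" "\<And>r. 0 < r \<Longrightarrow> 0 < mass (f \<circ> U) r" "\<And>r. 0 \<le> r \<Longrightarrow> U r = profile (f \<circ> U) r"
    using radial_extension[OF f_cont f_reg(3,5) R ivp pos lim] by blast
  interpret radial_equilibrium f U R r_inf
    by unfold_locales (use f_reg U R r_inf_gt in auto)
  show ?thesis using U(2) admissible HL by (intro exI[of _ U]) auto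
qed

end
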